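(* Let $$\varphi(x):=\tfrac12\langle Ax,x\rangle+\langle b,x\rangle+\alpha+g(x),\quad x\in\mathbb{R}^n,$$ where $A\in\mathbb{R}^{n\times n}$ is symmetric, $b\in\mathbb{R}^n$, $\alpha\in\mathbb{R}$, and let $\bar x$ satisfy $0\in\partial\varphi(\bar x)$. Let $g\colon\mathbb{R}^n\to(-\infty,\infty]$ be (proper, lower semicontinuous and) prox-bounded on $\mathbb{R}^n$ and continuously prox-regular at $\bar x$ for $-A\bar x-b$, and let $r>0$ be a constant of prox-regularity of $g$. Suppose that: (a) there is a neighborhood $U'\times V'$ of $(\bar x,0)$ such that for every $(x,v)\in\mathrm{gph}\,\partial\varphi\cap(U'\times V')$ there exists $d\in\mathbb{R}^n$ satisfying $-v\in\partial^2\varphi(x,v)(d)$; (b) $\partial\varphi$ is metrically regular around $(\bar x,0)$; (c) $\partial\varphi$ is semismooth$^*$ at $(\bar x,0)$. Consider the following algorithm with a parameter $\gamma\in(0,r^{-1})$ such that $I-\gamma A$ is nonsingular and a starting point $x^0$. For $k=0,1,\ldots$: if $0\in\partial\varphi(x^k)$, stop; otherwise compute $$u^k:=x^k-\gamma(Ax^k+b),\qquad v^k:=\mathrm{Prox}_{\gamma g}(u^k),$$ choose $d^k\in\mathbb{R}^n$ such that $$-\tfrac1\gamma(x^k-v^k)-Ad^k\in\partial^2g\Big(v^k,\tfrac1\gamma(u^k-v^k)\Big)(x^k-v^k+d^k),$$ and set $x^{k+1}:=x^k+d^k$. Then there exists a neighborhood $U$ of $\bar x$ such that for any starting point $x^0\in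 U$ the algorithm is well-defined and generates a sequence of iterates $\{x^k\}$ which converges $Q$-superlinearly to the solution $\bar x$ of the subgradient inclusion $0\in\partial\varphi(x)$.
   Context: For $\Omega\subset\mathbb{R}^s$ and $\bar z\in\Omega$: $\widehat N_\Omega(\bar z)=\{v:\limsup_{z\to\bar z,\,z\in\Omega}\frac{\langle v,z-\bar z\rangle}{\|z-\bar z\|}\le 0\}$; $N_\Omega(\bar z)=\{v:\exists\, z_k\to\bar z,\ z_k\in\Omega,\ v_k\to v,\ v_k\in\widehat N_\Omega(z_k)\}$; and for $d\in\mathbb{R}^s$, $N_\Omega(\bar z;d)=\{v:\exists\,t_k\downarrow0,\ d_k\to d,\ v_k\to v,\ v_k\in\widehat N_\Omega(\bar z+t_kd_k)\}$. For $F\colon\mathbb{R}^n\rightrightarrows\mathbb{R}^m$ and $(x,y)\in\mathrm{gph}\,F$, the limiting coderivative is $D^*F(x,y)(v)=\{u:(u,-v)\in N_{\mathrm{gph}\,F}(x,y)\}$, and the directional limiting coderivative in the direction $(u,v)$ is $D^*F((x,y);(u,v))(v^* )=\{u^*:(u^*,-v^* )\in N_{\mathrm{gph}\,F}((x,y);(u,v))\}$. For $\psi\colon\mathbb{R}^n\to(-\infty,\infty]$ the limiting subdifferential at $x\in\mathrm{dom}\,\psi$ is $\partial\psi(x)=\{v:(v,-1)\in N_{\mathrm{epi}\,\psi}(x,\psi(x))\}$ (empty off $\mathrm{dom}\,\psi$), and $\partial^2\psi(x,v)(u)=(D^*\partial\psi)(x,v)(u)$ for $v\in\partial\psi(x)$.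 $\psi$ is prox-regular at $\bar x\in\mathrm{dom}\,\psi$ for $\bar v\in\partial\psi(\bar x)$ with constant (modulus) $r>0$ if it is lower semicontinuous around $\bar x$ and there is $\epsilon>0$ such that for all $x,u\in\mathbb{B}_\epsilon(\bar x)$ with $|\psi(u)-\psi(\bar x)|<\epsilon$ one has $\psi(x)\ge\psi(u)+\langle v,x-u\rangle-\frac r2\|x-u\|^2$ whenever $v\in\partial\psi(u)\cap\mathbb{B}_\epsilon(\bar v)$. $\psi$ is subdifferentially continuous at $\bar x$ for $\bar v$ if $(x_k,v_k)\to(\bar x,\bar v)$ with $v_k\in\partial\psi(x_k)$ implies $\psi(x_k)\to\psi(\bar x)$. Continuously prox-regular means both. $\psi$ is prox-bounded if it is bounded from below by a quadratic function on $\mathbb{R}^n$. $\mathrm{Prox}_{\gamma g}(x)=\mathrm{argmin}_{y\in\mathbb{R}^n}\{g(y)+\frac1{2\gamma}\|y-x\|^2\}$. $F$ is metrically regular around $(\bar x,\bar y)\in\mathrm{gph}\,F$ if there are $\mu>0$ and neighborhoods $U$ of $\bar x$, $V$ of $\bar y$ with $\mathrm{dist}(x;F^{-1}(y))\le\mu\,\mathrm{dist}(y;F(x))$ for all $(x,y)\in U\times V$ (distance to the empty set is $\infty$). $F$ is semismooth$^*$ at $(\bar x,\bar y)\in\mathrm{gph}\,F$ if for every $(u,v)$ one has $\langle u^*,u\rangle=\langle v^*,v\rangle$ for all $(v^*,u^* )\in\mathrm{gph}\,D^*F((\bar x,\bar y);(u,v))$. "Well-defined" means that each step of the algorithm can be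 performed at each non-terminal iterate ($\mathrm{Prox}_{\gamma g}(u^k)$ is a singleton and a suitable $d^k$, which may be chosen arbitrarily, exists). $Q$-superlinear convergence means $x^k\to\bar x$ and $\|x^{k+1}-\bar x\|/\|x^k-\bar x\|\to0$; if the algorithm stops at some $x^k$, it is understood as $x^k=\bar x$.
   Formalization: The constant r of prox-regularity is additionally assumed to satisfy g(x) ≥ g(x̄) + ⟨−Ax̄−b, x−x̄⟩ − (r/2)‖x−x̄‖² for all x; without this Prox_{γg} can be empty for γ < 1/r (e.g. g = min(0,1−x²), A = 1, r = 1/4, γ = 2). *)

theory Defs
  imports "HOL-Analysis.Analysis"
begin

text \<open>Normal cones. A regular normal exists only at points of the set; at an isolated point the
  filter is \<open>bot\<close>, the upper limit is \<open>-\<infinity>\<close>, and every vector is a regular normal.\<close>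

definition regular_normal_cone :: "'a::euclidean_space set \<Rightarrow> 'a \<Rightarrow> 'a set" where
  "regular_normal_cone \<Omega> zbar =
     {v. zbar \<in> \<Omega> \<and>
         Limsup (at zbar within \<Omega>) (\<lambda>z. ereal (inner v (z - zbar) / norm (z - zbar))) \<le> 0}"

definition normal_cone :: "'a::euclidean_space set \<Rightarrow> 'a \<Rightarrow> 'a set" where
  "normal_cone \<Omega> zbar =
     {v. zbar \<in> \<Omega> \<and>
         (\<exists>z w. z \<longlonglongrightarrow> zbar \<and> (\<forall>k. z k \<in> \<Omega>) \<and> w \<longlonglongrightarrow> v \<and>
                (\<forall>k. w k \<in> regular_normal_cone \<Omega> (z k)))}"

definition dir_normal_cone :: "'a::euclidean_space set \<Rightarrow> 'a \<Rightarrow> 'a \<Rightarrow> 'a set" where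
  "dir_normal_cone \<Omega> zbar d =
     {v. zbar \<in> \<Omega> \<and>
         (\<exists>t e w. (\<forall>k. t k > (0::real)) \<and> t \<longlonglongrightarrow> 0 \<and> e \<longlonglongrightarrow> d \<and> w \<longlonglongrightarrow> v \<and>
                  (\<forall>k. w k \<in> regular_normal_cone \<Omega> (zbar + t k *\<^sub>R e k)))}"

text \<open>Set-valued mappings are functions into sets. The coderivatives at a point outside the graph
  are empty, because the normal cones are.\<close>

definition gph :: "('a \<Rightarrow> 'b set) \<Rightarrow> ('a \<times> 'b) set" where
  "gph F = {(x, y). y \<in> F x}"

definition coderivative ::
  "('a::euclidean_space \<Rightarrow> 'b::euclidean_space set) \<Rightarrow> 'a \<Rightarrow> 'b \<Rightarrow> 'b \<Rightarrow> 'a set" where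
  "coderivative F x y v = {u. (u, - v) \<in> normal_cone (gph F) (x, y)}"

definition dir_coderivative ::
  "('a::euclidean_space \<Rightarrow> 'b::euclidean_space set) \<Rightarrow> 'a \<times> 'b \<Rightarrow> 'a \<times> 'b \<Rightarrow> 'b \<Rightarrow> 'a set" where
  "dir_coderivative F p q vs = {us. (us, - vs) \<in> dir_normal_cone (gph F) p q}"

definition semismooth_star ::
  "('a::euclidean_space \<Rightarrow> 'b::euclidean_space set) \<Rightarrow> 'a \<Rightarrow> 'b \<Rightarrow> bool" where
  "semismooth_star F xbar ybar \<longleftrightarrow>
     (xbar, ybar) \<in> gph F \<and>
     (\<forall>u v. \<forall>(vs, us) \<in> gph (dir_coderivative F (xbar, ybar) (u, v)). inner us u = inner vs v)"

text \<open>Extended-valued distance, equal to \<open>\<infinity>\<close> for the empty set (unlike \<^const>\<open>infdist\<close>).\<close>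

definition edist_set :: "'a::metric_space \<Rightarrow> 'a set \<Rightarrow> ereal" where
  "edist_set x S = (INF s\<in>S. ereal (dist x s))"

definition metrically_regular ::
  "('a::euclidean_space \<Rightarrow> 'b::euclidean_space set) \<Rightarrow> 'a \<Rightarrow> 'b \<Rightarrow> bool" where
  "metrically_regular F xbar ybar \<longleftrightarrow>
     (xbar, ybar) \<in> gph F \<and>
     (\<exists>\<mu>>0. \<exists>U V. open U \<and> xbar \<in> U \<and> open V \<and> ybar \<in> V \<and>
        (\<forall>x\<in>U. \<forall>y\<in>V. edist_set x {z. y \<in> F z} \<le> ereal \<mu> * edist_set y (F x)))"

definition edom :: "('a \<Rightarrow> ereal) \<Rightarrow> 'a set" where
  "edom \<psi> = {x. \<psi> x < \<infinity>}"

definition proper_fun :: "('a \<Rightarrow> ereal) \<Rightarrow> bool" where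
  "proper_fun \<psi> \<longleftrightarrow> (\<forall>x. \<psi> x \<noteq> -\<infinity>) \<and> edom \<psi> \<noteq> {}"

definition lsc_at :: "('a::topological_space \<Rightarrow> ereal) \<Rightarrow> 'a \<Rightarrow> bool" where
  "lsc_at \<psi> x \<longleftrightarrow> \<psi> x \<le> Liminf (at x) \<psi>"

text \<open>The epigraph lives in \<open>'a \<times> real\<close>; \<^const>\<open>epigraph\<close> is for real-valued functions only.\<close>

definition epi :: "('a \<Rightarrow> ereal) \<Rightarrow> ('a \<times> real) set" where
  "epi \<psi> = {(x, t). \<psi> x \<le> ereal t}"

definition subdifferential :: "('a::euclidean_space \<Rightarrow> ereal) \<Rightarrow> 'a \<Rightarrow> 'a set" where
  "subdifferential \<psi> x =
     {v. x \<in> edom \<psi> \<and> (v, - 1) \<in> normal_cone (epi \<psi>) (x, real_of_ereal (\<psi> x))}"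

definition second_subdifferential ::
  "('a::euclidean_space \<Rightarrow> ereal) \<Rightarrow> 'a \<Rightarrow> 'a \<Rightarrow> 'a \<Rightarrow> 'a set" where
  "second_subdifferential \<psi> x v u = coderivative (subdifferential \<psi>) x v u"

text \<open>The modulus \<open>r\<close> is local: it controls \<open>\<psi>\<close> only near \<open>xbar\<close>. Even for prox-bounded \<open>\<psi>\<close> and
  \<open>\<gamma> < 1 / r\<close>, the proximal mapping can be empty at every point: take \<open>\<psi> x = min 0 (1 - x\<^sup>2)\<close> on the
  line with \<open>xbar = 0\<close>, \<open>vbar = 0\<close>, \<open>r = 1/4\<close>, \<open>\<gamma> = 2\<close>. Statements about such \<open>\<gamma>\<close> therefore need
  \<open>r\<close> to be valid in the global quadratic minorant at \<open>xbar\<close> for \<open>vbar\<close> as well; for prox-bounded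
  \<open>\<psi>\<close> every sufficiently large modulus is.\<close>

definition prox_regular :: "('a::euclidean_space \<Rightarrow> ereal) \<Rightarrow> 'a \<Rightarrow> 'a \<Rightarrow> real \<Rightarrow> bool" where
  "prox_regular \<psi> xbar vbar r \<longleftrightarrow>
     xbar \<in> edom \<psi> \<and> vbar \<in> subdifferential \<psi> xbar \<and> r > 0 \<and>
     (\<forall>\<^sub>F x in nhds xbar. lsc_at \<psi> x) \<and>
     (\<exists>\<epsilon>>0. \<forall>x\<in>cball xbar \<epsilon>. \<forall>u\<in>cball xbar \<epsilon>. \<bar>\<psi> u - \<psi> xbar\<bar> < ereal \<epsilon> \<longrightarrow>
        (\<forall>v \<in> subdifferential \<psi> u \<inter> cball vbar \<epsilon>.
           \<psi> x \<ge> \<psi> u + ereal (inner v (x - u) - r / 2 * (norm (x - u))\<^sup>2)))"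

definition subdifferentially_continuous ::
  "('a::euclidean_space \<Rightarrow> ereal) \<Rightarrow> 'a \<Rightarrow> 'a \<Rightarrow> bool" where
  "subdifferentially_continuous \<psi> xbar vbar \<longleftrightarrow>
     (\<forall>x v. x \<longlonglongrightarrow> xbar \<and> v \<longlonglongrightarrow> vbar \<and> (\<forall>k. v k \<in> subdifferential \<psi> (x k))
        \<longrightarrow> (\<lambda>k. \<psi> (x k)) \<longlonglongrightarrow> \<psi> xbar)"

definition continuously_prox_regular ::
  "('a::euclidean_space \<Rightarrow> ereal) \<Rightarrow> 'a \<Rightarrow> 'a \<Rightarrow> real \<Rightarrow> bool" where
  "continuously_prox_regular \<psi> xbar vbar r \<longleftrightarrow>
     prox_regular \<psi> xbar vbar r \<and> subdifferentially_continuous \<psi> xbar vbar"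

definition quadratic_fun ::
  "real^'n^'n \<Rightarrow> real^'n \<Rightarrow> real \<Rightarrow> real^'n \<Rightarrow> real" where
  "quadratic_fun A b \<alpha> x = 1 / 2 * inner (A *v x) x + inner b x + \<alpha>"

definition prox_bounded :: "(real^'n \<Rightarrow> ereal) \<Rightarrow> bool" where
  "prox_bounded g \<longleftrightarrow> (\<exists>Q c \<beta>. \<forall>x. ereal (quadratic_fun Q c \<beta> x) \<le> g x)"

definition Prox :: "real \<Rightarrow> ('a::euclidean_space \<Rightarrow> ereal) \<Rightarrow> 'a \<Rightarrow> 'a set" where
  "Prox \<gamma> g x =
     {y. is_arg_min (\<lambda>y. g y + ereal (1 / (2 * \<gamma>) * (norm (y - x))\<^sup>2)) (\<lambda>_. True) y}"

definition composite ::
  "real^'n^'n \<Rightarrow> real^'n \<Rightarrow> real \<Rightarrow> (real^'n \<Rightarrow> ereal) \<Rightarrow> real^'n \<Rightarrow> ereal" where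
  "composite A b \<alpha> g x = ereal (quadratic_fun A b \<alpha> x) + g x"

definition forward_point :: "real^'n^'n \<Rightarrow> real^'n \<Rightarrow> real \<Rightarrow> real^'n \<Rightarrow> real^'n" where
  "forward_point A b \<gamma> x = x - \<gamma> *\<^sub>R (A *v x + b)"

definition newton_directions ::
  "real^'n^'n \<Rightarrow> real^'n \<Rightarrow> (real^'n \<Rightarrow> ereal) \<Rightarrow> real \<Rightarrow> real^'n \<Rightarrow> (real^'n) set" where
  "newton_directions A b g \<gamma> x =
     {d. \<exists>v. Prox \<gamma> g (forward_point A b \<gamma> x) = {v} \<and>
         - ((1 / \<gamma>) *\<^sub>R (x - v)) - A *v d
           \<in> second_subdifferential g v ((1 / \<gamma>) *\<^sub>R (forward_point A b \<gamma> x - v)) (x - v + d)}"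

text \<open>All iterates that some run from \<open>x0\<close> can produce, over every possible choice of the
  directions.\<close>

inductive newton_iterate ::
  "real^'n^'n \<Rightarrow> real^'n \<Rightarrow> real \<Rightarrow> (real^'n \<Rightarrow> ereal) \<Rightarrow> real \<Rightarrow> real^'n \<Rightarrow> real^'n \<Rightarrow> bool"
  for A b \<alpha> g \<gamma> x0 where
  start: "newton_iterate A b \<alpha> g \<gamma> x0 x0"
| step: "newton_iterate A b \<alpha> g \<gamma> x0 x \<Longrightarrow> 0 \<notin> subdifferential (composite A b \<alpha> g) x \<Longrightarrow>
         d \<in> newton_directions A b g \<gamma> x \<Longrightarrow> newton_iterate A b \<alpha> g \<gamma> x0 (x + d)"

definition newton_well_defined ::
  "real^'n^'n \<Rightarrow> real^'n \<Rightarrow> real \<Rightarrow> (real^'n \<Rightarrow> ereal) \<Rightarrow> real \<Rightarrow> real^'n \<Rightarrow> bool" where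
  "newton_well_defined A b \<alpha> g \<gamma> x0 \<longleftrightarrow>
     (\<forall>x. newton_iterate A b \<alpha> g \<gamma> x0 x \<and> 0 \<notin> subdifferential (composite A b \<alpha> g) x \<longrightarrow>
        is_singleton (Prox \<gamma> g (forward_point A b \<gamma> x)) \<and> newton_directions A b g \<gamma> x \<noteq> {})"

text \<open>A run that stops is continued by the constant sequence.\<close>

definition newton_sequence ::
  "real^'n^'n \<Rightarrow> real^'n \<Rightarrow> real \<Rightarrow> (real^'n \<Rightarrow> ereal) \<Rightarrow> real \<Rightarrow> real^'n \<Rightarrow> (nat \<Rightarrow> real^'n) \<Rightarrow> bool" where
  "newton_sequence A b \<alpha> g \<gamma> x0 X \<longleftrightarrow>
     X 0 = x0 \<and>
     (\<forall>k. if 0 \<in> subdifferential (composite A b \<alpha> g) (X k) then X (Suc k) = X k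
          else \<exists>d \<in> newton_directions A b g \<gamma> (X k). X (Suc k) = X k + d)"

definition Q_superlinear :: "(nat \<Rightarrow> 'a::real_normed_vector) \<Rightarrow> 'a \<Rightarrow> bool" where
  "Q_superlinear X xbar \<longleftrightarrow>
     X \<longlonglongrightarrow> xbar \<and> (\<lambda>k. norm (X (Suc k) - xbar) / norm (X k - xbar)) \<longlonglongrightarrow> 0"

end

theory Submission
  imports Defs
begin

text \<open>
  Put \<open>F = subdifferential \<phi>\<close>. Let \<open>v\<close> be the proximal point computed from an iterate \<open>x\<close> and
  \<open>y = A v + b + (u - v) / \<gamma>\<close>, where \<open>u\<close> is the forward point. Then \<open>(v, y)\<close> lies on the graph of
  \<open>F\<close> at distance \<open>O(norm (x - xbar))\<close> from \<open>(xbar, 0)\<close>, because the proximal mapping is Lipschitz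
  near the forward point of \<open>xbar\<close>. The terms with \<open>A\<close> cancel in the inclusion for the direction \<open>d\<close>,
  which says that \<open>- y\<close> belongs to the coderivative of \<open>F\<close> at \<open>(v, y)\<close> applied to \<open>x + d - v\<close>.
  It can be solved by the hypothesis \<open>solvable\<close>. Superlinear convergence follows once
  \<open>newton_step_estimate\<close> is known: if \<open>- y\<close> is in the coderivative of \<open>F\<close> at \<open>(x, y)\<close> applied to \<open>d\<close>,
  then \<open>norm (x + d - xbar)\<close> is small compared with \<open>norm (x - xbar, y)\<close>. The case \<open>y = 0\<close>, \<open>d = 0\<close>
  also shows that \<open>xbar\<close> is an isolated stationary point.

  Semismoothness* alone is too weak for this estimate: it pairs a normal with the single vector
  \<open>(x - xbar, y)\<close> and so gives one scalar equation for the vector \<open>x + d - xbar\<close>. The missing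
  equations come from the symmetry of second-order objects of a function. By prox-regularity, the
  graph of the subdifferential of \<open>g\<close> is parametrized by \<open>u = x + \<gamma> v\<close> through the proximal
  mapping \<open>P\<close>, which is the gradient of a convex function \<open>E\<close> (\<open>prox_parametrization\<close>). Let \<open>ubar\<close>
  belong to the reference point, \<open>q = u - ubar\<close> and \<open>c = P u - xbar\<close>. Semismoothness* and a mean value
  inequality for proximal subgradients show that the difference quotients of \<open>P\<close> along \<open>q\<close> near
  \<open>u\<close> are close to \<open>c\<close>. They are gradients of difference quotients of \<open>E\<close>, whose limit is
  \<open>inner q \<circ> P\<close>; hence \<open>inner q \<circ> P\<close> is close to \<open>inner c\<close> as a Lipschitz function. No second
  derivatives are taken on the way. For the graph of \<open>F\<close> this says that
  \<open>inner y \<Delta>x - inner (x - xbar) \<Delta>y\<close> is small for all increments \<open>(\<Delta>x, \<Delta>y)\<close> of the graph near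
  \<open>(x, y)\<close> (\<open>graph_symmetry\<close>).

  To conclude, put \<open>e = x + d - xbar\<close> and use metric regularity to find an increment with
  \<open>\<Delta>y = - s e\<close> and \<open>norm \<Delta>x = O(s * norm e)\<close>. The inequality for the normal \<open>(- y, - d)\<close> and the
  symmetry bound add up to an upper bound for \<open>s * (norm e)\<^sup>2\<close> by a small multiple of
  \<open>s * norm e * norm (x - xbar, y)\<close>.
\<close>

section \<open>Normal cones under smooth changes of variables\<close>

text \<open>Replaces the upper limit of quotients, and with it the point itself and isolated points, by an
  inequality that can be added and composed.\<close>

lemma regular_normal_iff:
  "v \<in> regular_normal_cone \<Omega> z \<longleftrightarrow>
     z \<in> \<Omega> \<and> (\<forall>\<epsilon>>0. \<exists>\<delta>>0. \<forall>y\<in>\<Omega>. norm (y - z) < \<delta> \<longrightarrow> inner v (y - z) \<le> \<epsilon> * norm (y - z))"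
proof -
  have "Limsup (at z within \<Omega>) (\<lambda>y. ereal (inner v (y - z) / norm (y - z))) \<le> 0 \<longleftrightarrow>
     (\<forall>\<epsilon>>0. \<exists>\<delta>>0. \<forall>y\<in>\<Omega>. norm (y - z) < \<delta> \<longrightarrow> inner v (y - z) \<le> \<epsilon> * norm (y - z))"
    (is "?L \<longleftrightarrow> ?R")
  proof
    assume L: ?L
    show ?R
    proof (intro allI impI)
      fix \<epsilon> :: real assume "\<epsilon> > 0"
      then have "\<forall>\<^sub>F y in at z within \<Omega>. ereal (inner v (y - z) / norm (y - z)) < ereal \<epsilon>"
        using L[unfolded Limsup_le_iff, rule_format, of "ereal \<epsilon>"] by simp
      then obtain \<delta> where \<delta>: "\<delta> > 0" "\<And>y. y \<in> \<Omega> \<Longrightarrow> y \<noteq> z \<Longrightarrow> dist y z < \<delta> \<Longrightarrow>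
          inner v (y - z) / norm (y - z) < \<epsilon>"
        unfolding eventually_at by auto
      have "inner v (y - z) \<le> \<epsilon> * norm (y - z)" if "y \<in> \<Omega>" "norm (y - z) < \<delta>" for y
      proof (cases "y = z")
        case False
        then show ?thesis using \<delta>(2)[of y] that by (simp add: dist_norm divide_simps)
      qed simp
      then show "\<exists>\<delta>>0. \<forall>y\<in>\<Omega>. norm (y - z) < \<delta> \<longrightarrow> inner v (y - z) \<le> \<epsilon> * norm (y - z)"
        using \<delta>(1) by blast
    qed
  next
    assume R: ?R
    show ?L unfolding Limsup_le_iff
    proof (intro allI impI)
      fix c :: ereal assume "0 < c"
      then obtain \<epsilon> where \<epsilon>: "0 < ereal \<epsilon>" "ereal \<epsilon> < c"
        using ereal_dense2[of 0 c] by auto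
      then obtain \<delta> where \<delta>: "\<delta> > 0" "\<forall>y\<in>\<Omega>. norm (y - z) < \<delta> \<longrightarrow> inner v (y - z) \<le> \<epsilon> * norm (y - z)"
        using R by auto
      have "ereal (inner v (y - z) / norm (y - z)) < c" if "y \<in> \<Omega>" "y \<noteq> z" "dist y z < \<delta>" for y
      proof -
        have "inner v (y - z) / norm (y - z) \<le> \<epsilon>"
          using \<delta>(2) that by (simp add: dist_norm divide_simps)
        then show ?thesis using \<epsilon>(2) by (meson ereal_less_eq(3) le_less_trans)
      qed
      then show "\<forall>\<^sub>F y in at z within \<Omega>. ereal (inner v (y - z) / norm (y - z)) < c"
        unfolding eventually_at using \<delta>(1) by auto
    qed
  qed
  then show ?thesis unfolding regular_normal_cone_def by auto
qed

lemma regular_normal_scale: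
  assumes "v \<in> regular_normal_cone \<Omega> z" "c \<ge> 0"
  shows "c *\<^sub>R v \<in> regular_normal_cone \<Omega> z"
proof (cases "c = 0")
  case True
  then show ?thesis using assms unfolding regular_normal_iff by (auto intro!: exI[of _ 1])
next
  case False
  then have c: "c > 0" using assms by simp
  show ?thesis unfolding regular_normal_iff
  proof (intro conjI allI impI)
    show "z \<in> \<Omega>" using assms regular_normal_iff by auto
    fix \<epsilon> :: real assume "\<epsilon> > 0"
    then have "\<epsilon> / c > 0" using c by simp
    then obtain \<delta> where "\<delta> > 0" "\<forall>y\<in>\<Omega>. norm (y - z) < \<delta> \<longrightarrow> inner v (y - z) \<le> \<epsilon> / c * norm (y - z)"
      using assms unfolding regular_normal_iff by meson
    then show "\<exists>\<delta>>0. \<forall>y\<in>\<Omega>. norm (y - z) < \<delta> \<longrightarrow> inner (c *\<^sub>R v) (y - z) \<le> \<epsilon> * norm (y - z)"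
      using c by (intro exI[of _ \<delta>]) (auto simp: field_simps)
  qed
qed

text \<open>The defining inequality of a regular normal survives a first-order change of variables, since
  the remainder of the derivative is absorbed by the error term. Only the inclusion of the images
  is used, so the normal goes from the target back to the source through the adjoint derivative.\<close>

lemma regular_normal_pullback:
  fixes \<Phi> :: "'a::euclidean_space \<Rightarrow> 'b::euclidean_space"
  assumes v: "v \<in> regular_normal_cone \<Omega>' (\<Phi> z)" and z: "z \<in> \<Omega>" and sub: "\<Phi> ` \<Omega> \<subseteq> \<Omega>'"
    and D: "(\<Phi> has_derivative D) (at z)" and w: "\<And>h. inner w h = inner v (D h)"
  shows "w \<in> regular_normal_cone \<Omega> z"
  unfolding regular_normal_iff
proof (intro conjI allI impI)
  show "z \<in> \<Omega>" by (rule z)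
  fix \<epsilon> :: real assume \<epsilon>: "\<epsilon> > 0"
  have bl: "bounded_linear D" using D by (rule has_derivative_bounded_linear)
  define L where "L = onorm D + 1"
  have L: "L > 0" using onorm_pos_le[OF bl] by (simp add: L_def)
  define e where "e = min 1 (\<epsilon> / (2 * (norm v + 1)))"
  have nv: "norm v + 1 > 0" using norm_ge_zero[of v] by linarith
  have e: "e > 0" "e \<le> 1" "norm v * e \<le> \<epsilon> / 2"
  proof -
    show "e > 0" "e \<le> 1" using \<epsilon> nv by (auto simp: e_def)
    have "norm v * e \<le> (norm v + 1) * (\<epsilon> / (2 * (norm v + 1)))"
      using \<epsilon> nv by (intro mult_mono) (auto simp: e_def)
    also have "\<dots> = \<epsilon> / 2" using nv by (simp add: field_simps)
    finally show "norm v * e \<le> \<epsilon> / 2" .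
  qed
  obtain d1 where d1: "d1 > 0"
    "\<And>y. norm (y - z) < d1 \<Longrightarrow> norm (\<Phi> y - \<Phi> z - D (y - z)) \<le> e * norm (y - z)"
    using D e(1) unfolding has_derivative_at_alt by meson
  have "\<epsilon> / (2 * L) > 0" using \<epsilon> L by simp
  then obtain d2 where d2: "d2 > 0"
    "\<forall>y\<in>\<Omega>'. norm (y - \<Phi> z) < d2 \<longrightarrow> inner v (y - \<Phi> z) \<le> \<epsilon> / (2 * L) * norm (y - \<Phi> z)"
    using v unfolding regular_normal_iff by meson
  have "inner w (y - z) \<le> \<epsilon> * norm (y - z)" if y: "y \<in> \<Omega>" "norm (y - z) < min d1 (d2 / L)" for y
  proof -
    have r: "norm (\<Phi> y - \<Phi> z - D (y - z)) \<le> e * norm (y - z)" using d1(2) y by simp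
    have "norm (\<Phi> y - \<Phi> z) \<le> norm (\<Phi> y - \<Phi> z - D (y - z)) + norm (D (y - z))"
      by (metis diff_add_cancel norm_triangle_ineq)
    also have "\<dots> \<le> 1 * norm (y - z) + onorm D * norm (y - z)"
      using r e(2) onorm[OF bl, of "y - z"] mult_right_mono[of e 1 "norm (y - z)"] by auto
    finally have lip: "norm (\<Phi> y - \<Phi> z) \<le> L * norm (y - z)" by (simp add: L_def algebra_simps)
    also have "\<dots> < d2" using y(2) L by (simp add: field_simps)
    finally have "inner v (\<Phi> y - \<Phi> z) \<le> \<epsilon> / (2 * L) * norm (\<Phi> y - \<Phi> z)"
      using d2(2) y(1) sub by auto
    also have "\<dots> \<le> \<epsilon> / (2 * L) * (L * norm (y - z))"
      using lip \<epsilon> L by (intro mult_left_mono) auto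
    also have "\<dots> = \<epsilon> / 2 * norm (y - z)" using L by simp
    finally have 1: "inner v (\<Phi> y - \<Phi> z) \<le> \<epsilon> / 2 * norm (y - z)" .
    have "inner v (D (y - z)) - inner v (\<Phi> y - \<Phi> z) = - inner v (\<Phi> y - \<Phi> z - D (y - z))"
      by (simp add: inner_diff_right)
    also have "\<dots> \<le> norm v * norm (\<Phi> y - \<Phi> z - D (y - z))"
      using norm_cauchy_schwarz[of "- v" "\<Phi> y - \<Phi> z - D (y - z)"] by simp
    also have "\<dots> \<le> norm v * (e * norm (y - z))" using r by (intro mult_left_mono) auto
    also have "\<dots> \<le> \<epsilon> / 2 * norm (y - z)" using mult_right_mono[OF e(3), of "norm (y - z)"] by simp
    finally show ?thesis using 1 w by simp
  qed
  then show "\<exists>\<delta>>0. \<forall>y\<in>\<Omega>. norm (y - z) < \<delta> \<longrightarrow> inner w (y - z) \<le> \<epsilon> * norm (y - z)"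
    using d1(1) d2(1) L by (intro exI[of _ "min d1 (d2 / L)"]) auto
qed

text \<open>Limiting normals sit at nearby points of the target set; the inverse \<open>\<Psi>\<close> turns these into
  points of the source, where the preceding rule applies, and continuity of the adjoint derivative
  passes to the limit. The maps needed below are \<open>(x, t) \<mapsto> (x, t + q x)\<close> on epigraphs and
  \<open>(x, v) \<mapsto> (x, v + A x + b)\<close> on graphs.\<close>

lemma normal_cone_pullback:
  fixes \<Phi> :: "'a::euclidean_space \<Rightarrow> 'b::euclidean_space"
  assumes v: "v \<in> normal_cone \<Omega>' z" and sub: "\<Phi> ` \<Omega> \<subseteq> \<Omega>'"
    and \<Psi>: "\<And>y. y \<in> \<Omega>' \<Longrightarrow> \<Psi> y \<in> \<Omega> \<and> \<Phi> (\<Psi> y) = y" and cont\<Psi>: "isCont \<Psi> z"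
    and D: "\<And>x. (\<Phi> has_derivative D x) (at x)"
    and T: "\<And>x v h. inner (T x v) h = inner v (D x h)"
    and contT: "isCont (\<lambda>p. T (fst p) (snd p)) (\<Psi> z, v)"
  shows "T (\<Psi> z) v \<in> normal_cone \<Omega> (\<Psi> z)"
proof -
  obtain y w where z: "z \<in> \<Omega>'" and y: "y \<longlonglongrightarrow> z" "\<forall>k. y k \<in> \<Omega>'" and w: "w \<longlonglongrightarrow> v"
    "\<forall>k. w k \<in> regular_normal_cone \<Omega>' (y k)"
    using v unfolding normal_cone_def by blast
  have y': "(\<lambda>k. \<Psi> (y k)) \<longlonglongrightarrow> \<Psi> z" using cont\<Psi> y(1) by (rule isCont_tendsto_compose)
  have w': "(\<lambda>k. T (\<Psi> (y k)) (w k)) \<longlonglongrightarrow> T (\<Psi> z) v"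
    using isCont_tendsto_compose[OF contT tendsto_Pair[OF y' w(1)]] by simp
  have "T (\<Psi> (y k)) (w k) \<in> regular_normal_cone \<Omega> (\<Psi> (y k))" for k
    using w(2) \<Psi> y(2) by (intro regular_normal_pullback[OF _ _ sub D T]) auto
  then show ?thesis unfolding normal_cone_def using \<Psi> z y(2) y' w' by blast
qed

section \<open>Adding a quadratic function\<close>

lemma inner_symmetric_matrix:
  fixes A :: "real^'n^'n"
  assumes "transpose A = A"
  shows "inner (A *v x) y = inner x (A *v y)"
  by (metis assms dot_lmul_matrix vector_transpose_matrix)

lemma uminus_matrix_vector_mult: "(- A) *v x = - (A *v x)" for A :: "real^'n^'m"
  by (metis diff_0 matrix_vector_mult_diff_rdistrib matrix_vector_mult_0)

lemma quadratic_fun_has_derivative: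
  fixes A :: "real^'n^'n"
  assumes "transpose A = A"
  shows "(quadratic_fun A b \<alpha> has_derivative (\<lambda>h. inner (A *v x + b) h)) (at x)"
proof -
  have [derivative_intros]: "((\<lambda>x. A *v x) has_derivative (\<lambda>h. A *v h)) (at x)" for x :: "real^'n"
    by (rule bounded_linear_imp_has_derivative) (rule matrix_vector_mul_bounded_linear)
  have "((\<lambda>x. 1 / 2 * inner (A *v x) x + inner b x + \<alpha>) has_derivative
      (\<lambda>h. 1 / 2 * (inner (A *v x) h + inner (A *v h) x) + inner b h)) (at x)"
    by (auto intro!: derivative_eq_intros)
  moreover have "inner (A *v h) x = inner (A *v x) h" for h
    by (metis inner_symmetric_matrix[OF assms] inner_commute)
  ultimately have "((\<lambda>x. 1 / 2 * inner (A *v x) x + inner b x + \<alpha>) has_derivative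
      (\<lambda>h. inner (A *v x + b) h)) (at x)"
    by (simp add: inner_add_left)
  then show ?thesis by (simp add: quadratic_fun_def[abs_def])
qed

text \<open>The map \<open>(x, t) \<mapsto> (x, t + q x)\<close> carries the epigraph of \<open>g\<close> onto that of the composite, and
  its adjoint derivative subtracts the gradient of \<open>q\<close> from normals with last component \<open>-1\<close>.\<close>

lemma subdifferential_composite_subset:
  fixes A :: "real^'n^'n"
  assumes sym: "transpose A = A" and g: "\<And>x. g x \<noteq> -\<infinity>"
    and v: "v \<in> subdifferential (composite A b \<alpha> g) x"
  shows "v - (A *v x + b) \<in> subdifferential g x"
proof -
  define q where "q = quadratic_fun A b \<alpha>"
  define \<Phi> where "\<Phi> p = (fst p, snd p + q (fst p))" for p :: "(real^'n) \<times> real"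
  define \<Psi> where "\<Psi> p = (fst p, snd p - q (fst p))" for p :: "(real^'n) \<times> real"
  define D where "D p h = (fst h, snd h + inner (A *v fst p + b) (fst h))" for p h :: "(real^'n) \<times> real"
  define T where "T p w = (fst w + snd w *\<^sub>R (A *v fst p + b), snd w)" for p w :: "(real^'n) \<times> real"
  have q': "(q has_derivative (\<lambda>h. inner (A *v x + b) h)) (at x)" for x
    unfolding q_def by (rule quadratic_fun_has_derivative[OF sym])
  have dom: "x \<in> edom g" using v unfolding subdifferential_def edom_def composite_def by auto
  define r where "r = real_of_ereal (g x)"
  have r: "g x = ereal r" using dom g[of x] unfolding edom_def r_def by (cases "g x") auto
  have gq: "composite A b \<alpha> g x = ereal (r + q x)" by (simp add: composite_def r q_def)
  have v': "(v, -1) \<in> normal_cone (epi (composite A b \<alpha> g)) (x, r + q x)"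
    using v gq unfolding subdifferential_def by simp
  have epi_iff: "(y, t + q y) \<in> epi (composite A b \<alpha> g) \<longleftrightarrow> (y, t) \<in> epi g" for y t
    unfolding epi_def composite_def q_def[symmetric] by (cases "g y") auto
  have contq: "isCont q y" for y using q' has_derivative_continuous by blast
  have "T (\<Psi> (x, r + q x)) (v, -1) \<in> normal_cone (epi g) (\<Psi> (x, r + q x))"
  proof (rule normal_cone_pullback[OF v'])
    show "\<Phi> ` epi g \<subseteq> epi (composite A b \<alpha> g)" using epi_iff by (auto simp: \<Phi>_def)
    show "\<Psi> y \<in> epi g \<and> \<Phi> (\<Psi> y) = y" if "y \<in> epi (composite A b \<alpha> g)" for y
      using epi_iff[of "fst y" "snd y - q (fst y)"] that by (simp add: \<Psi>_def \<Phi>_def)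
    show "isCont \<Psi> (x, r + q x)" unfolding \<Psi>_def
      by (intro continuous_intros isCont_o2[OF _ contq, of _ fst]) 
    show "(\<Phi> has_derivative D p) (at p)" for p
      unfolding \<Phi>_def D_def
      by (auto intro!: derivative_eq_intros has_derivative_compose[OF _ q'])
    show "inner (T p w) h = inner w (D p h)" for p w h
      unfolding T_def D_def by (simp add: inner_prod_def inner_add_left algebra_simps)
    have contA: "isCont (\<lambda>x. A *v x) x" for x :: "real^'n"
      by (rule linear_continuous_at) (rule matrix_vector_mul_bounded_linear)
    show "isCont (\<lambda>p. T (fst p) (snd p)) (\<Psi> (x, r + q x), (v, -1))" unfolding T_def
      by (intro continuous_intros isCont_o2[OF _ contA, of _ "\<lambda>p. fst (fst p)"])
  qed
  moreover have "T (\<Psi> (x, r + q x)) (v, -1) = (v - (A *v x + b), -1)" "\<Psi> (x, r + q x) = (x, r)"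
    unfolding T_def \<Psi>_def by simp_all
  ultimately have "(v - (A *v x + b), -1) \<in> normal_cone (epi g) (x, r)" by (simp only:)
  then show ?thesis using dom r unfolding subdifferential_def by simp
qed

text \<open>The converse inclusion is the same statement for \<open>g\<close> written as the composite plus \<open>-q\<close>.\<close>

lemma subdifferential_composite:
  fixes A :: "real^'n^'n"
  assumes sym: "transpose A = A" and g: "\<And>x. g x \<noteq> -\<infinity>"
  shows "v \<in> subdifferential (composite A b \<alpha> g) x \<longleftrightarrow> v - (A *v x + b) \<in> subdifferential g x"
proof
  assume v: "v - (A *v x + b) \<in> subdifferential g x"
  have inv: "composite (- A) (- b) (- \<alpha>) (composite A b \<alpha> g) = g"
  proof
    fix y
    have "quadratic_fun (- A) (- b) (- \<alpha>) y = - quadratic_fun A b \<alpha> y"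
      unfolding quadratic_fun_def uminus_matrix_vector_mult inner_minus_left by linarith
    then show "composite (- A) (- b) (- \<alpha>) (composite A b \<alpha> g) y = g y"
      unfolding composite_def by (cases "g y") auto
  qed
  have "transpose (- A) = - A" using sym by (simp add: transpose_def vec_eq_iff)
  moreover have "composite A b \<alpha> g y \<noteq> -\<infinity>" for y using g[of y] unfolding composite_def by (cases "g y") auto
  ultimately have "v - (A *v x + b) - ((- A) *v x + (- b)) \<in> subdifferential (composite A b \<alpha> g) x"
    by (rule subdifferential_composite_subset[where \<alpha> = "- \<alpha>"]) (unfold inv, rule v)
  moreover have "v - (A *v x + b) - ((- A) *v x + (- b)) = v"
    unfolding uminus_matrix_vector_mult by (rule vec_eq_iff[THEN iffD2]) (simp only: vector_component, simp)
  ultimately show "v \<in> subdifferential (composite A b \<alpha> g) x" by (simp only:)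
qed (rule subdifferential_composite_subset[OF sym g])

text \<open>Adding a smooth gradient to a set-valued map shears its graph. For symmetric \<open>A\<close> the adjoint of
  the shear has the same matrix, which gives the coderivative of the sum without any calculus rule
  beyond change of variables.\<close>

lemma graph_shear:
  fixes A :: "real^'n^'n"
  assumes sym: "transpose A = A" and FG: "\<And>x v. v \<in> F x \<longleftrightarrow> v - (A *v x + b) \<in> G x"
  shows regular_normal_graph_shear:
      "(\<xi>, \<omega>) \<in> regular_normal_cone (gph G) (x, v) \<Longrightarrow>
         (\<xi> - A *v \<omega>, \<omega>) \<in> regular_normal_cone (gph F) (x, v + (A *v x + b))"
    and coderivative_shear_subset: "\<xi> \<in> coderivative G x (v - (A *v x + b)) w \<Longrightarrow>
      \<xi> + A *v w \<in> coderivative F x v w"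
proof -
  define \<Phi> where "\<Phi> p = (fst p, snd p - (A *v fst p + b))" for p :: "(real^'n) \<times> (real^'n)"
  define \<Psi> where "\<Psi> p = (fst p, snd p + (A *v fst p + b))" for p :: "(real^'n) \<times> (real^'n)"
  define D where "D h = (fst h, snd h - A *v fst h)" for h :: "(real^'n) \<times> (real^'n)"
  define T where "T w = (fst w - A *v snd w, snd w)" for w :: "(real^'n) \<times> (real^'n)"
  have derA: "((\<lambda>x. A *v x) has_derivative (\<lambda>h. A *v h)) (at x)" for x :: "real^'n"
    by (rule bounded_linear_imp_has_derivative) (rule matrix_vector_mul_bounded_linear)
  have contA: "isCont (\<lambda>x. A *v x) x" for x :: "real^'n"
    using derA has_derivative_continuous by blast
  have sub: "\<Phi> ` gph F \<subseteq> gph G" using FG by (auto simp: \<Phi>_def gph_def)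
  have D: "(\<Phi> has_derivative D) (at p)" for p
    unfolding \<Phi>_def D_def by (auto intro!: derivative_eq_intros has_derivative_compose[OF _ derA])
  have T: "inner (T w) h = inner w (D h)" for w h
    unfolding T_def D_def
    by (simp add: inner_prod_def inner_diff_left inner_diff_right inner_symmetric_matrix[OF sym])
  have \<Psi>: "\<Psi> y \<in> gph F \<and> \<Phi> (\<Psi> y) = y" if "y \<in> gph G" for y
    using FG that by (cases y) (auto simp: \<Psi>_def \<Phi>_def gph_def)
  have inG: "p \<in> gph G" if "w \<in> regular_normal_cone (gph G) p" for w p
    using that regular_normal_iff by blast
  show "(\<xi> - A *v \<omega>, \<omega>) \<in> regular_normal_cone (gph F) (x, v + (A *v x + b))"
    if n: "(\<xi>, \<omega>) \<in> regular_normal_cone (gph G) (x, v)"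
  proof -
    have "T (\<xi>, \<omega>) \<in> regular_normal_cone (gph F) (\<Psi> (x, v))"
      using n \<Psi>[OF inG[OF n]] by (intro regular_normal_pullback[OF _ _ sub D T]) auto
    then show ?thesis by (simp add: T_def \<Psi>_def)
  qed
  show "\<xi> + A *v w \<in> coderivative F x v w" if n: "\<xi> \<in> coderivative G x (v - (A *v x + b)) w"
  proof -
    have "T (\<xi>, - w) \<in> normal_cone (gph F) (\<Psi> (x, v - (A *v x + b)))"
    proof (rule normal_cone_pullback[where T = "\<lambda>_. T", OF _ sub \<Psi> _ D T])
      show "(\<xi>, - w) \<in> normal_cone (gph G) (x, v - (A *v x + b))"
        using n by (simp add: coderivative_def)
      show "isCont \<Psi> p" for p unfolding \<Psi>_def
        by (intro continuous_intros isCont_o2[OF _ contA, of _ fst])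
      show "isCont (\<lambda>p. T (snd p)) q" for q :: "((real^'n) \<times> (real^'n)) \<times> ((real^'n) \<times> (real^'n))"
        unfolding T_def by (intro continuous_intros isCont_o2[OF _ contA, of _ "\<lambda>p. snd (snd p)"])
    qed auto
    moreover have "A *v (- w) = - (A *v w)" by (rule linear_neg[OF matrix_vector_mul_linear])
    ultimately show ?thesis by (simp add: T_def \<Psi>_def coderivative_def)
  qed
qed

text \<open>Both directions are instances of the shear, once with \<open>A\<close> and once with \<open>- A\<close>.\<close>

lemma second_subdifferential_composite:
  fixes A :: "real^'n^'n"
  assumes sym: "transpose A = A" and g: "\<And>x. g x \<noteq> -\<infinity>"
  shows "\<xi> \<in> second_subdifferential (composite A b \<alpha> g) x y w \<longleftrightarrow>
    \<xi> - A *v w \<in> second_subdifferential g x (y - (A *v x + b)) w"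
proof
  let ?F = "subdifferential (composite A b \<alpha> g)" and ?G = "subdifferential g"
  have FG: "v \<in> ?F x \<longleftrightarrow> v - (A *v x + b) \<in> ?G x" for x v
    by (rule subdifferential_composite[OF sym g])
  show "\<xi> \<in> second_subdifferential (composite A b \<alpha> g) x y w"
    if "\<xi> - A *v w \<in> second_subdifferential g x (y - (A *v x + b)) w"
    using coderivative_shear_subset[of A ?F b ?G, OF sym FG, of "\<xi> - A *v w" x y w] that
    by (simp add: second_subdifferential_def)
  have sym': "transpose (- A) = - A" using sym by (simp add: transpose_def vec_eq_iff)
  have shift: "v - ((- A) *v x + (- b)) = v + (A *v x + b)" for v x
    unfolding uminus_matrix_vector_mult by simp
  have GF: "v \<in> ?G x \<longleftrightarrow> v - ((- A) *v x + (- b)) \<in> ?F x" for x v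
    unfolding shift FG by simp
  show "\<xi> - A *v w \<in> second_subdifferential g x (y - (A *v x + b)) w"
    if "\<xi> \<in> second_subdifferential (composite A b \<alpha> g) x y w"
  proof -
    have "\<xi> \<in> coderivative ?F x (y - (A *v x + b) - ((- A) *v x + (- b))) w"
      using that unfolding shift second_subdifferential_def by simp
    from coderivative_shear_subset[of "- A" ?G "- b" ?F, OF sym' GF this] show ?thesis
      unfolding uminus_matrix_vector_mult second_subdifferential_def by simp
  qed
qed

lemma shear_norm_bound:
  fixes f :: "'a::euclidean_space \<Rightarrow> 'a"
  assumes "bounded_linear f"
  shows "norm (a, c + f a) \<le> (1 + onorm f) * norm (a, c)"
    and "norm (a + f c, c) \<le> (1 + onorm f) * norm (a, c)"
proof -
  have "norm (a, c + f a) \<le> norm (a, c) + norm (0 :: 'a, f a)"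
    using norm_triangle_ineq[of "(a, c)" "(0, f a)"] by simp
  also have "norm (0 :: 'a, f a) \<le> onorm f * norm (a, c)"
  proof -
    have "norm (f a) \<le> onorm f * norm a" using assms by (rule onorm)
    also have "\<dots> \<le> onorm f * norm (a, c)"
      by (intro mult_left_mono norm_fst_le onorm_pos_le[OF assms])
    finally show ?thesis by (simp add: norm_Pair)
  qed
  finally show "norm (a, c + f a) \<le> (1 + onorm f) * norm (a, c)" by (simp add: algebra_simps)
  have "norm (a + f c, c) \<le> norm (a, c) + norm (f c, 0 :: 'a)"
    using norm_triangle_ineq[of "(a, c)" "(f c, 0)"] by simp
  also have "norm (f c, 0 :: 'a) \<le> onorm f * norm (a, c)"
  proof -
    have "norm (f c) \<le> onorm f * norm c" using assms by (rule onorm)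
    also have "\<dots> \<le> onorm f * norm (a, c)"
      by (intro mult_left_mono norm_snd_le onorm_pos_le[OF assms])
    finally show ?thesis by (simp add: norm_Pair)
  qed
  finally show "norm (a + f c, c) \<le> (1 + onorm f) * norm (a, c)" by (simp add: algebra_simps)
qed

text \<open>Normals transform by the inverse adjoint of the shear, so their pairing with the displacement from
  the reference point is unchanged, and norms are distorted by a bounded factor only.\<close>

lemma uniform_semismooth_shear:
  fixes A :: "real^'n^'n"
  assumes sym: "transpose A = A" and FG: "\<And>x v. v \<in> F x \<longleftrightarrow> v - (A *v x + b) \<in> G x"
    and uniform: "\<And>\<epsilon>. \<epsilon> > 0 \<Longrightarrow> \<exists>\<delta>>0. \<forall>p n. n \<in> regular_normal_cone (gph F) p \<longrightarrow>
      norm (p - (xbar, ybar)) < \<delta> \<longrightarrow> \<bar>inner n (p - (xbar, ybar))\<bar> \<le> \<epsilon> * norm (p - (xbar, ybar)) * norm n"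
    and vbar: "vbar = ybar - (A *v xbar + b)" and \<epsilon>: "\<epsilon> > 0"
  shows "\<exists>\<delta>>0. \<forall>p n. n \<in> regular_normal_cone (gph G) p \<longrightarrow>
      norm (p - (xbar, vbar)) < \<delta> \<longrightarrow> \<bar>inner n (p - (xbar, vbar))\<bar> \<le> \<epsilon> * norm (p - (xbar, vbar)) * norm n"
proof -
  have blA: "bounded_linear (\<lambda>x. A *v x)" by (rule matrix_vector_mul_bounded_linear)
  define C where "C = 1 + onorm (\<lambda>x. A *v x)"
  have C: "C > 0" using onorm_pos_le[OF blA] by (simp add: C_def)
  have "\<epsilon> / (C * C) > 0" using \<epsilon> C by simp
  from uniform[OF this] obtain \<delta> where \<delta>: "\<delta> > 0" "\<And>p n. n \<in> regular_normal_cone (gph F) p \<Longrightarrow>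
      norm (p - (xbar, ybar)) < \<delta> \<Longrightarrow> \<bar>inner n (p - (xbar, ybar))\<bar> \<le> \<epsilon> / (C * C) * norm (p - (xbar, ybar)) * norm n"
    by metis
  have "\<bar>inner n (p - (xbar, vbar))\<bar> \<le> \<epsilon> * norm (p - (xbar, vbar)) * norm n"
    if n: "n \<in> regular_normal_cone (gph G) p" and p: "norm (p - (xbar, vbar)) < \<delta> / C" for p n
  proof -
    obtain x v where xv: "p = (x, v)" by (cases p)
    obtain \<xi> \<omega> where \<xi>: "n = (\<xi>, \<omega>)" by (cases n)
    define p' where "p' = (x, v + (A *v x + b))"
    define n' where "n' = (\<xi> - A *v \<omega>, \<omega>)"
    have n': "n' \<in> regular_normal_cone (gph F) p'"
      unfolding n'_def p'_def
      by (rule regular_normal_graph_shear[of A F b G, OF sym FG]) (use n in \<open>simp add: \<xi> xv\<close>)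
    have dp: "p' - (xbar, ybar) = (x - xbar, (v - vbar) + A *v (x - xbar))"
      by (simp add: p'_def vbar algebra_simps matrix_vector_mult_diff_distrib)
    have np: "norm (p' - (xbar, ybar)) \<le> C * norm (p - (xbar, vbar))"
      unfolding dp C_def using shear_norm_bound(1)[OF blA, of "x - xbar" "v - vbar"] by (simp add: xv)
    have nn: "norm n' \<le> C * norm n"
    proof -
      have eq: "n' = (\<xi> + A *v (- \<omega>), - (- \<omega>))"
        by (simp add: n'_def linear_neg[OF matrix_vector_mul_linear])
      have "norm n' = norm (\<xi> + A *v (- \<omega>), - \<omega>)" unfolding eq norm_Pair by simp
      also have "\<dots> \<le> C * norm (\<xi>, - \<omega>)" unfolding C_def by (rule shear_norm_bound(2)[OF blA])
      also have "norm (\<xi>, - \<omega>) = norm n" by (simp add: \<xi> norm_Pair)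
      finally show ?thesis .
    qed
    have "C * norm (p - (xbar, vbar)) < C * (\<delta> / C)" using p C by (intro mult_strict_left_mono) auto
    then have small: "norm (p' - (xbar, ybar)) < \<delta>" using np C by simp
    have "inner n (p - (xbar, vbar)) = inner n' (p' - (xbar, ybar))"
      unfolding dp by (simp add: \<xi> xv n'_def inner_diff_left inner_add_right inner_symmetric_matrix[OF sym])
    then have "\<bar>inner n (p - (xbar, vbar))\<bar> \<le> \<epsilon> / (C * C) * norm (p' - (xbar, ybar)) * norm n'"
      using \<delta>(2)[OF n' small] by simp
    also have "\<dots> \<le> \<epsilon> / (C * C) * (C * norm (p - (xbar, vbar))) * (C * norm n)"
      using np nn \<epsilon> C by (intro mult_mono) auto
    also have "\<dots> = \<epsilon> * norm (p - (xbar, vbar)) * norm n" using C by simp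
    finally show ?thesis .
  qed
  moreover have "\<delta> / C > 0" using \<delta> C by simp
  ultimately show ?thesis by blast
qed

text \<open>The form \<open>inner y \<Delta>x - inner (x - xbar) \<Delta>y\<close> is the standard symplectic form. A shear with
  symmetric matrix preserves it, so the bound carries over from \<open>G\<close> to \<open>F\<close>.\<close>

lemma graph_symmetry_shear:
  fixes A :: "real^'n^'n"
  assumes sym: "transpose A = A" and FG: "\<And>x v. v \<in> F x \<longleftrightarrow> v - (A *v x + b) \<in> G x"
    and G: "\<And>\<epsilon>. \<epsilon> > 0 \<Longrightarrow> \<exists>\<delta>>0. \<forall>p\<in>gph G. norm (p - (xbar, vbar)) < \<delta> \<longrightarrow>
      (\<exists>\<tau>>0. \<forall>p1\<in>gph G \<inter> ball p \<tau>. \<forall>p2\<in>gph G \<inter> ball p \<tau>.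
        \<bar>inner (snd p - vbar) (fst p1 - fst p2) - inner (fst p - xbar) (snd p1 - snd p2)\<bar>
          \<le> \<epsilon> * norm (p - (xbar, vbar)) * norm (p1 - p2))"
    and vbar: "vbar = - (A *v xbar + b)" and \<epsilon>: "\<epsilon> > 0"
  shows "\<exists>\<delta>>0. \<forall>p\<in>gph F. norm (p - (xbar, 0)) < \<delta> \<longrightarrow>
      (\<exists>\<tau>>0. \<forall>p1\<in>gph F \<inter> ball p \<tau>. \<forall>p2\<in>gph F \<inter> ball p \<tau>.
        \<bar>inner (snd p) (fst p1 - fst p2) - inner (fst p - xbar) (snd p1 - snd p2)\<bar>
          \<le> \<epsilon> * norm (p - (xbar, 0)) * norm (p1 - p2))"
proof -
  have blA: "bounded_linear (\<lambda>x. A *v x)" by (rule matrix_vector_mul_bounded_linear)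
  have blA': "bounded_linear (\<lambda>x. - (A *v x))" by (rule bounded_linear_minus[OF blA])
  define C where "C = 1 + onorm (\<lambda>x. - (A *v x))"
  have C: "C > 0" using onorm_pos_le[OF blA'] by (simp add: C_def)
  define S where "S p = (fst p, snd p - (A *v fst p + b))" for p :: "(real^'n) \<times> (real^'n)"
  have S_gph: "S p \<in> gph G \<longleftrightarrow> p \<in> gph F" for p using FG by (cases p) (simp add: S_def gph_def)
  have S_diff: "S p - S p' = (fst (p - p'), snd (p - p') - A *v (fst (p - p')))" for p p'
    by (simp add: S_def algebra_simps matrix_vector_mult_diff_distrib)
  have "norm (fst q, snd q - A *v fst q) \<le> C * norm q" for q :: "(real^'n) \<times> (real^'n)"
    using shear_norm_bound(1)[OF blA', of "fst q" "snd q"] by (simp add: C_def)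
  then have S_lip: "norm (S p - S p') \<le> C * norm (p - p')" for p p'
    unfolding S_diff by blast
  have S_bar: "S (xbar, 0) = (xbar, vbar)" by (simp add: S_def vbar)
  have "\<epsilon> / (C * C) > 0" using \<epsilon> C by simp
  from G[OF this] obtain \<delta> where \<delta>: "\<delta> > 0" and
    key: "\<And>p. p \<in> gph G \<Longrightarrow> norm (p - (xbar, vbar)) < \<delta> \<Longrightarrow>
      \<exists>\<tau>>0. \<forall>p1\<in>gph G \<inter> ball p \<tau>. \<forall>p2\<in>gph G \<inter> ball p \<tau>.
        \<bar>inner (snd p - vbar) (fst p1 - fst p2) - inner (fst p - xbar) (snd p1 - snd p2)\<bar>
          \<le> \<epsilon> / (C * C) * norm (p - (xbar, vbar)) * norm (p1 - p2)" by blast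
  have "\<exists>\<tau>>0. \<forall>p1\<in>gph F \<inter> ball p \<tau>. \<forall>p2\<in>gph F \<inter> ball p \<tau>.
        \<bar>inner (snd p) (fst p1 - fst p2) - inner (fst p - xbar) (snd p1 - snd p2)\<bar>
          \<le> \<epsilon> * norm (p - (xbar, 0)) * norm (p1 - p2)"
    if p: "p \<in> gph F" "norm (p - (xbar, 0)) < \<delta> / C" for p
  proof -
    have np: "norm (S p - (xbar, vbar)) \<le> C * norm (p - (xbar, 0))" using S_lip[of p "(xbar, 0)"] S_bar by simp
    have "C * norm (p - (xbar, 0)) < C * (\<delta> / C)" using p C by (intro mult_strict_left_mono) auto
    then have "norm (S p - (xbar, vbar)) < \<delta>" using np C by simp
    with key[of "S p"] p(1) obtain \<tau> where \<tau>: "\<tau> > 0" and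
      keyS: "\<And>p1 p2. p1 \<in> gph G \<inter> ball (S p) \<tau> \<Longrightarrow> p2 \<in> gph G \<inter> ball (S p) \<tau> \<Longrightarrow>
        \<bar>inner (snd (S p) - vbar) (fst p1 - fst p2) - inner (fst (S p) - xbar) (snd p1 - snd p2)\<bar>
          \<le> \<epsilon> / (C * C) * norm (S p - (xbar, vbar)) * norm (p1 - p2)" unfolding S_gph by meson
    have in_ball: "S p1 \<in> gph G \<inter> ball (S p) \<tau>" if "p1 \<in> gph F \<inter> ball p (\<tau> / C)" for p1
    proof -
      have "C * norm (p - p1) < C * (\<tau> / C)" using that C by (intro mult_strict_left_mono) (auto simp: dist_norm)
      then show ?thesis using S_lip[of p p1] S_gph that C by (simp add: dist_norm)
    qed
    have "\<bar>inner (snd p) (fst p1 - fst p2) - inner (fst p - xbar) (snd p1 - snd p2)\<bar>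
          \<le> \<epsilon> * norm (p - (xbar, 0)) * norm (p1 - p2)"
      if p12: "p1 \<in> gph F \<inter> ball p (\<tau> / C)" "p2 \<in> gph F \<inter> ball p (\<tau> / C)" for p1 p2
    proof -
      have 1: "snd (S p) - vbar = snd p - A *v (fst p - xbar)"
        by (simp add: S_def vbar matrix_vector_mult_diff_distrib)
      have 2: "snd (S p1) - snd (S p2) = (snd p1 - snd p2) - A *v (fst p1 - fst p2)"
        by (simp add: S_def matrix_vector_mult_diff_distrib)
      have "inner (snd (S p) - vbar) (fst (S p1) - fst (S p2)) - inner (fst (S p) - xbar) (snd (S p1) - snd (S p2))
          = inner (snd p) (fst p1 - fst p2) - inner (fst p - xbar) (snd p1 - snd p2)"
        unfolding 1 2 inner_diff_left[of "snd p"] inner_diff_right[of _ "snd p1 - snd p2"]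
          inner_symmetric_matrix[OF sym] by (simp add: S_def)
      then have "\<bar>inner (snd p) (fst p1 - fst p2) - inner (fst p - xbar) (snd p1 - snd p2)\<bar>
          \<le> \<epsilon> / (C * C) * norm (S p - (xbar, vbar)) * norm (S p1 - S p2)"
        using keyS[OF in_ball[OF p12(1)] in_ball[OF p12(2)]] by simp
      also have "\<dots> \<le> \<epsilon> / (C * C) * (C * norm (p - (xbar, 0))) * (C * norm (p1 - p2))"
        using np S_lip[of p1 p2] \<epsilon> C by (intro mult_mono) auto
      also have "\<dots> = \<epsilon> * norm (p - (xbar, 0)) * norm (p1 - p2)" using C by simp
      finally show ?thesis .
    qed
    moreover have "\<tau> / C > 0" using \<tau> C by simp
    ultimately show ?thesis by blast
  qed
  moreover have "\<delta> / C > 0" using \<delta> C by simp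
  ultimately show ?thesis by blast
qed

section \<open>The proximal mapping at a prox-regular point\<close>

lemma regular_normal_in_normal_cone:
  assumes "v \<in> regular_normal_cone \<Omega> z" shows "v \<in> normal_cone \<Omega> z"
proof -
  have "z \<in> \<Omega>" using assms regular_normal_iff by blast
  then show ?thesis using assms unfolding normal_cone_def
    by (intro CollectI conjI exI[of _ "\<lambda>_. z"] exI[of _ "\<lambda>_. v"]) auto
qed

text \<open>A quadratic minorant touching \<open>g\<close> at \<open>x\<close> makes \<open>(v, -1)\<close> a regular normal of the epigraph.\<close>

lemma proximal_subgradient_in_subdifferential:
  fixes g :: "'a::euclidean_space \<Rightarrow> ereal"
  assumes gx: "g x = ereal a" and \<sigma>: "\<sigma> \<ge> 0"
    and ineq: "\<And>y. g y \<ge> ereal (a + inner v (y - x) - \<sigma> * (norm (y - x))\<^sup>2)"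
  shows "v \<in> subdifferential g x"
proof -
  have "(v, -1) \<in> regular_normal_cone (epi g) (x, a)"
    unfolding regular_normal_iff
  proof (intro conjI allI impI)
    show "(x, a) \<in> epi g" using gx by (simp add: epi_def)
    fix \<epsilon> :: real assume \<epsilon>: "\<epsilon> > 0"
    have "inner (v, -1) (p - (x, a)) \<le> \<epsilon> * norm (p - (x, a))"
      if p: "p \<in> epi g" "norm (p - (x, a)) < \<epsilon> / (\<sigma> + 1)" for p
    proof -
      obtain y s where ys: "p = (y, s)" by (cases p)
      have "ereal (a + inner v (y - x) - \<sigma> * (norm (y - x))\<^sup>2) \<le> ereal s"
        by (rule order_trans[OF ineq]) (use p(1) ys in \<open>simp add: epi_def\<close>)
      then have "inner (v, -1) (p - (x, a)) \<le> \<sigma> * (norm (y - x))\<^sup>2"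
        by (simp add: ys inner_prod_def)
      also have "\<dots> \<le> \<sigma> * (norm (p - (x, a)))\<^sup>2"
        using \<sigma> by (intro mult_left_mono) (auto simp: ys norm_prod_def)
      also have "\<dots> = (\<sigma> * norm (p - (x, a))) * norm (p - (x, a))" by (simp add: power2_eq_square)
      also have "\<dots> \<le> \<epsilon> * norm (p - (x, a))"
      proof (rule mult_right_mono)
        have "\<sigma> * norm (p - (x, a)) \<le> (\<sigma> + 1) * (\<epsilon> / (\<sigma> + 1))"
          using \<sigma> p(2) by (intro mult_mono) auto
        then show "\<sigma> * norm (p - (x, a)) \<le> \<epsilon>" using \<sigma> by simp
      qed simp
      finally show ?thesis .
    qed
    then show "\<exists>\<delta>>0. \<forall>p\<in>epi g. norm (p - (x, a)) < \<delta> \<longrightarrow> inner (v, -1) (p - (x, a)) \<le> \<epsilon> * norm (p - (x, a))"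
      using \<epsilon> \<sigma> by (intro exI[of _ "\<epsilon> / (\<sigma> + 1)"]) auto
  qed
  then show ?thesis
    using gx regular_normal_in_normal_cone unfolding subdifferential_def edom_def by fastforce
qed

text \<open>A minimising sequence has a limit point; lower semicontinuity excludes a jump upwards there.\<close>

lemma lsc_plus_continuous_attains_inf:
  fixes g :: "'a::euclidean_space \<Rightarrow> ereal"
  assumes lsc: "\<forall>x. lsc_at g x" and g: "\<And>x. g x \<noteq> -\<infinity>" and K: "compact K" "K \<noteq> {}"
    and \<theta>: "continuous_on UNIV \<theta>"
  shows "\<exists>y\<in>K. \<forall>z\<in>K. g y + ereal (\<theta> y) \<le> g z + ereal (\<theta> z)"
proof -
  define f where "f y = g y + ereal (\<theta> y)" for y
  obtain u where u: "\<And>n. u n \<in> f ` K" "u \<longlonglongrightarrow> Inf (f ` K)"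
    using Inf_as_limit[of "f ` K"] K by auto
  have "\<forall>n. \<exists>y. y \<in> K \<and> u n = f y" using u(1) by blast
  then obtain s where s: "\<And>n. s n \<in> K" "\<And>n. u n = f (s n)" using choice[of "\<lambda>n y. y \<in> K \<and> u n = f y"] by blast
  obtain y \<kappa> where y: "y \<in> K" "strict_mono \<kappa>" "(s \<circ> \<kappa>) \<longlonglongrightarrow> y"
    using K(1) s(1) unfolding compact_def by metis
  have "f y \<le> Inf (f ` K)"
  proof (rule ccontr)
    assume "\<not> f y \<le> Inf (f ` K)"
    then obtain c where c: "Inf (f ` K) < ereal c" "ereal c < f y"
      using ereal_dense2[of "Inf (f ` K)" "f y"] by (metis not_le)
    have "ereal (c - \<theta> y) < g y" using c(2) g[of y] by (cases "g y") (auto simp: f_def)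
    then obtain c' where c': "ereal (c - \<theta> y) < ereal c'" "ereal c' < g y"
      using ereal_dense2 by blast
    have "\<forall>\<^sub>F x in at y. ereal c' < g x"
      using lsc c'(2) unfolding lsc_at_def le_Liminf_iff by auto
    then have 1: "\<forall>\<^sub>F x in nhds y. ereal c' < g x" using c'(2) by (simp add: eventually_nhds_conv_at)
    have lim: "(\<theta> \<longlongrightarrow> \<theta> y) (nhds y)"
      using \<theta> by (simp add: continuous_on_eq_continuous_at isCont_def tendsto_at_iff_tendsto_nhds)
    have 2: "\<forall>\<^sub>F x in nhds y. c - c' < \<theta> x" by (rule order_tendstoD(1)[OF lim]) (use c'(1) in simp)
    have "\<forall>\<^sub>F x in nhds y. ereal c < f x" using 1 2
    proof eventually_elim
      case (elim x)
      then show ?case by (cases "g x") (auto simp: f_def)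
    qed
    then have "\<forall>\<^sub>F n in sequentially. ereal c < f ((s \<circ> \<kappa>) n)"
      by (rule eventually_compose_filterlim[OF _ y(3)])
    moreover have "(\<lambda>n. f ((s \<circ> \<kappa>) n)) \<longlonglongrightarrow> Inf (f ` K)"
      using LIMSEQ_subseq_LIMSEQ[OF u(2) y(2)] s(2) by (simp add: comp_def)
    then have "\<forall>\<^sub>F n in sequentially. f ((s \<circ> \<kappa>) n) < ereal c" using c(1) by (rule order_tendstoD)
    ultimately have "\<forall>\<^sub>F n in sequentially. False" by eventually_elim auto
    then show False by simp
  qed
  then show ?thesis using y(1) unfolding f_def[symmetric] by (meson INF_lower order_trans)
qed

text \<open>The minorant makes the proximal objective at \<open>ubar\<close> grow quadratically and globally away from
  its minimiser \<open>xbar\<close>, because \<open>\<gamma> < 1 / r\<close>; the local inequality of prox-regularity then makes nearby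
  proximal points unique.\<close>

locale prox_regular_minorant =
  fixes g :: "'a::euclidean_space \<Rightarrow> ereal" and xbar vbar :: 'a and r \<gamma> :: real
  assumes lsc: "\<forall>x. lsc_at g x" and g_minf: "\<And>x. g x \<noteq> -\<infinity>"
    and cpr: "continuously_prox_regular g xbar vbar r"
    and minorant: "\<And>x. g x \<ge> g xbar + ereal (inner vbar (x - xbar) - r / 2 * (norm (x - xbar))\<^sup>2)"
    and gamma: "0 < \<gamma>" "\<gamma> < 1 / r"
begin

definition "gbar = real_of_ereal (g xbar)"
definition "ubar = xbar + \<gamma> *\<^sub>R vbar"
text \<open>Twice the Lipschitz constant of the proximal mapping; it bounds the distance of proximal points
  to \<open>xbar\<close> relative to \<open>norm (u - ubar)\<close>.\<close>

definition "\<kappa> = 2 / (1 - \<gamma> * r)"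

lemma r_pos: "r > 0"
  using cpr unfolding continuously_prox_regular_def prox_regular_def by auto

lemma gamma_r: "1 - \<gamma> * r > 0"
  using gamma r_pos by (simp add: field_simps)

lemma kappa_pos: "\<kappa> > 0"
  using gamma_r by (simp add: \<kappa>_def)

lemma g_xbar: "g xbar = ereal gbar"
  using cpr g_minf[of xbar] unfolding continuously_prox_regular_def prox_regular_def edom_def gbar_def
  by (cases "g xbar") auto

lemma prox_iff: "y \<in> Prox \<gamma> g u \<longleftrightarrow>
    (\<forall>z. g y + ereal (1 / (2 * \<gamma>) * (norm (y - u))\<^sup>2) \<le> g z + ereal (1 / (2 * \<gamma>) * (norm (z - u))\<^sup>2))"
  unfolding Prox_def is_arg_min_def by (auto simp: not_less)

text \<open>Any point that is no worse than \<open>xbar\<close> lies close to \<open>xbar\<close>: at \<open>u = ubar\<close> the minorant leaves a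
  surplus of \<open>(1 - \<gamma> * r) / (2 * \<gamma>)\<close> times the squared distance, and moving \<open>u\<close> adds only a linear
  term. This gives existence, by compactness, and location of proximal points at once.\<close>

lemma prox_objective_growth:
  assumes "g y + ereal (1 / (2 * \<gamma>) * (norm (y - u))\<^sup>2) \<le> g xbar + ereal (1 / (2 * \<gamma>) * (norm (xbar - u))\<^sup>2)"
  shows "norm (y - xbar) \<le> \<kappa> * norm (u - ubar)"
proof -
  have "g y \<noteq> \<infinity>" using assms by (auto simp: g_xbar)
  then obtain b where b: "g y = ereal b" using g_minf[of y] by (cases "g y") auto
  have 1: "b + 1 / (2 * \<gamma>) * (norm (y - u))\<^sup>2 \<le> gbar + 1 / (2 * \<gamma>) * (norm (xbar - u))\<^sup>2"
    using assms by (simp add: b g_xbar)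
  have 2: "gbar + inner vbar (y - xbar) - r / 2 * (norm (y - xbar))\<^sup>2 \<le> b"
    using minorant[of y] by (simp add: b g_xbar)
  have y: "(norm (y - u))\<^sup>2 = (norm (y - xbar))\<^sup>2 + 2 * inner (y - xbar) (xbar - u) + (norm (xbar - u))\<^sup>2"
    unfolding power2_norm_eq_inner by (simp add: inner_diff_left inner_diff_right inner_commute)
  have xu: "inner (y - xbar) (xbar - u) = - inner (y - xbar) (u - ubar) - \<gamma> * inner vbar (y - xbar)"
    by (simp add: ubar_def inner_diff_left inner_diff_right inner_add_left inner_add_right inner_commute algebra_simps)
  have "inner vbar (y - xbar) - r / 2 * (norm (y - xbar))\<^sup>2
      + 1 / (2 * \<gamma>) * ((norm (y - xbar))\<^sup>2 + 2 * inner (y - xbar) (xbar - u)) \<le> 0"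
    using 1 2 unfolding y by (simp add: distrib_left)
  then have le: "2 * \<gamma> * (inner vbar (y - xbar) - r / 2 * (norm (y - xbar))\<^sup>2
      + 1 / (2 * \<gamma>) * ((norm (y - xbar))\<^sup>2 + 2 * (- inner (y - xbar) (u - ubar) - \<gamma> * inner vbar (y - xbar)))) \<le> 0"
    using gamma(1) unfolding xu by (intro mult_nonneg_nonpos) auto
  have "2 * \<gamma> * (V - r / 2 * N + 1 / (2 * \<gamma>) * (N + 2 * (- I - \<gamma> * V))) = (1 - \<gamma> * r) * N - 2 * I"
    for V N I using gamma(1) by (simp add: field_simps)
  from le[unfolded this] have "(1 - \<gamma> * r) * (norm (y - xbar))\<^sup>2 \<le> 2 * inner (y - xbar) (u - ubar)"
    by simp
  also have "\<dots> \<le> 2 * (norm (y - xbar) * norm (u - ubar))" using norm_cauchy_schwarz by auto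
  finally have "norm (y - xbar) * ((1 - \<gamma> * r) * norm (y - xbar)) \<le> norm (y - xbar) * (2 * norm (u - ubar))"
    by (simp add: power2_eq_square algebra_simps)
  then have "(1 - \<gamma> * r) * norm (y - xbar) \<le> 2 * norm (u - ubar)" 
    by (cases "norm (y - xbar) = 0") auto
  then show ?thesis using gamma_r by (simp add: \<kappa>_def field_simps)
qed

lemma prox_nonempty: "Prox \<gamma> g u \<noteq> {}"
proof -
  define K where "K = cball xbar (\<kappa> * norm (u - ubar))"
  have "0 \<le> \<kappa> * norm (u - ubar)" using kappa_pos by simp
  then have xK: "xbar \<in> K" by (simp add: K_def)
  have "continuous_on UNIV (\<lambda>y. 1 / (2 * \<gamma>) * (norm (y - u))\<^sup>2)" by (intro continuous_intros)
  then obtain y where y: "y \<in> K" "\<And>z. z \<in> K \<Longrightarrow> g y + ereal (1 / (2 * \<gamma>) * (norm (y - u))\<^sup>2)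
      \<le> g z + ereal (1 / (2 * \<gamma>) * (norm (z - u))\<^sup>2)"
    using lsc_plus_continuous_attains_inf[OF lsc g_minf, of K] xK by (fastforce simp: K_def)
  have "y \<in> Prox \<gamma> g u" unfolding prox_iff
  proof
    fix z show "g y + ereal (1 / (2 * \<gamma>) * (norm (y - u))\<^sup>2) \<le> g z + ereal (1 / (2 * \<gamma>) * (norm (z - u))\<^sup>2)"
    proof (cases "z \<in> K")
      case True then show ?thesis by (rule y(2))
    next
      case False
      then have "\<not> norm (z - xbar) \<le> \<kappa> * norm (u - ubar)" by (simp add: K_def dist_norm norm_minus_commute)
      then show ?thesis using prox_objective_growth[of z u] y(2)[OF xK] by (meson linear order_trans)
    qed
  qed
  then show ?thesis by auto
qed

lemma prox_point:
  assumes y: "y \<in> Prox \<gamma> g u"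
  shows prox_near: "norm (y - xbar) \<le> \<kappa> * norm (u - ubar)"
    and prox_finite: "g y = ereal (real_of_ereal (g y))"
    and prox_subgradient: "(1 / \<gamma>) *\<^sub>R (u - y) \<in> subdifferential g y"
    and prox_le: "real_of_ereal (g y) \<le> gbar + 1 / (2 * \<gamma>) * ((norm (xbar - u))\<^sup>2 - (norm (y - u))\<^sup>2)"
proof -
  note min = y[unfolded prox_iff, rule_format]
  show near: "norm (y - xbar) \<le> \<kappa> * norm (u - ubar)" by (rule prox_objective_growth[OF min])
  have "g y \<noteq> \<infinity>" using min[of xbar] by (auto simp: g_xbar)
  then show fin: "g y = ereal (real_of_ereal (g y))" using g_minf[of y] by (cases "g y") auto
  define b where "b = real_of_ereal (g y)"
  have b: "g y = ereal b" using fin b_def by simp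
  show "real_of_ereal (g y) \<le> gbar + 1 / (2 * \<gamma>) * ((norm (xbar - u))\<^sup>2 - (norm (y - u))\<^sup>2)"
    using min[of xbar] by (simp add: b g_xbar algebra_simps diff_divide_distrib)
  show "(1 / \<gamma>) *\<^sub>R (u - y) \<in> subdifferential g y"
  proof (rule proximal_subgradient_in_subdifferential[where g = g and x = y and \<sigma> = "1 / (2 * \<gamma>)", OF b])
    show "0 \<le> 1 / (2 * \<gamma>)" using gamma by simp
    fix z
    have "(norm (z - u))\<^sup>2 = (norm (z - y))\<^sup>2 - 2 * inner (u - y) (z - y) + (norm (y - u))\<^sup>2"
      unfolding power2_norm_eq_inner by (simp add: inner_diff_left inner_diff_right inner_commute)
    moreover have "b + 1 / \<gamma> * I - 1 / (2 * \<gamma>) * N = b + 1 / (2 * \<gamma>) * Y - 1 / (2 * \<gamma>) * (N - 2 * I + Y)"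
      for I N Y using gamma(1) by (simp add: field_simps)
    ultimately have "b + inner ((1 / \<gamma>) *\<^sub>R (u - y)) (z - y) - 1 / (2 * \<gamma>) * (norm (z - y))\<^sup>2
        = b + 1 / (2 * \<gamma>) * (norm (y - u))\<^sup>2 - 1 / (2 * \<gamma>) * (norm (z - u))\<^sup>2"
      by (simp only: inner_scaleR_left)
    then show "ereal (b + inner ((1 / \<gamma>) *\<^sub>R (u - y)) (z - y) - 1 / (2 * \<gamma>) * (norm (z - y))\<^sup>2) \<le> g z"
      using min[of z] by (cases "g z") (auto simp: b)
  qed
qed

text \<open>The localization of the subgradient graph in which function values are controlled too;
  this is where the inequality of prox-regularity is available.\<close>

definition attentive_graph :: "real \<Rightarrow> ('a \<times> 'a) set" where
  "attentive_graph \<epsilon> = {(x, v). v \<in> subdifferential g x \<and> norm (x - xbar) < \<epsilon> \<and> norm (v - vbar) < \<epsilon> \<and>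
      \<bar>g x - g xbar\<bar> < ereal \<epsilon>}"

text \<open>Adding the prox-regularity inequality at two points shows that the subgradients are
  monotone up to \<open>-r\<close>; since \<open>\<gamma> * r < 1\<close>, the map \<open>(x, v) \<mapsto> x + \<gamma> *\<^sub>R v\<close> is then expansive in \<open>x\<close>,
  which is uniqueness and Lipschitz continuity of its inverse, the proximal mapping.\<close>

lemma attentive_graph_expansive:
  "\<exists>\<epsilon>>0. \<forall>(x1, v1)\<in>attentive_graph \<epsilon>. \<forall>(x2, v2)\<in>attentive_graph \<epsilon>.
     (1 - \<gamma> * r) * norm (x1 - x2) \<le> norm ((x1 + \<gamma> *\<^sub>R v1) - (x2 + \<gamma> *\<^sub>R v2))"
proof -
  obtain \<epsilon> where \<epsilon>: "\<epsilon> > 0" and pr: "\<forall>x\<in>cball xbar \<epsilon>. \<forall>u\<in>cball xbar \<epsilon>. \<bar>g u - g xbar\<bar> < ereal \<epsilon> \<longrightarrow>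
        (\<forall>v \<in> subdifferential g u \<inter> cball vbar \<epsilon>.
           g x \<ge> g u + ereal (inner v (x - u) - r / 2 * (norm (x - u))\<^sup>2))"
    using cpr unfolding continuously_prox_regular_def prox_regular_def by blast
  have pr': "g x \<ge> g u + ereal (inner v (x - u) - r / 2 * (norm (x - u))\<^sup>2)"
    if "(x, w) \<in> attentive_graph \<epsilon>" "(u, v) \<in> attentive_graph \<epsilon>" for x u v w
    using pr[rule_format, of x u v] that by (simp add: attentive_graph_def dist_norm norm_minus_commute)
  have fin: "\<exists>b. g x = ereal b" if "(x, w) \<in> attentive_graph \<epsilon>" for x w
    using that g_minf[of x] by (cases "g x") (auto simp: attentive_graph_def g_xbar)
  have "(1 - \<gamma> * r) * norm (x1 - x2) \<le> norm ((x1 + \<gamma> *\<^sub>R v1) - (x2 + \<gamma> *\<^sub>R v2))"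
    if g1: "(x1, v1) \<in> attentive_graph \<epsilon>" and g2: "(x2, v2) \<in> attentive_graph \<epsilon>" for x1 v1 x2 v2
  proof -
    obtain b1 b2 where b: "g x1 = ereal b1" "g x2 = ereal b2" using fin g1 g2 by blast
    have i1: "b1 \<ge> b2 + (inner v2 (x1 - x2) - r / 2 * (norm (x1 - x2))\<^sup>2)"
      using pr'[OF g1 g2] b by simp
    have i2: "b2 \<ge> b1 + (inner v1 (x2 - x1) - r / 2 * (norm (x2 - x1))\<^sup>2)"
      using pr'[OF g2 g1] b by simp
    have "- r * (norm (x1 - x2))\<^sup>2 \<le> inner (v1 - v2) (x1 - x2)"
      using i1 i2 by (simp add: norm_minus_commute inner_diff_left inner_diff_right)
    then have "\<gamma> * (- r * (norm (x1 - x2))\<^sup>2) \<le> \<gamma> * inner (v1 - v2) (x1 - x2)"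
      using gamma by (intro mult_left_mono) auto
    then have "(1 - \<gamma> * r) * (norm (x1 - x2))\<^sup>2 \<le> inner (x1 - x2) (x1 - x2) + \<gamma> * inner (v1 - v2) (x1 - x2)"
      by (simp add: algebra_simps flip: power2_norm_eq_inner)
    also have "\<dots> = inner ((x1 + \<gamma> *\<^sub>R v1) - (x2 + \<gamma> *\<^sub>R v2)) (x1 - x2)"
      by (simp add: inner_diff_left inner_add_left algebra_simps)
    also have "\<dots> \<le> norm ((x1 + \<gamma> *\<^sub>R v1) - (x2 + \<gamma> *\<^sub>R v2)) * norm (x1 - x2)" by (rule norm_cauchy_schwarz)
    finally have "norm (x1 - x2) * ((1 - \<gamma> * r) * norm (x1 - x2)) \<le>
        norm (x1 - x2) * norm ((x1 + \<gamma> *\<^sub>R v1) - (x2 + \<gamma> *\<^sub>R v2))"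
      by (simp add: power2_eq_square algebra_simps)
    then show ?thesis by (cases "norm (x1 - x2) = 0") auto
  qed
  then show ?thesis using \<epsilon> by blast
qed

text \<open>All three distances to the reference data are \<open>O(norm (u - ubar))\<close>. The function value is squeezed
  between the minorant and the value forced by minimality.\<close>

lemma prox_in_attentive_graph:
  assumes \<epsilon>: "\<epsilon> > 0"
  shows "\<exists>\<rho>>0. \<forall>u\<in>ball ubar \<rho>. \<forall>y\<in>Prox \<gamma> g u. (y, (1 / \<gamma>) *\<^sub>R (u - y)) \<in> attentive_graph \<epsilon>"
proof -
  \<comment> \<open>Linear bounds, valid for \<open>norm (u - ubar) \<le> 1\<close>: \<open>C1\<close> and \<open>C2\<close> for the value from above and below, \<open>C3\<close> for the subgradient.\<close>
  define C1 where "C1 = \<kappa> / (2 * \<gamma>) * (2 * (1 + \<gamma> * norm vbar) + \<kappa>)"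
  define C2 where "C2 = norm vbar * \<kappa> + r / 2 * \<kappa>\<^sup>2"
  define C3 where "C3 = (1 + \<kappa>) / \<gamma>"
  have nn: "C1 \<ge> 0" "C2 \<ge> 0" "C3 \<ge> 0"
    using gamma kappa_pos r_pos by (auto simp: C1_def C2_def C3_def)
  define C where "C = C1 + C2 + C3 + \<kappa> + 1"
  have C: "C > 0" "C1 < C" "C2 < C" "C3 < C" "\<kappa> < C" using nn kappa_pos by (auto simp: C_def)
  define \<rho> where "\<rho> = min 1 (\<epsilon> / C)"
  have \<rho>: "\<rho> > 0" using \<epsilon> C by (simp add: \<rho>_def)
  have "(y, (1 / \<gamma>) *\<^sub>R (u - y)) \<in> attentive_graph \<epsilon>" if u: "u \<in> ball ubar \<rho>" and y: "y \<in> Prox \<gamma> g u" for u y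
  proof -
    define \<delta> where "\<delta> = norm (u - ubar)"
    have \<delta>: "\<delta> \<ge> 0" "\<delta> \<le> 1" "C * \<delta> < \<epsilon>"
      using u C by (auto simp: \<delta>_def \<rho>_def dist_norm norm_minus_commute field_simps)
    have small: "c * \<delta> < \<epsilon>" if "c < C" for c
      using mult_right_mono[of c C \<delta>] that \<delta> by auto
    have near: "norm (y - xbar) \<le> \<kappa> * \<delta>" using prox_near[OF y] by (simp add: \<delta>_def)
    have "norm (y - xbar) < \<epsilon>" using near small[of \<kappa>] C by simp
    moreover have "norm ((1 / \<gamma>) *\<^sub>R (u - y) - vbar) < \<epsilon>"
    proof -
      have "(1 / \<gamma>) *\<^sub>R (u - y) - vbar = (1 / \<gamma>) *\<^sub>R ((u - ubar) - (y - xbar))"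
        using gamma(1) by (simp add: ubar_def algebra_simps)
      also have "norm \<dots> = (1 / \<gamma>) * norm ((u - ubar) - (y - xbar))" using gamma(1) by simp
      also have "\<dots> \<le> (1 / \<gamma>) * (\<delta> + \<kappa> * \<delta>)"
        using gamma(1) near norm_triangle_ineq4[of "u - ubar" "y - xbar"]
        by (intro mult_left_mono) (auto simp: \<delta>_def)
      also have "\<dots> = C3 * \<delta>" by (simp add: C3_def add_divide_distrib algebra_simps)
      finally show ?thesis using small[OF C(4)] by simp
    qed
    moreover have "\<bar>g y - g xbar\<bar> < ereal \<epsilon>"
    proof -
      define b where "b = real_of_ereal (g y)"
      have b: "g y = ereal b" using prox_finite[OF y] b_def by simp
      have "b - gbar \<le> 1 / (2 * \<gamma>) * ((norm (xbar - u))\<^sup>2 - (norm (y - u))\<^sup>2)"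
        using prox_le[OF y] by (simp add: b_def)
      also have "\<dots> \<le> 1 / (2 * \<gamma>) * (\<kappa> * \<delta> * (2 * (1 + \<gamma> * norm vbar) + \<kappa>))"
      proof (rule mult_left_mono)
        have "xbar - u = - (u - ubar) - \<gamma> *\<^sub>R vbar" by (simp add: ubar_def)
        then have "norm (xbar - u) \<le> norm (- (u - ubar)) + norm (\<gamma> *\<^sub>R vbar)"
          by (simp only: norm_triangle_ineq4)
        then have xu: "norm (xbar - u) \<le> 1 + \<gamma> * norm vbar"
          using \<delta>(2) gamma(1) unfolding norm_minus_cancel \<delta>_def by simp
        have d: "norm (xbar - u) - norm (y - u) \<le> \<kappa> * \<delta>"
          using norm_triangle_sub[of "xbar - u" "y - u"] near by (simp add: norm_minus_commute)
        have d1: "\<kappa> * \<delta> \<le> \<kappa>" using \<delta> kappa_pos by (simp add: mult_left_le)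
        have s: "norm (y - u) \<le> norm (xbar - u) + \<kappa> * \<delta>"
          using norm_triangle_sub[of "y - u" "xbar - u"] near by (simp add: norm_minus_commute)
        have "(norm (xbar - u))\<^sup>2 - (norm (y - u))\<^sup>2 = (norm (xbar - u) - norm (y - u)) * (norm (xbar - u) + norm (y - u))"
          by (simp add: power2_eq_square algebra_simps)
        also have "\<dots> \<le> (\<kappa> * \<delta>) * (norm (xbar - u) + norm (y - u))"
          using d by (rule mult_right_mono) simp
        also have "\<dots> \<le> (\<kappa> * \<delta>) * (2 * (1 + \<gamma> * norm vbar) + \<kappa>)"
        proof (rule mult_left_mono)
          show "norm (xbar - u) + norm (y - u) \<le> 2 * (1 + \<gamma> * norm vbar) + \<kappa>"
          proof -
            have "norm (xbar - u) + norm (y - u) \<le> 2 * norm (xbar - u) + \<kappa>" using order_trans[OF s] d1 s by simp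
            also have "\<dots> \<le> 2 * (1 + \<gamma> * norm vbar) + \<kappa>" by (intro add_right_mono mult_left_mono xu) simp
            finally show ?thesis .
          qed
        qed (use \<delta> kappa_pos in simp)
        finally show "(norm (xbar - u))\<^sup>2 - (norm (y - u))\<^sup>2 \<le> \<kappa> * \<delta> * (2 * (1 + \<gamma> * norm vbar) + \<kappa>)" .
      qed (use gamma in simp)
      also have "\<dots> = C1 * \<delta>" by (simp add: C1_def)
      finally have up: "b - gbar < \<epsilon>" using small[OF C(2)] by simp
      have "gbar - b \<le> - inner vbar (y - xbar) + r / 2 * (norm (y - xbar))\<^sup>2"
        using minorant[of y] by (simp add: b g_xbar)
      also have "\<dots> \<le> norm vbar * norm (y - xbar) + r / 2 * (norm (y - xbar))\<^sup>2"
        using norm_cauchy_schwarz[of "- vbar" "y - xbar"] by simp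
      also have "\<dots> \<le> norm vbar * (\<kappa> * \<delta>) + r / 2 * (\<kappa> * \<delta>)\<^sup>2"
        using near r_pos by (intro add_mono mult_left_mono power_mono) auto
      also have "\<dots> \<le> norm vbar * (\<kappa> * \<delta>) + r / 2 * (\<kappa>\<^sup>2 * \<delta>)"
      proof -
        have "\<delta>\<^sup>2 \<le> \<delta>" using \<delta> by (simp add: power2_eq_square mult_left_le)
        then show ?thesis using r_pos by (simp add: power_mult_distrib mult_left_mono)
      qed
      also have "\<dots> = C2 * \<delta>" by (simp add: C2_def algebra_simps)
      finally have "gbar - b < \<epsilon>" using small[OF C(3)] by simp
      then show ?thesis using up by (simp add: b g_xbar)
    qed
    ultimately show ?thesis using prox_subgradient[OF y] by (simp add: attentive_graph_def)
  qed
  then show ?thesis using \<rho> by blast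
qed

text \<open>Subdifferential continuity turns closeness of points and subgradients into closeness of values.\<close>

lemma subgradients_in_attentive_graph:
  assumes \<epsilon>: "\<epsilon> > 0"
  shows "\<exists>\<eta>>0. \<forall>x v. v \<in> subdifferential g x \<longrightarrow> norm (x - xbar) < \<eta> \<longrightarrow> norm (v - vbar) < \<eta> \<longrightarrow>
    (x, v) \<in> attentive_graph \<epsilon>"
proof (rule ccontr)
  assume "\<not> ?thesis"
  then have neg: "\<exists>x v. v \<in> subdifferential g x \<and> norm (x - xbar) < \<eta> \<and> norm (v - vbar) < \<eta> \<and> (x, v) \<notin> attentive_graph \<epsilon>"
    if "\<eta> > 0" for \<eta> using that by blast
  have "\<exists>x v. v \<in> subdifferential g x \<and> norm (x - xbar) < inverse (real (Suc n)) \<and>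
      norm (v - vbar) < inverse (real (Suc n)) \<and> (x, v) \<notin> attentive_graph \<epsilon>" for n
    by (rule neg) simp
  then obtain x v where xv: "\<And>n. v n \<in> subdifferential g (x n)"
    "\<And>n. norm (x n - xbar) < inverse (real (Suc n))" "\<And>n. norm (v n - vbar) < inverse (real (Suc n))"
    "\<And>n. (x n, v n) \<notin> attentive_graph \<epsilon>" by metis
  have "(\<lambda>n. x n - xbar) \<longlonglongrightarrow> 0" "(\<lambda>n. v n - vbar) \<longlonglongrightarrow> 0"
    using xv(2,3) by (auto intro!: Lim_null_comparison[OF _ LIMSEQ_inverse_real_of_nat] always_eventually less_imp_le)
  then have lim: "x \<longlonglongrightarrow> xbar" "v \<longlonglongrightarrow> vbar" by (simp_all add: LIM_zero_iff)
  then have glim: "(\<lambda>n. g (x n)) \<longlonglongrightarrow> ereal gbar"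
    using cpr xv(1) unfolding continuously_prox_regular_def subdifferentially_continuous_def g_xbar[symmetric] by blast
  have "\<forall>\<^sub>F n in sequentially. g (x n) < ereal (gbar + \<epsilon>)" "\<forall>\<^sub>F n in sequentially. g (x n) > ereal (gbar - \<epsilon>)"
    by (rule order_tendstoD[OF glim]; use \<epsilon> in simp)+
  moreover have "\<forall>\<^sub>F n in sequentially. norm (x n - xbar) < \<epsilon>" "\<forall>\<^sub>F n in sequentially. norm (v n - vbar) < \<epsilon>"
    using lim \<epsilon> by (auto simp: tendsto_iff dist_norm)
  ultimately have "\<forall>\<^sub>F n in sequentially. False"
  proof eventually_elim
    case (elim n)
    then have "\<bar>g (x n) - g xbar\<bar> < ereal \<epsilon>" by (cases "g (x n)") (auto simp: g_xbar)
    then have "(x n, v n) \<in> attentive_graph \<epsilon>" using elim xv(1) by (simp add: attentive_graph_def)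
    then show ?case using xv(4) by blast
  qed
  then show False by simp
qed

text \<open>Near \<open>(xbar, vbar)\<close> the subgradient graph is parametrized by \<open>u = x + \<gamma> *\<^sub>R v\<close> through \<open>P\<close>. The
  function \<open>E\<close> is the conjugate of the sum of \<open>\<gamma> g\<close> and half the squared norm, so that comparing two proximal
  points in each other's problem is exactly the subgradient inequality for \<open>E\<close>: \<open>P\<close> is a gradient.\<close>

lemma prox_parametrization:
  obtains \<rho> \<eta> P E where "\<rho> > 0" "\<eta> > 0"
    "\<And>u. u \<in> ball ubar \<rho> \<Longrightarrow> Prox \<gamma> g u = {P u}"
    "\<And>u. u \<in> ball ubar \<rho> \<Longrightarrow> (1 / \<gamma>) *\<^sub>R (u - P u) \<in> subdifferential g (P u)"
    "(1 / (1 - \<gamma> * r))-lipschitz_on (ball ubar \<rho>) P" "P ubar = xbar"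
    "\<And>u u'. u \<in> ball ubar \<rho> \<Longrightarrow> u' \<in> ball ubar \<rho> \<Longrightarrow> E u' \<ge> E u + inner (P u) (u' - u)"
    "\<And>x v. v \<in> subdifferential g x \<Longrightarrow> norm (x - xbar) < \<eta> \<Longrightarrow> norm (v - vbar) < \<eta> \<Longrightarrow>
       P (x + \<gamma> *\<^sub>R v) = x"
proof -
  obtain \<epsilon> where \<epsilon>: "\<epsilon> > 0" and ex: "\<forall>(x1, v1)\<in>attentive_graph \<epsilon>. \<forall>(x2, v2)\<in>attentive_graph \<epsilon>.
     (1 - \<gamma> * r) * norm (x1 - x2) \<le> norm ((x1 + \<gamma> *\<^sub>R v1) - (x2 + \<gamma> *\<^sub>R v2))"
    using attentive_graph_expansive by blast
  obtain \<rho> where \<rho>: "\<rho> > 0" "\<forall>u\<in>ball ubar \<rho>. \<forall>y\<in>Prox \<gamma> g u. (y, (1 / \<gamma>) *\<^sub>R (u - y)) \<in> attentive_graph \<epsilon>"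
    using prox_in_attentive_graph[OF \<epsilon>] by blast
  obtain \<eta>1 where \<eta>1: "\<eta>1 > 0" "\<forall>x v. v \<in> subdifferential g x \<longrightarrow> norm (x - xbar) < \<eta>1 \<longrightarrow>
      norm (v - vbar) < \<eta>1 \<longrightarrow> (x, v) \<in> attentive_graph \<epsilon>" using subgradients_in_attentive_graph[OF \<epsilon>] by blast
  define P where "P u = (SOME y. y \<in> Prox \<gamma> g u)" for u
  have P: "P u \<in> Prox \<gamma> g u" for u unfolding P_def using prox_nonempty[of u] by (meson ex_in_conv someI_ex)
  have exP: "(1 - \<gamma> * r) * norm (y1 - y2) \<le> norm (u1 - u2)"
    if "u1 \<in> ball ubar \<rho>" "u2 \<in> ball ubar \<rho>" "y1 \<in> Prox \<gamma> g u1" "y2 \<in> Prox \<gamma> g u2" for u1 u2 y1 y2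
  proof -
    have "(y1, (1 / \<gamma>) *\<^sub>R (u1 - y1)) \<in> attentive_graph \<epsilon>" "(y2, (1 / \<gamma>) *\<^sub>R (u2 - y2)) \<in> attentive_graph \<epsilon>"
      using \<rho>(2) that by blast+
    with ex have "(1 - \<gamma> * r) * norm (y1 - y2) \<le>
        norm ((y1 + \<gamma> *\<^sub>R ((1 / \<gamma>) *\<^sub>R (u1 - y1))) - (y2 + \<gamma> *\<^sub>R ((1 / \<gamma>) *\<^sub>R (u2 - y2))))" by fast
    then show ?thesis using gamma(1) by simp
  qed
  have sing: "Prox \<gamma> g u = {P u}" if u: "u \<in> ball ubar \<rho>" for u
  proof -
    have "y = P u" if "y \<in> Prox \<gamma> g u" for y
      using exP[OF u u that P] gamma_r by (simp add: mult_le_0_iff)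
    then show ?thesis using P by blast
  qed
  define h where "h u = real_of_ereal (g (P u))" for u
  have h: "g (P u) = ereal (h u)" for u using prox_finite[OF P] by (simp add: h_def)
  \<comment> \<open>The value at \<open>u\<close> of the conjugate of \<open>\<gamma> g + norm\<^sup>2 / 2\<close>, attained at the proximal point.\<close>
  define E where "E u = inner u (P u) - \<gamma> * h u - (norm (P u))\<^sup>2 / 2" for u
  define \<eta> where "\<eta> = min \<eta>1 (\<rho> / (1 + \<gamma>))"
  have inv: "P (x + \<gamma> *\<^sub>R v) = x"
    if v: "v \<in> subdifferential g x" "norm (x - xbar) < \<eta>" "norm (v - vbar) < \<eta>" for x v
  proof -
    have xv: "(x, v) \<in> attentive_graph \<epsilon>" using \<eta>1(2) v by (simp add: \<eta>_def)
    define u where "u = x + \<gamma> *\<^sub>R v"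
    have "u - ubar = (x - xbar) + \<gamma> *\<^sub>R (v - vbar)"
      by (simp add: u_def ubar_def algebra_simps)
    then have "norm (u - ubar) \<le> norm (x - xbar) + norm (\<gamma> *\<^sub>R (v - vbar))"
      by (simp only: norm_triangle_ineq)
    then have "norm (u - ubar) \<le> norm (x - xbar) + \<gamma> * norm (v - vbar)"
      using gamma(1) by (simp only: norm_scaleR abs_of_pos)
    also have "\<dots> < \<eta> + \<gamma> * \<eta>" using v gamma by (intro add_strict_mono) auto
    also have "\<dots> = (1 + \<gamma>) * \<eta>" by (simp add: algebra_simps)
    also have "\<dots> \<le> (1 + \<gamma>) * (\<rho> / (1 + \<gamma>))" using gamma(1) by (intro mult_left_mono) (auto simp: \<eta>_def)
    also have "\<dots> = \<rho>" using gamma(1) by simp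
    finally have u: "u \<in> ball ubar \<rho>" by (simp add: dist_norm norm_minus_commute)
    have "(P u, (1 / \<gamma>) *\<^sub>R (u - P u)) \<in> attentive_graph \<epsilon>" using \<rho>(2) u P by blast
    with ex xv have "(1 - \<gamma> * r) * norm (x - P u) \<le> norm (x + \<gamma> *\<^sub>R v - (P u + \<gamma> *\<^sub>R ((1 / \<gamma>) *\<^sub>R (u - P u))))"
      by fast
    also have "\<dots> = 0" using gamma(1) by (simp add: u_def)
    finally show ?thesis using gamma_r by (simp add: u_def mult_le_0_iff)
  qed
  show ?thesis
  proof (rule that[of \<rho> \<eta> P E])
    show "\<eta> > 0" using \<eta>1 \<rho> gamma by (simp add: \<eta>_def)
    show "(1 / (1 - \<gamma> * r))-lipschitz_on (ball ubar \<rho>) P"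
      using exP[OF _ _ P P] gamma_r by (intro lipschitz_onI) (auto simp: dist_norm field_simps)
    show "P ubar = xbar" using prox_near[OF P, of ubar] by simp
    show "E u' \<ge> E u + inner (P u) (u' - u)" if "u \<in> ball ubar \<rho>" "u' \<in> ball ubar \<rho>" for u u'
    proof -
      have "h u' + 1 / (2 * \<gamma>) * (norm (P u' - u'))\<^sup>2 \<le> h u + 1 / (2 * \<gamma>) * (norm (P u - u'))\<^sup>2"
        using P[of u', unfolded prox_iff, rule_format, of "P u"] by (simp add: h)
      then have "\<gamma> * (h u' + 1 / (2 * \<gamma>) * (norm (P u' - u'))\<^sup>2)
          \<le> \<gamma> * (h u + 1 / (2 * \<gamma>) * (norm (P u - u'))\<^sup>2)"
        using gamma(1) by (intro mult_left_mono) auto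
      moreover have "\<gamma> * (t + 1 / (2 * \<gamma>) * N) = \<gamma> * t + N / 2" for t N
        using gamma(1) by (simp add: field_simps)
      ultimately have "\<gamma> * h u' + (norm (P u' - u'))\<^sup>2 / 2 \<le> \<gamma> * h u + (norm (P u - u'))\<^sup>2 / 2"
        by (simp only:)
      moreover have "(norm (y - u'))\<^sup>2 = (norm y)\<^sup>2 - 2 * inner u' y + (norm u')\<^sup>2" for y
        unfolding power2_norm_eq_inner by (simp add: inner_diff_left inner_diff_right inner_commute)
      ultimately show ?thesis
        by (simp add: E_def inner_diff_right inner_commute add_divide_distrib diff_divide_distrib)
    qed
  qed (use \<rho> sing prox_subgradient[OF P] inv in auto)
qed

end

section \<open>Proximal subgradients and gradient maps\<close>

text \<open>If the increment exceeded \<open>t * m\<close>, a slightly larger slope \<open>m'\<close> would still be exceeded.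
  Minimise \<open>h y - m' * s + K * (norm (y - z - s *\<^sub>R p))\<^sup>2\<close> over \<open>y\<close> in a ball and \<open>s\<close> in \<open>{0..t}\<close>. For large
  \<open>K\<close> the minimiser stays off the boundary of the ball and off \<open>s = t\<close>. Stationarity in \<open>y\<close> produces a proximal
  subgradient there, and one-sided stationarity in \<open>s\<close> says that its slope along \<open>p\<close> is at least
  \<open>m'\<close>.\<close>

lemma proximal_mean_value_inequality:
  fixes h :: "'a::euclidean_space \<Rightarrow> real"
  assumes lip: "C-lipschitz_on (ball z0 R) h"
    and sub: "\<And>y \<xi> K e. y \<in> ball z0 R \<Longrightarrow> e > 0 \<Longrightarrow>
      (\<forall>y'\<in>ball y e. h y' \<ge> h y + inner \<xi> (y' - y) - K * (norm (y' - y))\<^sup>2) \<Longrightarrow> inner \<xi> p \<le> m"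
    and z: "z \<in> ball z0 R" "z + t *\<^sub>R p \<in> ball z0 R" and t: "t > 0"
  shows "h (z + t *\<^sub>R p) - h z \<le> t * m"
proof (rule ccontr)
  assume neg: "\<not> ?thesis"
  define \<eta> where "\<eta> = h (z + t *\<^sub>R p) - h z - t * m"
  have \<eta>: "\<eta> > 0" using neg by (simp add: \<eta>_def)
  define m' where "m' = m + \<eta> / (2 * t)"
  have m': "m' > m" "h (z + t *\<^sub>R p) - h z - t * m' = \<eta> / 2"
    using \<eta> t by (auto simp: m'_def \<eta>_def field_simps)
  define R1 where "R1 = max (dist z0 z) (dist z0 (z + t *\<^sub>R p))"
  have R1: "R1 < R" using z by (simp add: R1_def)
  define R2 where "R2 = (R1 + R) / 2"
  have R2: "R1 < R2" "R2 < R" using R1 by (auto simp: R2_def)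
  have C: "C \<ge> 0" using lip by (rule lipschitz_on_nonneg)
  \<comment> \<open>The first summand keeps the minimiser away from \<open>s = t\<close>, the second one away from the sphere.\<close>
  define K where "K = C\<^sup>2 / \<eta> + 2 * C / (R2 - R1) + 1"
  have K1: "K \<ge> 1" using C \<eta> R2 by (simp add: K_def)
  have "C < K * (R2 - R1)"
  proof -
    have "2 * C / (R2 - R1) + 1 \<le> K" using C \<eta> by (simp add: K_def)
    from mult_right_mono[OF this, of "R2 - R1"] R2(1)
    have "(2 * C / (R2 - R1) + 1) * (R2 - R1) \<le> K * (R2 - R1)" by simp
    moreover have "(2 * C / (R2 - R1) + 1) * (R2 - R1) = 2 * C + (R2 - R1)"
      using R2(1) by (simp add: distrib_right)
    ultimately have "2 * C + (R2 - R1) \<le> K * (R2 - R1)" by simp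
    then show ?thesis using C R2 by linarith
  qed
  have "C\<^sup>2 + \<eta> \<le> K * \<eta>"
  proof -
    have "C\<^sup>2 / \<eta> + 1 \<le> K" using C \<eta> R2 by (simp add: K_def)
    from mult_right_mono[OF this, of \<eta>] \<eta> have "(C\<^sup>2 / \<eta> + 1) * \<eta> \<le> K * \<eta>" by simp
    moreover have "(C\<^sup>2 / \<eta> + 1) * \<eta> = C\<^sup>2 + \<eta>" using \<eta> by (simp add: distrib_right)
    ultimately show ?thesis by simp
  qed
  have seg: "z + s *\<^sub>R p \<in> cball z0 R1" if "s \<in> {0..t}" for s
  proof -
    have "(1 - s / t) *\<^sub>R z + (s / t) *\<^sub>R (z + t *\<^sub>R p) \<in> cball z0 R1"
      using that t by (intro convexD[OF convex_cball]) (auto simp: R1_def field_simps)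
    moreover have "(1 - s / t) *\<^sub>R z + (s / t) *\<^sub>R (z + t *\<^sub>R p) = z + s *\<^sub>R p"
      using t by (simp add: algebra_simps)
    ultimately show ?thesis by simp
  qed
  have sub2: "cball z0 R2 \<subseteq> ball z0 R" using R2 by auto
  have conth: "continuous_on (cball z0 R2) h"
    using lip sub2 by (meson continuous_on_subset lipschitz_on_continuous_on)
  define f where "f w = h (fst w) - m' * snd w + K * (norm (fst w - z - snd w *\<^sub>R p))\<^sup>2"
    for w :: "'a \<times> real"
  have "continuous_on (cball z0 R2 \<times> {0..t}) f" unfolding f_def
    by (intro continuous_intros continuous_on_compose2[OF conth]) auto
  moreover have "compact (cball z0 R2 \<times> {0..t})" by (intro compact_Times) auto
  moreover have zin: "(z, 0) \<in> cball z0 R2 \<times> {0..t}" using t R2 by (auto simp: R1_def)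
  ultimately obtain w where w: "w \<in> cball z0 R2 \<times> {0..t}"
    "\<And>w'. w' \<in> cball z0 R2 \<times> {0..t} \<Longrightarrow> f w \<le> f w'"
    using continuous_attains_inf by (metis empty_iff)
  define y where "y = fst w"
  define s where "s = snd w"
  have ys: "y \<in> cball z0 R2" "s \<in> {0..t}" using w(1) by (auto simp: y_def s_def)
  define \<Delta> where "\<Delta> = y - z - s *\<^sub>R p"
  have min: "h y - m' * s + K * (norm \<Delta>)\<^sup>2 \<le> h y' - m' * s' + K * (norm (y' - z - s' *\<^sub>R p))\<^sup>2"
    if "y' \<in> cball z0 R2" "s' \<in> {0..t}" for y' s'
    using w(2)[of "(y', s')"] that by (simp add: f_def y_def s_def \<Delta>_def)
  have hlip: "h a - h b \<le> C * norm (a - b)" if "a \<in> cball z0 R2" "b \<in> cball z0 R2" for a b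
    using lipschitz_onD[OF lip subsetD[OF sub2 that(1)] subsetD[OF sub2 that(2)]] by (simp add: dist_norm)
  have seg2: "z + s' *\<^sub>R p \<in> cball z0 R2" if "s' \<in> {0..t}" for s'
    using seg[OF that] R2 by auto
  have "K * (norm \<Delta>)\<^sup>2 \<le> C * norm \<Delta>"
  proof -
    have "h y + K * (norm \<Delta>)\<^sup>2 \<le> h (z + s *\<^sub>R p)" using min[OF seg2[OF ys(2)] ys(2)] by simp
    moreover have "h (z + s *\<^sub>R p) - h y \<le> C * norm \<Delta>"
      using hlip[OF seg2[OF ys(2)] ys(1)] by (simp add: \<Delta>_def norm_minus_commute algebra_simps)
    ultimately show ?thesis by linarith
  qed
  then have "norm \<Delta> * (K * norm \<Delta>) \<le> norm \<Delta> * C" by (simp add: power2_eq_square algebra_simps)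
  then have "K * norm \<Delta> \<le> C" using C by (cases "norm \<Delta> = 0") auto
  then have "K * norm \<Delta> < K * (R2 - R1)" using \<open>C < K * (R2 - R1)\<close> by linarith
  then have \<Delta>small: "norm \<Delta> < R2 - R1" using K1 by simp
  have yin: "y \<in> ball z0 R2"
  proof -
    have "dist z0 y \<le> dist z0 (z + s *\<^sub>R p) + dist (z + s *\<^sub>R p) y" by (rule dist_triangle)
    also have "dist (z + s *\<^sub>R p) y = norm \<Delta>" by (simp add: dist_norm \<Delta>_def norm_minus_commute algebra_simps)
    finally show ?thesis using seg[OF ys(2)] \<Delta>small by simp
  qed
  have "s \<noteq> t"
  proof
    assume st: "s = t"
    have "h y - m' * t + K * (norm \<Delta>)\<^sup>2 \<le> h z" using min[of z 0] zin st by simp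
    moreover have "h (z + t *\<^sub>R p) - h y \<le> C * norm \<Delta>"
      using hlip[OF seg2[OF ys(2)] ys(1)] st by (simp add: \<Delta>_def norm_minus_commute algebra_simps)
    ultimately have "\<eta> / 2 \<le> C * norm \<Delta> - K * (norm \<Delta>)\<^sup>2" using m'(2) by (simp add: mult.commute)
    then have "K * (\<eta> / 2) \<le> K * (C * norm \<Delta> - K * (norm \<Delta>)\<^sup>2)"
      using K1 by (intro mult_left_mono) auto
    also have "\<dots> = C\<^sup>2 / 4 - (K * norm \<Delta> - C / 2)\<^sup>2"
      by (simp add: power2_eq_square algebra_simps)
    also have "\<dots> \<le> C\<^sup>2 / 4" by simp
    finally have "K * \<eta> \<le> C\<^sup>2 / 2" by simp
    then show False using \<open>C\<^sup>2 + \<eta> \<le> K * \<eta>\<close> \<eta> zero_le_power2[of C] by linarith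
  qed
  then have st: "s < t" using ys by simp
  define \<xi> where "\<xi> = (- 2 * K) *\<^sub>R \<Delta>"
  have "inner \<xi> p \<le> m"
  proof (rule sub[of y "R2 - dist z0 y" \<xi> K])
    show "y \<in> ball z0 R" using yin R2 by simp
    show "0 < R2 - dist z0 y" using yin by simp
    show "\<forall>y'\<in>ball y (R2 - dist z0 y). h y' \<ge> h y + inner \<xi> (y' - y) - K * (norm (y' - y))\<^sup>2"
    proof
      fix y' assume y': "y' \<in> ball y (R2 - dist z0 y)"
      have "dist z0 y' \<le> dist z0 y + dist y y'" by (rule dist_triangle)
      then have "y' \<in> cball z0 R2" using y' by simp
      from min[OF this ys(2)]
      have "h y + K * (norm \<Delta>)\<^sup>2 \<le> h y' + K * (norm (y' - z - s *\<^sub>R p))\<^sup>2" by simp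
      also have "y' - z - s *\<^sub>R p = (y' - y) + \<Delta>" by (simp add: \<Delta>_def)
      also have "(norm ((y' - y) + \<Delta>))\<^sup>2 = (norm (y' - y))\<^sup>2 + 2 * inner \<Delta> (y' - y) + (norm \<Delta>)\<^sup>2"
        unfolding power2_norm_eq_inner by (simp add: inner_add_left inner_add_right inner_commute)
      finally show "h y' \<ge> h y + inner \<xi> (y' - y) - K * (norm (y' - y))\<^sup>2"
        by (simp add: \<xi>_def algebra_simps)
    qed
  qed
  moreover have "m' \<le> inner \<xi> p"
  proof (rule field_le_epsilon)
    fix e :: real assume e: "e > 0"
    define B where "B = K * (norm p)\<^sup>2 + 1"
    have B: "B > 0" using K1 by (simp add: B_def add_nonneg_pos)
    define \<tau> where "\<tau> = min (t - s) (e / B)"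
    have \<tau>: "\<tau> > 0" "\<tau> \<le> t - s" "\<tau> * B \<le> e" using st e B
      by (auto simp: \<tau>_def min_def field_simps)
    have "y \<in> cball z0 R2" "s + \<tau> \<in> {0..t}" using ys \<tau> by auto
    from min[OF this]
    have "m' * \<tau> + K * (norm \<Delta>)\<^sup>2 \<le> K * (norm (y - z - (s + \<tau>) *\<^sub>R p))\<^sup>2"
      by (simp add: distrib_left)
    also have "y - z - (s + \<tau>) *\<^sub>R p = \<Delta> - \<tau> *\<^sub>R p" by (simp add: \<Delta>_def algebra_simps)
    also have "(norm (\<Delta> - \<tau> *\<^sub>R p))\<^sup>2 = (norm \<Delta>)\<^sup>2 - 2 * \<tau> * inner \<Delta> p + \<tau>\<^sup>2 * (norm p)\<^sup>2"
      unfolding power2_norm_eq_inner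
      by (simp add: inner_diff_left inner_diff_right inner_commute power2_eq_square algebra_simps)
    finally have "\<tau> * m' \<le> \<tau> * (inner \<xi> p + \<tau> * (K * (norm p)\<^sup>2))"
      by (simp add: \<xi>_def algebra_simps power2_eq_square)
    then have "m' \<le> inner \<xi> p + \<tau> * (K * (norm p)\<^sup>2)" using \<tau>(1) by simp
    also have "\<dots> \<le> inner \<xi> p + \<tau> * B" using \<tau>(1) by (simp add: B_def)
    finally show "m' \<le> inner \<xi> p + e" using \<tau>(3) by linarith
  qed
  ultimately show False using m'(1) by linarith
qed

text \<open>The inequality for \<open>E\<close> makes \<open>P\<close> its gradient, hence the hypothesis \<open>dq\<close> bounds the gradient of
  \<open>z \<mapsto> (E (z + t *\<^sub>R q) - E z) / t - inner c z\<close> by \<open>\<delta>\<close>. As \<open>t\<close> tends to \<open>0\<close> this function tends to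
  \<open>z \<mapsto> inner q (P z) - inner c z\<close>, which inherits the Lipschitz constant \<open>\<delta>\<close>. This replaces the
  symmetry of second derivatives, which need not exist here.\<close>

lemma difference_quotient_symmetry:
  fixes P :: "'a::euclidean_space \<Rightarrow> 'a" and E :: "'a \<Rightarrow> real"
  assumes E: "\<And>u u'. u \<in> ball u0 R \<Longrightarrow> u' \<in> ball u0 R \<Longrightarrow> E u' \<ge> E u + inner (P u) (u' - u)"
    and lip: "L-lipschitz_on (ball u0 R) P"
    and dq: "\<And>z t. z \<in> ball u0 R \<Longrightarrow> z + t *\<^sub>R q \<in> ball u0 R \<Longrightarrow> t > 0 \<Longrightarrow>
      norm (P (z + t *\<^sub>R q) - P z - t *\<^sub>R c) \<le> t * \<delta>"
    and z: "z1 \<in> ball u0 R" "z2 \<in> ball u0 R"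
  shows "\<bar>inner q (P z1 - P z2) - inner c (z1 - z2)\<bar> \<le> \<delta> * norm (z1 - z2)"
proof -
  have gap: "E y - E x - inner (P x) (y - x) \<in> {0..L * (norm (y - x))\<^sup>2}"
    if "x \<in> ball u0 R" "y \<in> ball u0 R" for x y
  proof -
    have "E y - E x - inner (P x) (y - x) \<le> inner (P y - P x) (y - x)"
      using E[OF that(2,1)] by (simp add: inner_diff_left inner_diff_right)
    also have "\<dots> \<le> norm (P y - P x) * norm (y - x)" by (rule norm_cauchy_schwarz)
    also have "\<dots> \<le> (L * norm (y - x)) * norm (y - x)"
      using lipschitz_onD[OF lip that(2,1)] by (intro mult_right_mono) (auto simp: dist_norm)
    finally show ?thesis using E[OF that] by (simp add: power2_eq_square algebra_simps)
  qed
  have L: "L \<ge> 0" using lip by (rule lipschitz_on_nonneg)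
  have der: "(E has_derivative (\<lambda>h. inner (P x) h)) (at x)" if x: "x \<in> ball u0 R" for x
    unfolding has_derivative_at_alt
  proof (intro conjI allI impI)
    show "bounded_linear (inner (P x))" by (rule bounded_linear_inner_right)
    fix e :: real assume e: "e > 0"
    define d where "d = min (R - dist u0 x) (e / (L + 1))"
    have d: "d > 0" using x e L by (simp add: d_def)
    have "norm (E y - E x - inner (P x) (y - x)) \<le> e * norm (y - x)" if y: "norm (y - x) < d" for y
    proof -
      have "dist u0 y \<le> dist u0 x + norm (y - x)"
        using dist_triangle[of u0 y x] by (simp add: dist_norm norm_minus_commute)
      then have "y \<in> ball u0 R" using y by (simp add: d_def)
      from gap[OF x this]
      have "norm (E y - E x - inner (P x) (y - x)) \<le> L * norm (y - x) * norm (y - x)"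
        by (simp add: power2_eq_square algebra_simps)
      also have "L * norm (y - x) \<le> (L + 1) * (e / (L + 1))"
        using y L e by (intro mult_mono) (auto simp: d_def)
      also have "\<dots> = e" using L by simp
      finally show ?thesis by (simp add: mult_right_mono)
    qed
    then show "\<exists>d>0. \<forall>y. norm (y - x) < d \<longrightarrow> norm (E y - E x - inner (P x) (y - x)) \<le> e * norm (y - x)"
      using d by blast
  qed
  define R1 where "R1 = max (dist u0 z1) (dist u0 z2)"
  have R1: "R1 < R" "z1 \<in> cball u0 R1" "z2 \<in> cball u0 R1" using z by (auto simp: R1_def)
  have shift: "z \<in> ball u0 R" "z + t *\<^sub>R q \<in> ball u0 R"
    if "z \<in> cball u0 R1" "t > 0" "t * norm q < R - R1" for z t
  proof -
    show "z \<in> ball u0 R" using that R1 by simp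
    have "dist u0 (z + t *\<^sub>R q) \<le> dist u0 z + dist z (z + t *\<^sub>R q)" by (rule dist_triangle)
    also have "dist z (z + t *\<^sub>R q) = t * norm q" using that by (simp add: dist_norm)
    finally show "z + t *\<^sub>R q \<in> ball u0 R" using that by simp
  qed
  have main: "\<bar>inner q (P z1 - P z2) - inner c (z1 - z2)\<bar> \<le> \<delta> * norm (z1 - z2) + t * (L * (norm q)\<^sup>2)"
    if t: "t > 0" "t * norm q < R - R1" for t
  proof -
    define D where "D x = E (x + t *\<^sub>R q) - E x - t * inner c x" for x
    have "norm (D z1 - D z2) \<le> (t * \<delta>) * norm (z1 - z2)"
    proof (rule differentiable_bound[OF convex_cball[of u0 R1]])
      fix x assume x: "x \<in> cball u0 R1"
      note sh = shift[OF x t]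
      have 1: "((\<lambda>x. E (x + t *\<^sub>R q)) has_derivative (\<lambda>h. inner (P (x + t *\<^sub>R q)) h)) (at x)"
        by (rule has_derivative_compose[where f = "\<lambda>x. x + t *\<^sub>R q" and f' = "\<lambda>h. h", OF _ der[OF sh(2)]])
          (auto intro!: derivative_eq_intros)
      have 2: "((\<lambda>x. t * inner c x) has_derivative (\<lambda>h. t * inner c h)) (at x)"
        by (auto intro!: derivative_eq_intros)
      have "(D has_derivative (\<lambda>h. inner (P (x + t *\<^sub>R q)) h - inner (P x) h - t * inner c h)) (at x)"
        unfolding D_def[abs_def]
        by (intro has_derivative_diff 1 2 der[OF sh(1)])
      also have "(\<lambda>h. inner (P (x + t *\<^sub>R q)) h - inner (P x) h - t * inner c h) =
          (\<lambda>h. inner (P (x + t *\<^sub>R q) - P x - t *\<^sub>R c) h)" by (simp add: inner_diff_left)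
      finally show "(D has_derivative (\<lambda>h. inner (P (x + t *\<^sub>R q) - P x - t *\<^sub>R c) h)) (at x within cball u0 R1)"
        by (rule has_derivative_at_withinI)
      show "onorm (\<lambda>h. inner (P (x + t *\<^sub>R q) - P x - t *\<^sub>R c) h) \<le> t * \<delta>"
      proof (rule onorm_le)
        fix h
        have "norm (inner (P (x + t *\<^sub>R q) - P x - t *\<^sub>R c) h) \<le> norm (P (x + t *\<^sub>R q) - P x - t *\<^sub>R c) * norm h"
          by (simp add: Cauchy_Schwarz_ineq2)
        also have "\<dots> \<le> t * \<delta> * norm h" using dq[OF sh t(1)] by (rule mult_right_mono) simp
        finally show "norm (inner (P (x + t *\<^sub>R q) - P x - t *\<^sub>R c) h) \<le> t * \<delta> * norm h" .
      qed
    qed (use R1 in auto)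
    moreover have "E (x + t *\<^sub>R q) - E x - t * inner q (P x) \<in> {0..t * (t * (L * (norm q)\<^sup>2))}"
      if "x \<in> cball u0 R1" for x
      using gap[OF shift[OF that t]] t by (simp add: inner_commute power_mult_distrib power2_eq_square algebra_simps)
    note this[OF R1(2)] this[OF R1(3)]
    moreover have "t * (inner q (P z1 - P z2) - inner c (z1 - z2)) =
        t * inner q (P z1) - t * inner q (P z2) - t * inner c z1 + t * inner c z2"
      by (simp add: inner_diff_right algebra_simps)
    ultimately have "\<bar>t * (inner q (P z1 - P z2) - inner c (z1 - z2))\<bar>
        \<le> (t * \<delta>) * norm (z1 - z2) + t * (t * (L * (norm q)\<^sup>2))"
      unfolding D_def real_norm_def atLeastAtMost_iff by linarith
    also have "\<dots> = t * (\<delta> * norm (z1 - z2) + t * (L * (norm q)\<^sup>2))" by (simp add: algebra_simps)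
    finally have "t * \<bar>inner q (P z1 - P z2) - inner c (z1 - z2)\<bar>
        \<le> t * (\<delta> * norm (z1 - z2) + t * (L * (norm q)\<^sup>2))"
      using t(1) by (simp add: abs_mult)
    then show ?thesis using t(1) by simp
  qed
  show ?thesis
  proof (rule field_le_epsilon)
    fix e :: real assume e: "e > 0"
    define B where "B = L * (norm q)\<^sup>2 + 1"
    have B: "B > 0" using L by (simp add: B_def add_nonneg_pos)
    define t where "t = min ((R - R1) / (norm q + 1)) (e / B)"
    have nq: "norm q + 1 > 0" using norm_ge_zero[of q] by linarith
    have t: "t > 0" using R1 e B nq by (simp add: t_def)
    have "t * norm q < t * (norm q + 1)" using t by simp
    also have "\<dots> \<le> (R - R1) / (norm q + 1) * (norm q + 1)"
      using nq by (intro mult_right_mono) (auto simp: t_def)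
    also have "\<dots> = R - R1" using nq by simp
    finally have t2: "t * norm q < R - R1" .
    have "t * (L * (norm q)\<^sup>2) \<le> t * B" using t by (simp add: B_def)
    also have "\<dots> \<le> e / B * B" using B by (intro mult_right_mono) (auto simp: t_def)
    also have "\<dots> = e" using B by simp
    finally show "\<bar>inner q (P z1 - P z2) - inner c (z1 - z2)\<bar> \<le> \<delta> * norm (z1 - z2) + e"
      using main[OF t t2] by linarith
  qed
qed

section \<open>Symmetry of the subgradient graph\<close>

text \<open>Semismoothness* speaks about limits of normals along directions. Violations at points tending
  to \<open>(xbar, ybar)\<close> can be normalised, and a limit of the normalised points and normals would be a
  directional normal with nonzero pairing.\<close>

lemma semismooth_star_uniform:
  fixes F :: "'a::euclidean_space \<Rightarrow> 'b::euclidean_space set"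
  assumes ss: "semismooth_star F xbar ybar" and \<epsilon>: "\<epsilon> > 0"
  shows "\<exists>\<delta>>0. \<forall>p n. n \<in> regular_normal_cone (gph F) p \<longrightarrow> norm (p - (xbar, ybar)) < \<delta> \<longrightarrow>
    \<bar>inner n (p - (xbar, ybar))\<bar> \<le> \<epsilon> * norm (p - (xbar, ybar)) * norm n"
proof (rule ccontr)
  assume "\<not> ?thesis"
  then have neg: "\<exists>p n. n \<in> regular_normal_cone (gph F) p \<and> norm (p - (xbar, ybar)) < \<delta> \<and>
    \<epsilon> * norm (p - (xbar, ybar)) * norm n < \<bar>inner n (p - (xbar, ybar))\<bar>" if "\<delta> > 0" for \<delta>
    using that by (meson not_le)
  define pbar where "pbar = (xbar, ybar)"
  have "\<forall>k. \<exists>w. snd w \<in> regular_normal_cone (gph F) (fst w) \<and>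
      norm (fst w - pbar) < inverse (real (Suc k)) \<and>
      \<epsilon> * norm (fst w - pbar) * norm (snd w) < \<bar>inner (snd w) (fst w - pbar)\<bar>"
    using neg[of "inverse (real (Suc _))"] by (auto simp: pbar_def)
  then obtain w where w: "\<And>k. snd (w k) \<in> regular_normal_cone (gph F) (fst (w k))"
    "\<And>k. norm (fst (w k) - pbar) < inverse (real (Suc k))"
    "\<And>k. \<epsilon> * norm (fst (w k) - pbar) * norm (snd (w k)) < \<bar>inner (snd (w k)) (fst (w k) - pbar)\<bar>"
    by metis
  define t where "t k = norm (fst (w k) - pbar)" for k
  define e where "e k = (1 / t k) *\<^sub>R (fst (w k) - pbar)" for k
  define m where "m k = (1 / norm (snd (w k))) *\<^sub>R snd (w k)" for k
  have ne: "fst (w k) - pbar \<noteq> 0" "snd (w k) \<noteq> 0" for k using w(3)[of k] by auto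
  have t: "t k > 0" for k using ne by (simp add: t_def)
  have norm1: "norm (e k) = 1" "norm (m k) = 1" for k using ne[of k] by (auto simp: e_def m_def t_def)
  have mn: "m k \<in> regular_normal_cone (gph F) (pbar + t k *\<^sub>R e k)" for k
    using regular_normal_scale[OF w(1)[of k], of "1 / norm (snd (w k))"] t[of k] by (simp add: m_def e_def)
  have big: "\<epsilon> < \<bar>inner (m k) (e k)\<bar>" for k
  proof -
    have "inner (m k) (e k) = inner (snd (w k)) (fst (w k) - pbar) / (norm (snd (w k)) * t k)"
      by (simp add: m_def e_def)
    then have "\<bar>inner (m k) (e k)\<bar> = \<bar>inner (snd (w k)) (fst (w k) - pbar)\<bar> / (norm (snd (w k)) * t k)"
      using t[of k] by (simp add: abs_mult)
    moreover have "norm (snd (w k)) * t k > 0" using ne[of k] t[of k] by simp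
    ultimately show ?thesis using w(3)[of k] by (simp add: pos_less_divide_eq t_def algebra_simps)
  qed
  have "compact (sphere 0 1 \<times> sphere 0 1 :: (('a \<times> 'b) \<times> ('a \<times> 'b)) set)" by (intro compact_Times) auto
  moreover have "\<forall>k. (e k, m k) \<in> sphere 0 1 \<times> sphere 0 1" using norm1 by simp
  ultimately obtain l \<kappa> where l: "strict_mono (\<kappa> :: nat \<Rightarrow> nat)" "((\<lambda>k. (e k, m k)) \<circ> \<kappa>) \<longlonglongrightarrow> l"
    unfolding compact_def by metis
  obtain d mm where dm: "l = (d, mm)" by (cases l)
  have lim: "(\<lambda>k. e (\<kappa> k)) \<longlonglongrightarrow> d" "(\<lambda>k. m (\<kappa> k)) \<longlonglongrightarrow> mm"
    using tendsto_fst[OF l(2)] tendsto_snd[OF l(2)] by (auto simp: dm comp_def)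
  have "norm (t k) \<le> inverse (real (Suc k))" for k using w(2)[of k] by (simp add: t_def)
  then have "t \<longlonglongrightarrow> 0"
    by (intro Lim_null_comparison[OF _ LIMSEQ_inverse_real_of_nat] always_eventually allI)
  then have t0: "(\<lambda>k. t (\<kappa> k)) \<longlonglongrightarrow> 0" using LIMSEQ_subseq_LIMSEQ[OF _ l(1)] by (auto simp: comp_def)
  have "pbar \<in> gph F" using ss by (simp add: semismooth_star_def pbar_def)
  then have "mm \<in> dir_normal_cone (gph F) pbar d" unfolding dir_normal_cone_def
    using t t0 lim mn by (intro CollectI conjI exI[of _ "\<lambda>k. t (\<kappa> k)"] exI[of _ "\<lambda>k. e (\<kappa> k)"] exI[of _ "\<lambda>k. m (\<kappa> k)"]) auto
  then have "(- snd mm, fst mm) \<in> gph (dir_coderivative F (xbar, ybar) (fst d, snd d))"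
    by (simp add: gph_def dir_coderivative_def pbar_def)
  then have "inner (fst mm) (fst d) = inner (- snd mm) (snd d)"
    using ss unfolding semismooth_star_def by fast
  then have "inner mm d = 0" by (simp add: inner_prod_def)
  moreover have "(\<lambda>k. \<bar>inner (m (\<kappa> k)) (e (\<kappa> k))\<bar>) \<longlonglongrightarrow> \<bar>inner mm d\<bar>"
    by (intro tendsto_intros lim)
  then have "\<epsilon> \<le> \<bar>inner mm d\<bar>" by (rule Lim_bounded2[of _ _ 0]) (use big in \<open>auto intro: less_imp_le\<close>)
  ultimately show False using \<epsilon> by simp
qed

text \<open>A set-valued map whose graph is, near \<open>(xbar, vbar)\<close>, the Lipschitz image of \<open>u = x + \<gamma> *\<^sub>R v\<close> under
  a gradient map \<open>P\<close> with convex potential \<open>E\<close>, and whose regular normals are uniformly almost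
  orthogonal to the displacement from \<open>(xbar, vbar)\<close>.\<close>

locale prox_graph =
  fixes G :: "'a::euclidean_space \<Rightarrow> 'a set" and P :: "'a \<Rightarrow> 'a" and E :: "'a \<Rightarrow> real"
    and xbar vbar :: 'a and \<gamma> \<rho> \<eta> L :: real
  assumes gamma: "\<gamma> > 0" and rho: "\<rho> > 0" and eta: "\<eta> > 0"
    and graph: "\<And>u. u \<in> ball (xbar + \<gamma> *\<^sub>R vbar) \<rho> \<Longrightarrow> (1 / \<gamma>) *\<^sub>R (u - P u) \<in> G (P u)"
    and lip: "L-lipschitz_on (ball (xbar + \<gamma> *\<^sub>R vbar) \<rho>) P"
    and P_base: "P (xbar + \<gamma> *\<^sub>R vbar) = xbar"
    and potential: "\<And>u u'. u \<in> ball (xbar + \<gamma> *\<^sub>R vbar) \<rho> \<Longrightarrow> u' \<in> ball (xbar + \<gamma> *\<^sub>R vbar) \<rho> \<Longrightarrow>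
      E u' \<ge> E u + inner (P u) (u' - u)"
    and resolvent: "\<And>x v. v \<in> G x \<Longrightarrow> norm (x - xbar) < \<eta> \<Longrightarrow> norm (v - vbar) < \<eta> \<Longrightarrow> P (x + \<gamma> *\<^sub>R v) = x"
    and uniform: "\<And>\<epsilon>. \<epsilon> > 0 \<Longrightarrow> \<exists>\<delta>>0. \<forall>p n. n \<in> regular_normal_cone (gph G) p \<longrightarrow>
      norm (p - (xbar, vbar)) < \<delta> \<longrightarrow> \<bar>inner n (p - (xbar, vbar))\<bar> \<le> \<epsilon> * norm (p - (xbar, vbar)) * norm n"
begin

abbreviation "ubar \<equiv> xbar + \<gamma> *\<^sub>R vbar"
abbreviation "pbar \<equiv> (xbar, vbar)"
text \<open>\<open>param\<close> and \<open>comb\<close> are the two directions of the Lipschitz parametrization of the graph by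
  \<open>u = x + \<gamma> *\<^sub>R v\<close>.\<close>

definition "param u = (P u, (1 / \<gamma>) *\<^sub>R (u - P u))"
definition "comb p = fst p + \<gamma> *\<^sub>R snd p" for p :: "'a \<times> 'a"

lemma L_nonneg: "L \<ge> 0" using lip by (rule lipschitz_on_nonneg)

lemma comb_param [simp]: "comb (param u) = u"
  using gamma by (simp add: comb_def param_def)

lemma comb_pbar: "comb pbar = ubar" by (simp add: comb_def)

lemma param_ubar: "param ubar = pbar" using gamma by (simp add: param_def P_base)

lemma param_gph: "u \<in> ball ubar \<rho> \<Longrightarrow> param u \<in> gph G"
  using graph by (simp add: param_def gph_def)

lemma param_comb:
  assumes "p \<in> gph G" "norm (p - pbar) < \<eta>" shows "param (comb p) = p"
proof -
  obtain x v where p: "p = (x, v)" by (cases p)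
  have "norm (x - xbar) \<le> norm (p - pbar)" "norm (v - vbar) \<le> norm (p - pbar)"
    using norm_fst_le[of "x - xbar" "v - vbar"] norm_snd_le[of "v - vbar" "x - xbar"] by (auto simp: p)
  then have "P (x + \<gamma> *\<^sub>R v) = x" using assms p by (intro resolvent) (auto simp: gph_def)
  then show ?thesis using gamma by (simp add: param_def comb_def p)
qed

lemma comb_lipschitz: "norm (comb p - comb p') \<le> (1 + \<gamma>) * norm (p - p')"
proof -
  have "comb p - comb p' = fst (p - p') + \<gamma> *\<^sub>R snd (p - p')" by (simp add: comb_def algebra_simps)
  then have "norm (comb p - comb p') \<le> norm (fst (p - p')) + norm (\<gamma> *\<^sub>R snd (p - p'))"
    by (simp only: norm_triangle_ineq)
  also have "\<dots> \<le> norm (p - p') + \<gamma> * norm (p - p')"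
  proof (intro add_mono)
    show "norm (fst (p - p')) \<le> norm (p - p')" by (metis norm_fst_le prod.collapse)
    have "norm (snd (p - p')) \<le> norm (p - p')" by (metis norm_snd_le prod.collapse)
    then show "norm (\<gamma> *\<^sub>R snd (p - p')) \<le> \<gamma> * norm (p - p')" using gamma by simp
  qed
  finally show ?thesis by (simp add: algebra_simps)
qed

lemma param_lipschitz:
  assumes "u \<in> ball ubar \<rho>" "u' \<in> ball ubar \<rho>"
  shows "norm (param u - param u') \<le> (L + (1 + L) / \<gamma>) * norm (u - u')"
proof -
  have 1: "norm (P u - P u') \<le> L * norm (u - u')" using lipschitz_onD[OF lip assms] by (simp add: dist_norm)
  have "param u - param u' = (P u - P u', (1 / \<gamma>) *\<^sub>R ((u - u') - (P u - P u')))"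
    by (simp add: param_def algebra_simps)
  then have "norm (param u - param u') \<le> norm (P u - P u') + norm ((1 / \<gamma>) *\<^sub>R ((u - u') - (P u - P u')))"
    by (simp only: norm_Pair_le)
  also have "norm ((1 / \<gamma>) *\<^sub>R ((u - u') - (P u - P u'))) \<le> (1 / \<gamma>) * ((1 + L) * norm (u - u'))"
  proof -
    have "norm ((u - u') - (P u - P u')) \<le> (1 + L) * norm (u - u')"
      using 1 norm_triangle_ineq4[of "u - u'" "P u - P u'"] by (simp add: algebra_simps)
    then show ?thesis using gamma by (simp add: divide_right_mono)
  qed
  finally have "norm (param u - param u') \<le> L * norm (u - u') + (1 / \<gamma>) * ((1 + L) * norm (u - u'))"
    using 1 by linarith
  then show ?thesis by (simp add: distrib_right)
qed

text \<open>Test the subgradient inequality in the direction \<open>\<xi>\<close> itself.\<close>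

lemma proximal_slope_bound:
  assumes z: "z \<in> ball ubar \<rho>" and e: "e > 0"
    and sub: "\<forall>z'\<in>ball z e. inner w (P z') \<ge> inner w (P z) + inner \<xi> (z' - z) - K * (norm (z' - z))\<^sup>2"
  shows "norm \<xi> \<le> L * norm w"
proof (rule field_le_epsilon)
  fix \<epsilon>' :: real assume \<epsilon>': "\<epsilon>' > 0"
  define B where "B = \<bar>K\<bar> * norm \<xi> + 1"
  have B: "B > 0" by (simp add: B_def add_nonneg_pos)
  define s where "s = min (min e (\<rho> - dist ubar z) / (norm \<xi> + 1)) (\<epsilon>' / B)"
  have nx: "norm \<xi> + 1 > 0" using norm_ge_zero[of \<xi>] by linarith
  have s: "s > 0" using e z nx B \<epsilon>' by (simp add: s_def)
  have "s * norm \<xi> < s * (norm \<xi> + 1)" using s by simp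
  also have "\<dots> \<le> min e (\<rho> - dist ubar z) / (norm \<xi> + 1) * (norm \<xi> + 1)"
    using nx by (intro mult_right_mono) (auto simp: s_def)
  also have "\<dots> = min e (\<rho> - dist ubar z)" using nx by simp
  finally have sm: "s * norm \<xi> < e" "s * norm \<xi> < \<rho> - dist ubar z" by auto
  define z' where "z' = z + s *\<^sub>R \<xi>"
  have dz: "dist z z' = s * norm \<xi>" using s by (simp add: z'_def dist_norm)
  have z'1: "z' \<in> ball z e" using dz sm by simp
  have z'2: "z' \<in> ball ubar \<rho>" using dz sm dist_triangle[of ubar z' z] by simp
  have "inner \<xi> (z' - z) = s * (norm \<xi>)\<^sup>2" by (simp add: z'_def power2_norm_eq_inner)
  moreover have "inner w (P z' - P z) \<le> norm w * (L * (s * norm \<xi>))"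
  proof -
    have "inner w (P z' - P z) \<le> norm w * norm (P z' - P z)" by (rule norm_cauchy_schwarz)
    also have "\<dots> \<le> norm w * (L * (s * norm \<xi>))"
      using lipschitz_onD[OF lip z'2 z] dz by (intro mult_left_mono) (auto simp: dist_norm dist_commute norm_minus_commute)
    finally show ?thesis .
  qed
  moreover have "K * (norm (z' - z))\<^sup>2 \<le> \<bar>K\<bar> * (s * norm \<xi>)\<^sup>2"
    using dz by (intro mult_mono) (auto simp: dist_norm norm_minus_commute)
  ultimately have "s * (norm \<xi>)\<^sup>2 \<le> norm w * (L * (s * norm \<xi>)) + \<bar>K\<bar> * (s * norm \<xi>)\<^sup>2"
    using sub z'1 by (force simp: inner_diff_right)
  then have "(s * norm \<xi>) * norm \<xi> \<le> (s * norm \<xi>) * (L * norm w + s * (\<bar>K\<bar> * norm \<xi>))"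
    by (simp add: power2_eq_square algebra_simps)
  then have "norm \<xi> \<le> L * norm w + s * (\<bar>K\<bar> * norm \<xi>)"
    using s L_nonneg by (cases "norm \<xi> = 0") auto
  also have "s * (\<bar>K\<bar> * norm \<xi>) \<le> s * B" using s by (simp add: B_def)
  also have "s * B \<le> \<epsilon>' / B * B" using B by (intro mult_right_mono) (auto simp: s_def)
  also have "\<dots> = \<epsilon>'" using B by simp
  finally show "norm \<xi> \<le> L * norm w + \<epsilon>'" by simp
qed

text \<open>With \<open>z = x + \<gamma> *\<^sub>R v\<close> the subgradient inequality for \<open>inner w (P z)\<close> becomes an inequality between
  increments of \<open>x\<close> and \<open>v\<close> along the graph; collecting their coefficients gives the normal.\<close>

lemma proximal_subgradient_regular_normal:
  assumes z: "z \<in> ball ubar \<rho>" "norm (param z - pbar) < \<eta> / 2" and e: "e > 0"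
    and sub: "\<forall>z'\<in>ball z e. inner w (P z') \<ge> inner w (P z) + inner \<xi> (z' - z) - K * (norm (z' - z))\<^sup>2"
  shows "(\<xi> - w, \<gamma> *\<^sub>R \<xi>) \<in> regular_normal_cone (gph G) (param z)"
  unfolding regular_normal_iff
proof (intro conjI allI impI)
  show "param z \<in> gph G" using z(1) by (rule param_gph)
  fix \<epsilon> :: real assume \<epsilon>: "\<epsilon> > 0"
  define B where "B = \<bar>K\<bar> * (1 + \<gamma>)\<^sup>2 + 1"
  have B: "B > 0" by (simp add: B_def add_nonneg_pos)
  define \<delta> where "\<delta> = min (\<eta> / 2) (min (e / (1 + \<gamma>)) (\<epsilon> / B))"
  have \<delta>: "\<delta> > 0" using eta e B \<epsilon> gamma by (simp add: \<delta>_def)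
  have "inner (\<xi> - w, \<gamma> *\<^sub>R \<xi>) (p - param z) \<le> \<epsilon> * norm (p - param z)"
    if p: "p \<in> gph G" "norm (p - param z) < \<delta>" for p
  proof -
    have "norm (p - pbar) \<le> norm (p - param z) + norm (param z - pbar)"
      by (rule dist_triangle[of p pbar "param z", unfolded dist_norm])
    then have "norm (p - pbar) < \<eta>" using p(2) z(2) by (simp add: \<delta>_def)
    from param_comb[OF p(1) this] have pc: "param (comb p) = p" .
    define z' where "z' = comb p"
    have fst_p: "fst p = P z'" using pc by (simp add: z'_def param_def prod_eq_iff)
    have zz: "norm (z' - z) \<le> (1 + \<gamma>) * norm (p - param z)"
      using comb_lipschitz[of p "param z"] by (simp add: z'_def)
    also have "\<dots> < (1 + \<gamma>) * (e / (1 + \<gamma>))" using p(2) gamma by (intro mult_strict_left_mono) (auto simp: \<delta>_def)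
    also have "\<dots> = e" using gamma by simp
    finally have "z' \<in> ball z e" by (simp add: dist_norm norm_minus_commute)
    with sub have s: "inner \<xi> (z' - z) - inner w (P z' - P z) \<le> K * (norm (z' - z))\<^sup>2"
      by (force simp: inner_diff_right)
    have "z' - z = fst (p - param z) + \<gamma> *\<^sub>R snd (p - param z)"
    proof -
      have "z' - z = comb p - comb (param z)" by (simp add: z'_def)
      then show ?thesis by (simp add: comb_def algebra_simps)
    qed
    moreover have "P z' - P z = fst (p - param z)" by (simp add: fst_p param_def)
    ultimately have "inner (\<xi> - w, \<gamma> *\<^sub>R \<xi>) (p - param z) = inner \<xi> (z' - z) - inner w (P z' - P z)"
      by (simp add: inner_prod_def inner_diff_left inner_add_right)
    also note s
    also have "K * (norm (z' - z))\<^sup>2 \<le> \<bar>K\<bar> * ((1 + \<gamma>) * norm (p - param z))\<^sup>2"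
      using zz by (intro mult_mono power_mono) auto
    also have "\<dots> = (\<bar>K\<bar> * (1 + \<gamma>)\<^sup>2 * norm (p - param z)) * norm (p - param z)"
      by (simp add: power2_eq_square algebra_simps)
    also have "\<dots> \<le> \<epsilon> * norm (p - param z)"
    proof (rule mult_right_mono)
      have "\<bar>K\<bar> * (1 + \<gamma>)\<^sup>2 * norm (p - param z) \<le> B * (\<epsilon> / B)"
        using p(2) B by (intro mult_mono) (auto simp: B_def \<delta>_def)
      also have "\<dots> = \<epsilon>" using B by simp
      finally show "\<bar>K\<bar> * (1 + \<gamma>)\<^sup>2 * norm (p - param z) \<le> \<epsilon>" .
    qed simp
    finally show ?thesis .
  qed
  then show "\<exists>\<delta>>0. \<forall>p\<in>gph G. norm (p - param z) < \<delta> \<longrightarrow>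
      inner (\<xi> - w, \<gamma> *\<^sub>R \<xi>) (p - param z) \<le> \<epsilon> * norm (p - param z)" using \<delta> by blast
qed

text \<open>Semismoothness* of the graph, rewritten as a scalar relation for the subgradients of the components
  of \<open>P\<close>: the slope of \<open>inner w \<circ> P\<close> at \<open>z\<close> along \<open>z - ubar\<close> is close to its increment from \<open>ubar\<close> to \<open>z\<close>.\<close>

lemma prox_semismooth:
  assumes \<epsilon>: "\<epsilon> > 0"
  shows "\<exists>\<rho>'>0. \<rho>' \<le> \<rho> \<and> (\<forall>z\<in>ball ubar \<rho>'. \<forall>w \<xi> K e. e > 0 \<longrightarrow>
    (\<forall>z'\<in>ball z e. inner w (P z') \<ge> inner w (P z) + inner \<xi> (z' - z) - K * (norm (z' - z))\<^sup>2) \<longrightarrow>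
    \<bar>inner \<xi> (z - ubar) - inner w (P z - xbar)\<bar> \<le> \<epsilon> * norm w * norm (z - ubar))"
proof -
  define B where "B = L + (1 + L) / \<gamma>"
  define C where "C = L + 1 + \<gamma> * L"
  have B: "B > 0" using L_nonneg gamma by (simp add: B_def add_nonneg_pos)
  have C: "C > 0" using L_nonneg gamma by (simp add: C_def add_pos_nonneg)
  have "\<epsilon> / (B * C) > 0" using \<epsilon> B C by simp
  then obtain \<delta> where \<delta>: "\<delta> > 0" "\<And>p n. n \<in> regular_normal_cone (gph G) p \<Longrightarrow> norm (p - pbar) < \<delta> \<Longrightarrow>
      \<bar>inner n (p - pbar)\<bar> \<le> \<epsilon> / (B * C) * norm (p - pbar) * norm n"
    using uniform by meson
  define \<rho>' where "\<rho>' = min \<rho> (min \<delta> (\<eta> / 2) / B)"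
  have \<rho>': "\<rho>' > 0" "\<rho>' \<le> \<rho>" using rho \<delta> eta B by (auto simp: \<rho>'_def)
  have "\<bar>inner \<xi> (z - ubar) - inner w (P z - xbar)\<bar> \<le> \<epsilon> * norm w * norm (z - ubar)"
    if z: "z \<in> ball ubar \<rho>'" and e: "e > 0"
      and sub: "\<forall>z'\<in>ball z e. inner w (P z') \<ge> inner w (P z) + inner \<xi> (z' - z) - K * (norm (z' - z))\<^sup>2"
    for z w \<xi> K e
  proof -
    have z\<rho>: "z \<in> ball ubar \<rho>" "ubar \<in> ball ubar \<rho>" using z \<rho>' rho by auto
    have pz: "norm (param z - pbar) \<le> B * norm (z - ubar)"
      using param_lipschitz[OF z\<rho>] by (simp add: param_ubar B_def)
    also have "\<dots> < B * (min \<delta> (\<eta> / 2) / B)"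
      using z B by (intro mult_strict_left_mono) (auto simp: \<rho>'_def dist_norm norm_minus_commute)
    also have "\<dots> = min \<delta> (\<eta> / 2)" using B by simp
    finally have pz2: "norm (param z - pbar) < \<delta>" "norm (param z - pbar) < \<eta> / 2" by auto
    define n where "n = (\<xi> - w, \<gamma> *\<^sub>R \<xi>)"
    have n: "n \<in> regular_normal_cone (gph G) (param z)"
      unfolding n_def by (rule proximal_subgradient_regular_normal[OF z\<rho>(1) pz2(2) e sub])
    have \<xi>: "norm \<xi> \<le> L * norm w" by (rule proximal_slope_bound[OF z\<rho>(1) e sub])
    have "norm n \<le> norm (\<xi> - w) + norm (\<gamma> *\<^sub>R \<xi>)" unfolding n_def by (rule norm_Pair_le)
    also have "\<dots> \<le> (norm \<xi> + norm w) + \<gamma> * norm \<xi>" using gamma norm_triangle_ineq4[of \<xi> w] by simp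
    also have "\<dots> \<le> (L * norm w + norm w) + \<gamma> * (L * norm w)"
      using \<xi> gamma by (intro add_mono mult_left_mono) auto
    also have "\<dots> = C * norm w" by (simp add: C_def algebra_simps)
    finally have nn: "norm n \<le> C * norm w" .
    have "z - ubar = fst (param z - pbar) + \<gamma> *\<^sub>R snd (param z - pbar)"
    proof -
      have "z - ubar = comb (param z) - comb pbar" by (simp add: comb_pbar)
      then show ?thesis by (simp add: comb_def algebra_simps)
    qed
    moreover have "inner n d = inner \<xi> (fst d + \<gamma> *\<^sub>R snd d) - inner w (fst d)" for d
      by (simp add: n_def inner_prod_def inner_diff_left inner_add_right)
    moreover have "fst (param z - pbar) = P z - xbar" by (simp add: param_def)
    ultimately have "inner n (param z - pbar) = inner \<xi> (z - ubar) - inner w (P z - xbar)"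
      by (simp only:)
    then have "\<bar>inner \<xi> (z - ubar) - inner w (P z - xbar)\<bar> \<le> \<epsilon> / (B * C) * norm (param z - pbar) * norm n"
      using \<delta>(2)[OF n pz2(1)] by simp
    also have "\<dots> \<le> \<epsilon> / (B * C) * (B * norm (z - ubar)) * (C * norm w)"
      using pz nn \<epsilon> B C by (intro mult_mono) auto
    also have "\<dots> = \<epsilon> * norm w * norm (z - ubar)" using B C by simp
    finally show ?thesis .
  qed
  then show ?thesis using \<rho>' by blast
qed

text \<open>The slopes of \<open>inner w \<circ> P\<close> along \<open>q = u - ubar\<close> are close to \<open>inner w c\<close> at all points near
  \<open>u\<close>, for every unit vector \<open>w\<close>. By the mean value inequality the difference quotients of \<open>P\<close> along
  \<open>q\<close> are close to \<open>c\<close>, and symmetry of the gradient map \<open>P\<close> transposes this: \<open>inner q \<circ> P\<close> is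
  close to the linear function \<open>inner c\<close>.\<close>

lemma prox_symmetry:
  assumes \<epsilon>: "\<epsilon> > 0"
  shows "\<exists>\<rho>'>0. \<rho>' \<le> \<rho> \<and> (\<forall>u\<in>ball ubar \<rho>'. u \<noteq> ubar \<longrightarrow> (\<exists>R>0. \<forall>z1\<in>ball u R. \<forall>z2\<in>ball u R.
    \<bar>inner (u - ubar) (P z1 - P z2) - inner (P u - xbar) (z1 - z2)\<bar>
      \<le> \<epsilon> * norm (u - ubar) * norm (z1 - z2)))"
proof -
  have "\<epsilon> / 2 > 0" using \<epsilon> by simp
  from prox_semismooth[OF this] obtain \<rho>' where \<rho>': "\<rho>' > 0" "\<rho>' \<le> \<rho>" and
    semi: "\<And>z w \<xi> K e. z \<in> ball ubar \<rho>' \<Longrightarrow> e > 0 \<Longrightarrow>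
    (\<forall>z'\<in>ball z e. inner w (P z') \<ge> inner w (P z) + inner \<xi> (z' - z) - K * (norm (z' - z))\<^sup>2) \<Longrightarrow>
    \<bar>inner \<xi> (z - ubar) - inner w (P z - xbar)\<bar> \<le> \<epsilon> / 2 * norm w * norm (z - ubar)" by metis
  have "\<exists>R>0. \<forall>z1\<in>ball u R. \<forall>z2\<in>ball u R.
    \<bar>inner (u - ubar) (P z1 - P z2) - inner (P u - xbar) (z1 - z2)\<bar> \<le> \<epsilon> * norm (u - ubar) * norm (z1 - z2)"
    if u: "u \<in> ball ubar \<rho>'" "u \<noteq> ubar" for u
  proof -
    define q where "q = u - ubar"
    define c where "c = P u - xbar"
    have q: "norm q > 0" using u by (simp add: q_def)
    define B where "B = \<epsilon> / 2 + 2 * L"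
    have B: "B > 0" using \<epsilon> L_nonneg by (simp add: B_def add_pos_nonneg)
    define R where "R = min (\<rho>' - dist ubar u) (\<epsilon> / 2 * norm q / B)"
    have R: "R > 0" using u q B \<epsilon> by (simp add: R_def)
    have RB: "B * R \<le> \<epsilon> / 2 * norm q"
    proof -
      have "B * R \<le> B * (\<epsilon> / 2 * norm q / B)" using B by (intro mult_left_mono) (auto simp: R_def)
      then show ?thesis using B by simp
    qed
    have sub: "ball u R \<subseteq> ball ubar \<rho>'"
    proof
      fix z assume "z \<in> ball u R"
      then show "z \<in> ball ubar \<rho>'" using dist_triangle[of ubar z u] by (simp add: R_def)
    qed
    then have sub2: "ball u R \<subseteq> ball ubar \<rho>" using \<rho>' by fastforce
    have lipR: "L-lipschitz_on (ball u R) P" using lip sub2 by (rule lipschitz_on_subset)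
    have slope: "inner \<xi> q \<le> inner w c + \<epsilon> * norm q"
      if w: "norm w = 1" and z: "z \<in> ball u R" and e: "e > 0"
        and s: "\<forall>z'\<in>ball z e. inner w (P z') \<ge> inner w (P z) + inner \<xi> (z' - z) - K * (norm (z' - z))\<^sup>2"
      for w z \<xi> K e
    proof -
      have zu: "norm (z - u) \<le> R" using z by (simp add: dist_norm norm_minus_commute)
      have 1: "\<bar>inner \<xi> (z - ubar) - inner w (P z - xbar)\<bar> \<le> \<epsilon> / 2 * norm (z - ubar)"
        using semi[OF subsetD[OF sub z] e s] w by simp
      have "norm (z - ubar) \<le> norm (z - u) + norm q"
        unfolding q_def by (rule dist_triangle[of z ubar u, unfolded dist_norm])
      then have "norm (z - ubar) \<le> R + norm q" using zu by linarith
      then have 2: "\<epsilon> / 2 * norm (z - ubar) \<le> \<epsilon> / 2 * R + \<epsilon> / 2 * norm q"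
        using mult_left_mono[of "norm (z - ubar)" "R + norm q" "\<epsilon> / 2"] \<epsilon> by (simp add: distrib_left)
      have "norm \<xi> \<le> L" using proximal_slope_bound[OF subsetD[OF sub2 z] e s] w by simp
      then have 3: "inner \<xi> (u - z) \<le> L * R"
        using norm_cauchy_schwarz[of \<xi> "u - z"] zu L_nonneg mult_mono[of "norm \<xi>" L "norm (u - z)" R]
        by (simp add: norm_minus_commute)
      have "norm (P z - P u) \<le> L * R"
      proof -
        have "norm (P z - P u) \<le> L * norm (z - u)"
          using lipschitz_onD[OF lipR z, of u] R by (simp add: dist_norm)
        also have "\<dots> \<le> L * R" using zu L_nonneg by (rule mult_left_mono)
        finally show ?thesis .
      qed
      then have 4: "inner w (P z - P u) \<le> L * R" using norm_cauchy_schwarz[of w "P z - P u"] w by simp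
      have "inner \<xi> q - inner w c = (inner \<xi> (z - ubar) - inner w (P z - xbar)) + inner \<xi> (u - z) + inner w (P z - P u)"
        by (simp add: q_def c_def inner_diff_right)
      also have "\<dots> \<le> (\<epsilon> / 2 * R + \<epsilon> / 2 * norm q) + L * R + L * R" using 1 2 3 4 by linarith
      also have "\<dots> = B * R + \<epsilon> / 2 * norm q" by (simp add: B_def algebra_simps)
      also have "\<dots> \<le> \<epsilon> * norm q" using RB by simp
      finally show ?thesis by simp
    qed
    have dq: "norm (P (z + t *\<^sub>R q) - P z - t *\<^sub>R c) \<le> t * (\<epsilon> * norm q)"
      if z: "z \<in> ball u R" "z + t *\<^sub>R q \<in> ball u R" and t: "t > 0" for z t
    proof -
      define X where "X = P (z + t *\<^sub>R q) - P z - t *\<^sub>R c"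
      show ?thesis
      proof (cases "X = 0")
        case True then show ?thesis using t \<epsilon> by (simp add: X_def)
      next
        case False
        \<comment> \<open>Testing with the direction of the error turns the scalar inequalities into a norm bound.\<close>
        define w where "w = sgn X"
        have w: "norm w = 1" using False by (simp add: w_def norm_sgn)
        have wX: "inner w X = norm X"
          using False by (simp add: w_def sgn_div_norm power2_norm_eq_inner[symmetric] power2_eq_square)
        have "L-lipschitz_on (ball u R) (\<lambda>z. inner w (P z))"
        proof (rule lipschitz_onI)
          fix x y assume xy: "x \<in> ball u R" "y \<in> ball u R"
          have "dist (inner w (P x)) (inner w (P y)) \<le> norm w * norm (P x - P y)"
            using Cauchy_Schwarz_ineq2[of w "P x - P y"] by (simp add: dist_real_def inner_diff_right)
          then show "dist (inner w (P x)) (inner w (P y)) \<le> L * dist x y"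
            using lipschitz_onD[OF lipR xy] w by (simp add: dist_norm)
        qed (rule L_nonneg)
        then have "inner w (P (z + t *\<^sub>R q)) - inner w (P z) \<le> t * (inner w c + \<epsilon> * norm q)"
          by (rule proximal_mean_value_inequality) (use slope[OF w] z t in auto)
        then have "inner w X \<le> t * (\<epsilon> * norm q)" by (simp add: X_def inner_diff_right algebra_simps)
        then show ?thesis by (simp add: wX flip: X_def)
      qed
    qed
    have potR: "E v' \<ge> E v + inner (P v) (v' - v)" if "v \<in> ball u R" "v' \<in> ball u R" for v v'
      by (rule potential[OF subsetD[OF sub2 that(1)] subsetD[OF sub2 that(2)]])
    have "\<bar>inner q (P z1 - P z2) - inner c (z1 - z2)\<bar> \<le> (\<epsilon> * norm q) * norm (z1 - z2)"
      if "z1 \<in> ball u R" "z2 \<in> ball u R" for z1 z2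
      by (rule difference_quotient_symmetry[where E = E and R = R and ?u0.0 = u and L = L, OF potR lipR dq that])
    then show ?thesis using R by (auto simp: q_def c_def)
  qed
  then show ?thesis using \<rho>' by blast
qed

text \<open>The preceding lemma in coordinates of the graph. Writing \<open>q\<close> and \<open>z1 - z2\<close> through their
  components, the terms \<open>inner (x - xbar) \<Delta>x\<close> cancel and a symplectic form is left: the tangent
  directions of the graph at \<open>p\<close> are almost orthogonal, in this form, to \<open>p - pbar\<close>.\<close>

lemma graph_symmetry:
  assumes \<epsilon>: "\<epsilon> > 0"
  shows "\<exists>\<delta>>0. \<forall>p\<in>gph G. norm (p - pbar) < \<delta> \<longrightarrow> (\<exists>\<tau>>0. \<forall>p1\<in>gph G \<inter> ball p \<tau>. \<forall>p2\<in>gph G \<inter> ball p \<tau>.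
    \<bar>inner (snd p - vbar) (fst p1 - fst p2) - inner (fst p - xbar) (snd p1 - snd p2)\<bar>
      \<le> \<epsilon> * norm (p - pbar) * norm (p1 - p2))"
proof -
  define \<epsilon>1 where "\<epsilon>1 = \<epsilon> * \<gamma> / (1 + \<gamma>)\<^sup>2"
  have g1: "1 + \<gamma> > 0" using gamma by simp
  have "\<epsilon>1 > 0" using \<epsilon> gamma by (simp add: \<epsilon>1_def)
  from prox_symmetry[OF this] obtain \<rho>' where \<rho>': "\<rho>' > 0" "\<rho>' \<le> \<rho>" and
    sym: "\<And>u. u \<in> ball ubar \<rho>' \<Longrightarrow> u \<noteq> ubar \<Longrightarrow> \<exists>R>0. \<forall>z1\<in>ball u R. \<forall>z2\<in>ball u R.
      \<bar>inner (u - ubar) (P z1 - P z2) - inner (P u - xbar) (z1 - z2)\<bar> \<le> \<epsilon>1 * norm (u - ubar) * norm (z1 - z2)"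
    by metis
  define \<delta> where "\<delta> = min (\<eta> / 2) (\<rho>' / (1 + \<gamma>))"
  have \<delta>: "\<delta> > 0" using eta \<rho>' gamma by (simp add: \<delta>_def)
  have "\<exists>\<tau>>0. \<forall>p1\<in>gph G \<inter> ball p \<tau>. \<forall>p2\<in>gph G \<inter> ball p \<tau>.
    \<bar>inner (snd p - vbar) (fst p1 - fst p2) - inner (fst p - xbar) (snd p1 - snd p2)\<bar>
      \<le> \<epsilon> * norm (p - pbar) * norm (p1 - p2)" if p: "p \<in> gph G" "norm (p - pbar) < \<delta>" for p
  proof -
    define u where "u = comb p"
    have pu: "param u = p" unfolding u_def using p eta by (intro param_comb) (auto simp: \<delta>_def)
    have uu: "norm (u - ubar) \<le> (1 + \<gamma>) * norm (p - pbar)"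
      using comb_lipschitz[of p pbar] by (simp add: u_def comb_pbar)
    show ?thesis
    proof (cases "u = ubar")
      case True
      then have "p = pbar" using pu param_ubar by simp
      then show ?thesis by (intro exI[of _ 1]) auto
    next
      case False
      have "(1 + \<gamma>) * norm (p - pbar) < (1 + \<gamma>) * (\<rho>' / (1 + \<gamma>))"
        using p(2) g1 by (intro mult_strict_left_mono) (auto simp: \<delta>_def)
      also have "\<dots> = \<rho>'" using g1 by simp
      finally have "u \<in> ball ubar \<rho>'" using uu by (simp add: dist_norm norm_minus_commute)
      from sym[OF this False] obtain R where R: "R > 0" and
        symR: "\<And>z1 z2. z1 \<in> ball u R \<Longrightarrow> z2 \<in> ball u R \<Longrightarrow>
          \<bar>inner (u - ubar) (P z1 - P z2) - inner (P u - xbar) (z1 - z2)\<bar> \<le> \<epsilon>1 * norm (u - ubar) * norm (z1 - z2)"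
        by metis
      define \<tau> where "\<tau> = min (\<eta> / 2) (R / (1 + \<gamma>))"
      have \<tau>: "\<tau> > 0" using eta R g1 by (simp add: \<tau>_def)
      have near: "comb p' \<in> ball u R \<and> param (comb p') = p'" if p': "p' \<in> gph G \<inter> ball p \<tau>" for p'
      proof
        have d: "norm (p' - p) < \<tau>" using p' by (simp add: dist_norm norm_minus_commute)
        have "norm (comb p' - u) \<le> (1 + \<gamma>) * norm (p' - p)" using comb_lipschitz[of p' p] by (simp add: u_def)
        also have "\<dots> < (1 + \<gamma>) * (R / (1 + \<gamma>))" using d g1 by (intro mult_strict_left_mono) (auto simp: \<tau>_def)
        also have "\<dots> = R" using g1 by simp
        finally show "comb p' \<in> ball u R" by (simp add: dist_norm norm_minus_commute)
        have "norm (p' - pbar) \<le> norm (p' - p) + norm (p - pbar)"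
          by (rule dist_triangle[of p' pbar p, unfolded dist_norm])
        then have "norm (p' - pbar) < \<eta>" using d p(2) by (simp add: \<tau>_def \<delta>_def)
        then show "param (comb p') = p'" using p' by (intro param_comb) auto
      qed
      have "\<bar>inner (snd p - vbar) (fst p1 - fst p2) - inner (fst p - xbar) (snd p1 - snd p2)\<bar>
        \<le> \<epsilon> * norm (p - pbar) * norm (p1 - p2)" if p12: "p1 \<in> gph G \<inter> ball p \<tau>" "p2 \<in> gph G \<inter> ball p \<tau>" for p1 p2
      proof -
        define z1 where "z1 = comb p1"
        define z2 where "z2 = comb p2"
        have Pz: "P z1 = fst p1" "P z2 = fst p2" "P u = fst p"
          using near[OF p12(1)] near[OF p12(2)] pu by (auto simp: z1_def z2_def param_def prod_eq_iff)
        have "u - ubar = (fst p - xbar) + \<gamma> *\<^sub>R (snd p - vbar)" by (simp add: u_def comb_def algebra_simps)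
        moreover have "z1 - z2 = (fst p1 - fst p2) + \<gamma> *\<^sub>R (snd p1 - snd p2)"
          by (simp add: z1_def z2_def comb_def algebra_simps)
        ultimately have "inner (u - ubar) (P z1 - P z2) - inner (P u - xbar) (z1 - z2) =
            \<gamma> * (inner (snd p - vbar) (fst p1 - fst p2) - inner (fst p - xbar) (snd p1 - snd p2))"
          by (simp only: Pz inner_add_left inner_add_right inner_scaleR_left inner_scaleR_right)
            (simp add: algebra_simps)
        then have "\<gamma> * \<bar>inner (snd p - vbar) (fst p1 - fst p2) - inner (fst p - xbar) (snd p1 - snd p2)\<bar> =
            \<bar>inner (u - ubar) (P z1 - P z2) - inner (P u - xbar) (z1 - z2)\<bar>"
          using gamma by (simp add: abs_mult)
        also have "\<dots> \<le> \<epsilon>1 * norm (u - ubar) * norm (z1 - z2)"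
          using symR near[OF p12(1)] near[OF p12(2)] by (simp add: z1_def z2_def)
        also have "\<dots> \<le> \<epsilon>1 * ((1 + \<gamma>) * norm (p - pbar)) * ((1 + \<gamma>) * norm (p1 - p2))"
          using uu comb_lipschitz[of p1 p2] \<open>\<epsilon>1 > 0\<close> g1 by (intro mult_mono) (auto simp: z1_def z2_def)
        also have "\<dots> = (\<epsilon>1 * (1 + \<gamma>)\<^sup>2) * (norm (p - pbar) * norm (p1 - p2))"
          by (simp add: power2_eq_square algebra_simps)
        also have "\<epsilon>1 * (1 + \<gamma>)\<^sup>2 = \<epsilon> * \<gamma>" using g1 by (simp add: \<epsilon>1_def)
        also have "\<epsilon> * \<gamma> * (norm (p - pbar) * norm (p1 - p2)) = \<gamma> * (\<epsilon> * norm (p - pbar) * norm (p1 - p2))"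
          by simp
        finally show ?thesis using gamma by simp
      qed
      then show ?thesis using \<tau> by blast
    qed
  qed
  then show ?thesis using \<delta> by blast
qed

end

section \<open>Error of one Newton step\<close>

text \<open>Put \<open>e = x + d - xbar\<close>. Metric regularity provides, from graph points near \<open>(x, y)\<close>, graph
  displacements \<open>(\<Delta>x, - s *\<^sub>R e)\<close> with \<open>norm \<Delta>x\<close> of order \<open>s * norm e\<close>. The normal \<open>(- y, - d)\<close> gives an
  upper bound for \<open>- inner y \<Delta>x + s * inner d e\<close>, symmetry one for
  \<open>inner y \<Delta>x + s * inner (x - xbar) e\<close>. In the sum the unknown \<open>\<Delta>x\<close> disappears and
  \<open>s * (norm e)\<^sup>2\<close> remains.\<close>

lemma newton_step_estimate:
  fixes F :: "'a::euclidean_space \<Rightarrow> 'a set"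
  assumes mr: "metrically_regular F xbar 0"
    and sym: "\<And>\<epsilon>. \<epsilon> > 0 \<Longrightarrow> \<exists>\<delta>>0. \<forall>p\<in>gph F. norm (p - (xbar, 0)) < \<delta> \<longrightarrow>
      (\<exists>\<tau>>0. \<forall>p1\<in>gph F \<inter> ball p \<tau>. \<forall>p2\<in>gph F \<inter> ball p \<tau>.
        \<bar>inner (snd p) (fst p1 - fst p2) - inner (fst p - xbar) (snd p1 - snd p2)\<bar>
          \<le> \<epsilon> * norm (p - (xbar, 0)) * norm (p1 - p2))"
    and \<epsilon>: "\<epsilon> > 0"
  shows "\<exists>\<delta>>0. \<forall>x y d. norm ((x, y) - (xbar, 0)) < \<delta> \<longrightarrow> - y \<in> coderivative F x y d \<longrightarrow>
    norm (x + d - xbar) \<le> \<epsilon> * norm ((x, y) - (xbar, 0))"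
proof -
  obtain \<mu> U V where \<mu>: "\<mu> > 0" and UV: "open U" "xbar \<in> U" "open V" "0 \<in> V" and
    reg: "\<And>x y. x \<in> U \<Longrightarrow> y \<in> V \<Longrightarrow> edist_set x {z. y \<in> F z} \<le> ereal \<mu> * edist_set y (F x)"
    using mr unfolding metrically_regular_def by auto
  have "open (U \<times> V)" "(xbar, 0) \<in> U \<times> V" using UV by (auto intro: open_Times)
  then obtain r0 where r0: "r0 > 0" "ball (xbar, 0) r0 \<subseteq> U \<times> V" using open_contains_ball by metis
  define B where "B = 2 * \<mu> + 1"
  have B: "B > 0" using \<mu> by (simp add: B_def)
  have "\<epsilon> / B > 0" using \<epsilon> B by simp
  from sym[OF this] obtain \<delta>1 where \<delta>1: "\<delta>1 > 0" and
    key: "\<And>p. p \<in> gph F \<Longrightarrow> norm (p - (xbar, 0)) < \<delta>1 \<Longrightarrow>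
      \<exists>\<tau>>0. \<forall>p1\<in>gph F \<inter> ball p \<tau>. \<forall>p2\<in>gph F \<inter> ball p \<tau>.
        \<bar>inner (snd p) (fst p1 - fst p2) - inner (fst p - xbar) (snd p1 - snd p2)\<bar>
          \<le> \<epsilon> / B * norm (p - (xbar, 0)) * norm (p1 - p2)" by blast
  define \<delta> where "\<delta> = min \<delta>1 (r0 / 2)"
  have \<delta>: "\<delta> > 0" using \<delta>1 r0 by (simp add: \<delta>_def)
  have "norm (x + d - xbar) \<le> \<epsilon> * norm ((x, y) - (xbar, 0))"
    if near: "norm ((x, y) - (xbar, 0)) < \<delta>" and cod: "- y \<in> coderivative F x y d" for x y d
  proof (rule field_le_epsilon)
    fix \<epsilon>' :: real assume \<epsilon>': "\<epsilon>' > 0"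
    define p where "p = (x, y)"
    define N where "N = norm (p - (xbar, 0))"
    define e where "e = x + d - xbar"
    obtain z w where zw: "z \<longlonglongrightarrow> p" "\<And>k. z k \<in> gph F" "w \<longlonglongrightarrow> (- y, - d)"
      "\<And>k. w k \<in> regular_normal_cone (gph F) (z k)" and p: "p \<in> gph F"
      using cod unfolding coderivative_def normal_cone_def p_def by blast
    obtain \<tau> where \<tau>: "\<tau> > 0" and key': "\<And>p1 p2. p1 \<in> gph F \<Longrightarrow> p2 \<in> gph F \<Longrightarrow> dist p p1 < \<tau> \<Longrightarrow> dist p p2 < \<tau> \<Longrightarrow>
        \<bar>inner y (fst p1 - fst p2) - inner (x - xbar) (snd p1 - snd p2)\<bar> \<le> \<epsilon> / B * N * norm (p1 - p2)"
      using key[OF p] near by (auto simp: \<delta>_def p_def N_def Ball_def)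
    \<comment> \<open>Tolerance for replacing the limiting normal at \<open>p\<close> by a regular normal at a nearby point.\<close>
    define \<kappa> where "\<kappa> = \<epsilon>' / (2 * B)"
    have \<kappa>: "\<kappa> > 0" using \<epsilon>' B by (simp add: \<kappa>_def)
    have "\<forall>\<^sub>F k in sequentially. dist (z k) p < min (\<tau> / 2) (r0 / 2)"
      by (rule tendstoD[OF zw(1)]) (use \<tau> r0 in simp)
    moreover have "\<forall>\<^sub>F k in sequentially. dist (w k) (- y, - d) < \<kappa>"
      by (rule tendstoD[OF zw(3) \<kappa>])
    ultimately have "\<forall>\<^sub>F k in sequentially. dist (z k) p < min (\<tau> / 2) (r0 / 2) \<and> dist (w k) (- y, - d) < \<kappa>"
      by eventually_elim simp
    then obtain k where k: "dist (z k) p < \<tau> / 2" "dist (z k) p < r0 / 2" "dist (w k) (- y, - d) < \<kappa>"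
      unfolding eventually_sequentially by auto
    obtain xk yk where zk: "z k = (xk, yk)" by (cases "z k")
    have "dist (xbar, 0) (z k) < r0"
    proof -
      have "dist (xbar, 0) (z k) \<le> dist (xbar, 0) p + dist p (z k)" by (rule dist_triangle)
      moreover have "dist (xbar, 0) p = norm ((x, y) - (xbar, 0))"
        by (simp only: dist_norm p_def norm_minus_commute)
      ultimately show ?thesis using near k(2) by (simp add: \<delta>_def dist_commute)
    qed
    then have "z k \<in> U \<times> V" using r0 by auto
    then have xyk: "xk \<in> U" "yk \<in> V" by (auto simp: zk)
    obtain \<delta>2 where \<delta>2: "\<delta>2 > 0" "\<And>p'. p' \<in> gph F \<Longrightarrow> norm (p' - z k) < \<delta>2 \<Longrightarrow>
        inner (w k) (p' - z k) \<le> \<kappa> * norm (p' - z k)"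
      using zw(4)[of k] \<kappa> unfolding regular_normal_iff by meson
    obtain r1 where r1: "r1 > 0" "ball yk r1 \<subseteq> V" using UV xyk open_contains_ball by metis
    show "norm (x + d - xbar) \<le> \<epsilon> * norm ((x, y) - (xbar, 0)) + \<epsilon>'"
    proof (cases "e = 0")
      case True then show ?thesis using \<epsilon> \<epsilon>' by (simp add: e_def)
    next
      case False
      \<comment> \<open>Bounds the step so that the target value stays in \<open>V\<close> and the new graph point stays close to \<open>z k\<close>.\<close>
      define m where "m = min r1 (min \<delta>2 (\<tau> / 2) / B)"
      have m: "m > 0" using r1 \<delta>2 \<tau> B by (simp add: m_def)
      define s where "s = m / (2 * norm e)"
      have s: "s > 0" using m False by (simp add: s_def)
      have se: "s * norm e = m / 2" using False by (simp add: s_def)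
      define y' where "y' = yk - s *\<^sub>R e"
      have "m \<le> r1" by (simp add: m_def)
      moreover have "dist yk y' = s * norm e" using s by (simp add: y'_def dist_norm)
      ultimately have "dist yk y' < r1" using se m by linarith
      then have "y' \<in> V" using r1 by auto
      have "edist_set y' (F xk) \<le> ereal (dist y' yk)"
        unfolding edist_set_def using zw(2)[of k] by (intro INF_lower) (simp add: zk gph_def)
      also have "dist y' yk = s * norm e" using s by (simp add: y'_def dist_norm)
      finally have "ereal \<mu> * edist_set y' (F xk) \<le> ereal \<mu> * ereal (s * norm e)"
        using \<mu> by (intro ereal_mult_left_mono) auto
      with reg[OF xyk(1) \<open>y' \<in> V\<close>] have "edist_set xk {z. y' \<in> F z} \<le> ereal (\<mu> * (s * norm e))"
        by (auto intro: order_trans)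
      also have "\<dots> < ereal (2 * \<mu> * (s * norm e))" using \<mu> s False by simp
      finally obtain x' where x': "y' \<in> F x'" "dist xk x' < 2 * \<mu> * (s * norm e)"
        unfolding edist_set_def INF_less_iff by auto
      define p' where "p' = (x', y')"
      have p'F: "p' \<in> gph F" using x' by (simp add: p'_def gph_def)
      have dp: "p' - z k = (x' - xk, - s *\<^sub>R e)" by (simp add: p'_def zk y'_def)
      have np: "norm (p' - z k) \<le> B * (s * norm e)"
      proof -
        have "norm (p' - z k) \<le> norm (x' - xk) + norm (- s *\<^sub>R e)" unfolding dp by (rule norm_Pair_le)
        also have "\<dots> \<le> 2 * \<mu> * (s * norm e) + s * norm e"
          using x'(2) s by (simp add: dist_norm norm_minus_commute)
        finally show ?thesis by (simp add: B_def algebra_simps)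
      qed
      have "B * (s * norm e) < min \<delta>2 (\<tau> / 2)"
      proof -
        have "B * (s * norm e) < B * m" using se m B by simp
        also have "\<dots> \<le> B * (min \<delta>2 (\<tau> / 2) / B)" using B by (intro mult_left_mono) (auto simp: m_def)
        finally show ?thesis using B by simp
      qed
      then have small: "norm (p' - z k) < \<delta>2" "norm (p' - z k) < \<tau> / 2" using np by auto
      have "dist p p' < \<tau>"
        using dist_triangle[of p p' "z k"] small(2) k(1) by (simp add: dist_commute dist_norm[of p' "z k"])
      moreover have "dist p (z k) < \<tau>" using k(1) \<tau> by (simp add: dist_commute)
      ultimately have "\<bar>inner y (fst p' - fst (z k)) - inner (x - xbar) (snd p' - snd (z k))\<bar>
          \<le> \<epsilon> / B * N * norm (p' - z k)"
        using key' p'F zw(2) by blast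
      moreover have "fst p' - fst (z k) = x' - xk" "snd p' - snd (z k) = - s *\<^sub>R e"
        using dp by (auto simp flip: fst_diff snd_diff)
      ultimately have i1: "inner y (x' - xk) + s * inner (x - xbar) e \<le> \<epsilon> / B * N * norm (p' - z k)"
        by simp
      have "inner (- y, - d) (p' - z k) = inner (w k) (p' - z k) - inner (w k - (- y, - d)) (p' - z k)"
        by (simp add: inner_diff_left)
      also have "\<dots> \<le> \<kappa> * norm (p' - z k) + norm (w k - (- y, - d)) * norm (p' - z k)"
        using \<delta>2(2)[OF p'F small(1)] norm_cauchy_schwarz[of "- (w k - (- y, - d))" "p' - z k"]
        unfolding inner_minus_left norm_minus_cancel by linarith
      also have "\<dots> \<le> \<kappa> * norm (p' - z k) + \<kappa> * norm (p' - z k)"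
        using k(3) by (intro add_left_mono mult_right_mono) (auto simp: dist_norm)
      finally have i2: "- inner y (x' - xk) + s * inner d e \<le> 2 * \<kappa> * norm (p' - z k)"
        unfolding dp by simp
      have "s * (norm e)\<^sup>2 = s * inner (x - xbar) e + s * inner d e"
        unfolding power2_norm_eq_inner by (simp add: e_def inner_add_left inner_diff_left algebra_simps)
      also have "\<dots> \<le> (\<epsilon> / B * N + 2 * \<kappa>) * norm (p' - z k)" using i1 i2 by (simp add: distrib_right)
      also have "\<dots> \<le> (\<epsilon> / B * N + 2 * \<kappa>) * (B * (s * norm e))"
        using np \<epsilon> B \<kappa> by (intro mult_left_mono) (auto simp: N_def)
      also have "\<dots> = (s * norm e) * (\<epsilon> * N + \<epsilon>')" using B by (simp add: \<kappa>_def field_simps)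
      finally have "(s * norm e) * norm e \<le> (s * norm e) * (\<epsilon> * N + \<epsilon>')"
        by (simp add: power2_eq_square mult.assoc)
      then have "norm e \<le> \<epsilon> * N + \<epsilon>'" using s False by simp
      then show ?thesis by (simp add: e_def N_def p_def)
    qed
  qed
  then show ?thesis using \<delta> by blast
qed

section \<open>Convergence\<close>

lemma contraction_Q_superlinear:
  fixes X :: "nat \<Rightarrow> 'a::real_normed_vector"
  assumes half: "\<And>k. norm (X (Suc k) - xbar) \<le> 1 / 2 * norm (X k - xbar)"
    and super: "\<And>\<epsilon>. \<epsilon> > 0 \<Longrightarrow> \<exists>\<delta>>0. \<forall>k. norm (X k - xbar) < \<delta> \<longrightarrow>
      norm (X (Suc k) - xbar) \<le> \<epsilon> * norm (X k - xbar)"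
  shows "Q_superlinear X xbar"
  unfolding Q_superlinear_def
proof
  have bound: "norm (X k - xbar) \<le> (1 / 2) ^ k * norm (X 0 - xbar)" for k
  proof (induction k)
    case (Suc k)
    then show ?case using half[of k] by simp
  qed simp
  have geometric: "(\<lambda>k. (1 / 2) ^ k * norm (X 0 - xbar)) \<longlonglongrightarrow> 0"
    by (intro tendsto_mult_left_zero LIMSEQ_realpow_zero) auto
  have "(\<lambda>k. X k - xbar) \<longlonglongrightarrow> 0"
    by (rule Lim_null_comparison[OF always_eventually[OF allI, OF bound] geometric])
  then show lim: "X \<longlonglongrightarrow> xbar" by (simp add: LIM_zero_iff)
  show "(\<lambda>k. norm (X (Suc k) - xbar) / norm (X k - xbar)) \<longlonglongrightarrow> 0"
    unfolding tendsto_iff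
  proof (intro allI impI)
    fix e :: real assume e: "e > 0"
    then have "e / 2 > 0" by simp
    from super[OF this] obtain \<delta> where \<delta>: "\<delta> > 0"
      "\<And>k. norm (X k - xbar) < \<delta> \<Longrightarrow> norm (X (Suc k) - xbar) \<le> e / 2 * norm (X k - xbar)" by metis
    have "\<forall>\<^sub>F k in sequentially. dist (X k) xbar < \<delta>" using lim \<delta>(1) by (rule tendstoD)
    then show "\<forall>\<^sub>F k in sequentially. dist (norm (X (Suc k) - xbar) / norm (X k - xbar)) 0 < e"
    proof eventually_elim
      case (elim k)
      then have "norm (X (Suc k) - xbar) \<le> e / 2 * norm (X k - xbar)" using \<delta>(2) by (simp add: dist_norm)
      then have "norm (X (Suc k) - xbar) / norm (X k - xbar) \<le> e / 2"
        using e by (cases "X k = xbar") (auto simp: divide_le_eq)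
      then have "norm (X (Suc k) - xbar) / norm (X k - xbar) < e" using e by linarith
      then show ?case by simp
    qed
  qed
qed

theorem theorem7p8:
  fixes A :: "real^'n^'n" and b xbar :: "real^'n" and \<alpha> r \<gamma> :: real
    and g \<phi> :: "real^'n \<Rightarrow> ereal"
  assumes phi: "\<phi> = composite A b \<alpha> g"
    and A_sym: "transpose A = A"
    and stationary: "0 \<in> subdifferential \<phi> xbar"
    and g_proper: "proper_fun g"
    and g_lsc: "\<forall>x. lsc_at g x"
    and g_prox_bounded: "prox_bounded g"
    and g_prox_regular: "continuously_prox_regular g xbar (- (A *v xbar) - b) r"
    and r_global: "\<forall>x. g x \<ge> g xbar +
          ereal (inner (- (A *v xbar) - b) (x - xbar) - r / 2 * (norm (x - xbar))\<^sup>2)"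
    and solvable: "\<exists>U' V'. open U' \<and> xbar \<in> U' \<and> open V' \<and> 0 \<in> V' \<and>
          (\<forall>(x, v) \<in> gph (subdifferential \<phi>) \<inter> U' \<times> V'.
             \<exists>d. - v \<in> second_subdifferential \<phi> x v d)"
    and metric_reg: "metrically_regular (subdifferential \<phi>) xbar 0"
    and semismooth: "semismooth_star (subdifferential \<phi>) xbar 0"
    and gamma: "0 < \<gamma>" "\<gamma> < 1 / r"
    and nonsingular: "invertible (mat 1 - \<gamma> *\<^sub>R A)"
  shows "\<exists>U. open U \<and> xbar \<in> U \<and>
    (\<forall>x0\<in>U. newton_well_defined A b \<alpha> g \<gamma> x0 \<and>
       (\<forall>X. newton_sequence A b \<alpha> g \<gamma> x0 X \<longrightarrow>
          (\<forall>k. 0 \<in> subdifferential \<phi> (X k) \<longrightarrow> X k = xbar) \<and>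
          ((\<forall>k. 0 \<notin> subdifferential \<phi> (X k)) \<longrightarrow> Q_superlinear X xbar)))"
proof -
  let ?F = "subdifferential \<phi>" and ?G = "subdifferential g"
  define vbar where "vbar = - (A *v xbar) - b"
  have vbar': "vbar = - (A *v xbar + b)" by (simp add: vbar_def)
  have g_minf: "g x \<noteq> -\<infinity>" for x using g_proper by (simp add: proper_fun_def)
  interpret prox_regular_minorant g xbar vbar r \<gamma>
    by unfold_locales (use g_lsc g_minf g_prox_regular r_global gamma in \<open>auto simp: vbar_def\<close>)
  have FG: "v \<in> ?F x \<longleftrightarrow> v - (A *v x + b) \<in> ?G x" for x v
    unfolding phi by (rule subdifferential_composite[OF A_sym g_minf])
  obtain \<rho> \<eta> P E where \<rho>: "\<rho> > 0" and \<eta>: "\<eta> > 0"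
    and Prox_P: "\<And>u. u \<in> ball ubar \<rho> \<Longrightarrow> Prox \<gamma> g u = {P u}"
    and graph_P: "\<And>u. u \<in> ball ubar \<rho> \<Longrightarrow> (1 / \<gamma>) *\<^sub>R (u - P u) \<in> ?G (P u)"
    and lip_P: "(1 / (1 - \<gamma> * r))-lipschitz_on (ball ubar \<rho>) P" and P_ubar: "P ubar = xbar"
    and potential: "\<And>u u'. u \<in> ball ubar \<rho> \<Longrightarrow> u' \<in> ball ubar \<rho> \<Longrightarrow> E u' \<ge> E u + inner (P u) (u' - u)"
    and resolvent: "\<And>x v. v \<in> ?G x \<Longrightarrow> norm (x - xbar) < \<eta> \<Longrightarrow> norm (v - vbar) < \<eta> \<Longrightarrow>
       P (x + \<gamma> *\<^sub>R v) = x"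
    using prox_parametrization by blast
  define L where "L = 1 / (1 - \<gamma> * r)"
  have uniform: "\<exists>\<delta>>0. \<forall>p n. n \<in> regular_normal_cone (gph ?G) p \<longrightarrow>
      norm (p - (xbar, vbar)) < \<delta> \<longrightarrow> \<bar>inner n (p - (xbar, vbar))\<bar> \<le> \<epsilon> * norm (p - (xbar, vbar)) * norm n"
    if "\<epsilon> > 0" for \<epsilon>
    by (rule uniform_semismooth_shear[OF A_sym FG semismooth_star_uniform[OF semismooth] _ that])
      (simp_all add: vbar')
  interpret pg: prox_graph ?G P E xbar vbar \<gamma> \<rho> \<eta> L
    by unfold_locales (fact gamma(1) \<rho> \<eta> uniform resolvent P_ubar[unfolded ubar_def]
        graph_P[unfolded ubar_def] lip_P[unfolded ubar_def, folded L_def] potential[unfolded ubar_def])+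
  have estimate: "\<exists>\<delta>>0. \<forall>x y d. norm ((x, y) - (xbar, 0)) < \<delta> \<longrightarrow> - y \<in> second_subdifferential \<phi> x y d \<longrightarrow>
    norm (x + d - xbar) \<le> \<epsilon> * norm ((x, y) - (xbar, 0))" if "\<epsilon> > 0" for \<epsilon>
    unfolding second_subdifferential_def
    by (rule newton_step_estimate[OF metric_reg
          graph_symmetry_shear[OF A_sym FG pg.graph_symmetry vbar'] that])

  have fwd_bar: "forward_point A b \<gamma> xbar = ubar"
    unfolding forward_point_def ubar_def unfolding vbar' by (simp add: algebra_simps)
  have blA: "bounded_linear (\<lambda>x. A *v x)" by (rule matrix_vector_mul_bounded_linear)
  define a where "a = onorm (\<lambda>x. A *v x)"
  have a: "a \<ge> 0" "\<And>x. norm (A *v x) \<le> a * norm x"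
    unfolding a_def using onorm_pos_le[OF blA] onorm[OF blA] by auto
  define M where "M = 1 + \<gamma> * a"
  have M: "M \<ge> 1" using gamma a by (simp add: M_def)
  have fwd_lip: "norm (forward_point A b \<gamma> x - ubar) \<le> M * norm (x - xbar)" for x
  proof -
    have "forward_point A b \<gamma> x - ubar = (x - xbar) - \<gamma> *\<^sub>R (A *v (x - xbar))"
      unfolding fwd_bar[symmetric] forward_point_def
      by (simp add: matrix_vector_mult_diff_distrib algebra_simps)
    then have "norm (forward_point A b \<gamma> x - ubar) \<le> norm (x - xbar) + norm (\<gamma> *\<^sub>R (A *v (x - xbar)))"
      by (simp only: norm_triangle_ineq4)
    also have "\<dots> \<le> norm (x - xbar) + \<gamma> * (a * norm (x - xbar))"
      using a(2) gamma(1) by (simp add: mult_left_mono)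
    finally show ?thesis by (simp add: M_def algebra_simps)
  qed
  \<comment> \<open>The pair \<open>(prox x, res x)\<close> is the point of the graph of \<open>F\<close> at which the algorithm linearizes.\<close>
  define prox where "prox x = P (forward_point A b \<gamma> x)" for x
  define res where "res x = A *v prox x + b + (1 / \<gamma>) *\<^sub>R (forward_point A b \<gamma> x - prox x)" for x
  define C where "C = (1 + a) * ((L + (1 + L) / \<gamma>) * M)"
  have "L \<ge> 0" by (rule pg.L_nonneg)
  then have C: "C \<ge> 0" using a M gamma by (simp add: C_def)
  have in_ball: "forward_point A b \<gamma> x \<in> ball ubar \<rho>" if "norm (x - xbar) < \<rho> / M" for x
  proof -
    have "M * norm (x - xbar) < M * (\<rho> / M)" using that M by (intro mult_strict_left_mono) auto
    then show ?thesis using fwd_lip[of x] M by (simp add: dist_norm norm_minus_commute)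
  qed
  have res_F: "res x \<in> ?F (prox x)" if "norm (x - xbar) < \<rho> / M" for x
    unfolding FG using graph_P[OF in_ball[OF that]] by (simp add: res_def prox_def)
  have res_near: "norm ((prox x, res x) - (xbar, 0)) \<le> C * norm (x - xbar)"
    if "norm (x - xbar) < \<rho> / M" for x
  proof -
    define u where "u = forward_point A b \<gamma> x"
    have "(prox x, res x) - (xbar, 0) = (fst (pg.param u - (xbar, vbar)),
        snd (pg.param u - (xbar, vbar)) + A *v fst (pg.param u - (xbar, vbar)))"
      by (simp add: pg.param_def res_def prox_def u_def vbar' matrix_vector_mult_diff_distrib)
    then have "norm ((prox x, res x) - (xbar, 0)) \<le> (1 + a) * norm (pg.param u - (xbar, vbar))"
      using shear_norm_bound(1)[OF blA] unfolding a_def by (metis prod.collapse)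
    also have "norm (pg.param u - (xbar, vbar)) \<le> (L + (1 + L) / \<gamma>) * norm (u - ubar)"
      using pg.param_lipschitz[of u ubar] in_ball[OF that] \<rho> pg.param_ubar by (simp add: u_def ubar_def)
    also have "norm (u - ubar) \<le> M * norm (x - xbar)" unfolding u_def by (rule fwd_lip)
    finally show ?thesis using a \<open>L \<ge> 0\<close> gamma(1) by (simp add: C_def mult_left_mono mult.assoc)
  qed
  \<comment> \<open>Passing from \<open>g\<close> to \<open>\<phi>\<close> in the second-order term absorbs \<open>- A d\<close> and leaves the Newton inclusion of \<open>F\<close>.\<close>
  have direction_iff: "d \<in> newton_directions A b g \<gamma> x \<longleftrightarrow>
      - res x \<in> second_subdifferential \<phi> (prox x) (res x) (x - prox x + d)"
    if "norm (x - xbar) < \<rho> / M" for x d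
  proof -
    have 1: "res x - (A *v prox x + b) = (1 / \<gamma>) *\<^sub>R (forward_point A b \<gamma> x - prox x)"
      by (simp add: res_def)
    have "(1 / \<gamma>) *\<^sub>R (forward_point A b \<gamma> x - prox x) = (1 / \<gamma>) *\<^sub>R (x - prox x) - (A *v x + b)"
      using gamma(1) by (simp add: forward_point_def algebra_simps)
    then have 2: "- res x - A *v (x - prox x + d) = - ((1 / \<gamma>) *\<^sub>R (x - prox x)) - A *v d"
      by (simp add: res_def matrix_vector_mult_diff_distrib matrix_vector_right_distrib)
    show ?thesis
      unfolding phi second_subdifferential_composite[OF A_sym g_minf] 1 2 newton_directions_def
      by (simp add: Prox_P[OF in_ball[OF that]] flip: prox_def)
  qed

  have local: "\<exists>\<delta>>0. \<delta> \<le> \<rho> / M \<and> (\<forall>x d. norm (x - xbar) < \<delta> \<longrightarrow> d \<in> newton_directions A b g \<gamma> x \<longrightarrow>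
      norm (x + d - xbar) \<le> \<epsilon> * norm (x - xbar))" if \<epsilon>: "\<epsilon> > 0" for \<epsilon>
  proof -
    have "\<epsilon> / (C + 1) > 0" using \<epsilon> C by simp
    from estimate[OF this] obtain \<delta> where \<delta>: "\<delta> > 0" and
      est: "\<And>x y d. norm ((x, y) - (xbar, 0)) < \<delta> \<Longrightarrow> - y \<in> second_subdifferential \<phi> x y d \<Longrightarrow>
        norm (x + d - xbar) \<le> \<epsilon> / (C + 1) * norm ((x, y) - (xbar, 0))" by metis
    define \<delta>' where "\<delta>' = min (\<rho> / M) (\<delta> / (C + 1))"
    have "norm (x + d - xbar) \<le> \<epsilon> * norm (x - xbar)"
      if x: "norm (x - xbar) < \<delta>'" and d: "d \<in> newton_directions A b g \<gamma> x" for x d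
    proof -
      have x\<rho>: "norm (x - xbar) < \<rho> / M" using x by (simp add: \<delta>'_def)
      note near = res_near[OF x\<rho>]
      have near': "norm ((prox x, res x) - (xbar, 0)) \<le> (C + 1) * norm (x - xbar)"
        using near by (simp add: algebra_simps add_increasing)
      have "(C + 1) * norm (x - xbar) < (C + 1) * (\<delta> / (C + 1))"
        using x C by (intro mult_strict_left_mono) (auto simp: \<delta>'_def)
      then have "norm ((prox x, res x) - (xbar, 0)) < \<delta>" using near' C by simp
      from est[OF this] d[unfolded direction_iff[OF x\<rho>]]
      have "norm (prox x + (x - prox x + d) - xbar) \<le> \<epsilon> / (C + 1) * norm ((prox x, res x) - (xbar, 0))" by blast
      also have "\<dots> \<le> \<epsilon> / (C + 1) * ((C + 1) * norm (x - xbar))"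
        using near' \<epsilon> C by (intro mult_left_mono) auto
      also have "\<dots> = \<epsilon> * norm (x - xbar)" using C by simp
      finally show ?thesis by (simp add: algebra_simps)
    qed
    moreover have "\<delta>' > 0" "\<delta>' \<le> \<rho> / M" using \<delta> \<rho> M C by (auto simp: \<delta>'_def)
    ultimately show ?thesis by blast
  qed

  \<comment> \<open>A stationary point near \<open>xbar\<close> satisfies the Newton inclusion with zero step, hence contracts to \<open>xbar\<close>.\<close>
  have isolated: "\<exists>\<delta>>0. \<forall>x. norm (x - xbar) < \<delta> \<longrightarrow> 0 \<in> ?F x \<longrightarrow> x = xbar"
  proof -
    from estimate[of "1 / 2"] obtain \<delta> where \<delta>: "\<delta> > 0" and
      est: "\<And>x y d. norm ((x, y) - (xbar, 0)) < \<delta> \<Longrightarrow> - y \<in> second_subdifferential \<phi> x y d \<Longrightarrow>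
        norm (x + d - xbar) \<le> 1 / 2 * norm ((x, y) - (xbar, 0))" by auto
    have "x = xbar" if x: "norm (x - xbar) < \<delta>" "0 \<in> ?F x" for x
    proof -
      have "(0, 0) \<in> regular_normal_cone (gph ?F) (x, 0)"
        using x(2) unfolding regular_normal_iff by (auto simp: gph_def zero_prod_def[symmetric] intro!: exI[of _ 1])
      then have "- 0 \<in> second_subdifferential \<phi> x 0 0"
        unfolding second_subdifferential_def coderivative_def
        using regular_normal_in_normal_cone by auto
      from est[OF _ this] x(1) have "norm (x - xbar) \<le> 1 / 2 * norm (x - xbar)" by (simp add: norm_Pair)
      then show ?thesis by simp
    qed
    then show ?thesis using \<delta> by blast
  qed

  have solvable_local: "\<exists>\<delta>>0. \<forall>x. norm (x - xbar) < \<delta> \<longrightarrow> newton_directions A b g \<gamma> x \<noteq> {}"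
  proof -
    obtain U' V' where UV: "open U'" "xbar \<in> U'" "open V'" "0 \<in> V'" and
      solve: "\<And>x v. v \<in> ?F x \<Longrightarrow> x \<in> U' \<Longrightarrow> v \<in> V' \<Longrightarrow> \<exists>d. - v \<in> second_subdifferential \<phi> x v d"
      using solvable by (fastforce simp: gph_def)
    have "open (U' \<times> V')" "(xbar, 0) \<in> U' \<times> V'" using UV by (auto intro: open_Times)
    then obtain s where s: "s > 0" "ball (xbar, 0) s \<subseteq> U' \<times> V'" using open_contains_ball by metis
    define \<delta> where "\<delta> = min (\<rho> / M) (s / (C + 1))"
    have "newton_directions A b g \<gamma> x \<noteq> {}" if x: "norm (x - xbar) < \<delta>" for x
    proof -
      have x\<rho>: "norm (x - xbar) < \<rho> / M" using x by (simp add: \<delta>_def)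
      have "norm ((prox x, res x) - (xbar, 0)) \<le> (C + 1) * norm (x - xbar)"
        using res_near[OF x\<rho>] by (simp add: algebra_simps add_increasing)
      also have "\<dots> < (C + 1) * (s / (C + 1))"
        using x C by (intro mult_strict_left_mono) (auto simp: \<delta>_def)
      also have "\<dots> = s" using C by simp
      finally have "(prox x, res x) \<in> ball (xbar, 0) s"
        unfolding mem_ball by (subst dist_commute) (simp only: dist_norm)
      then have "(prox x, res x) \<in> U' \<times> V'" using s by blast
      then obtain w where "- res x \<in> second_subdifferential \<phi> (prox x) (res x) w"
        using solve res_F[OF x\<rho>] by auto
      then have "w - (x - prox x) \<in> newton_directions A b g \<gamma> x"
        unfolding direction_iff[OF x\<rho>] by simp
      then show ?thesis by blast
    qed
    moreover have "\<delta> > 0" using s \<rho> M C by (simp add: \<delta>_def)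
    ultimately show ?thesis by blast
  qed

  obtain \<delta>1 where \<delta>1: "\<delta>1 > 0" "\<delta>1 \<le> \<rho> / M" and half: "\<And>x d. norm (x - xbar) < \<delta>1 \<Longrightarrow>
      d \<in> newton_directions A b g \<gamma> x \<Longrightarrow> norm (x + d - xbar) \<le> 1 / 2 * norm (x - xbar)"
    using local[of "1 / 2"] by auto
  obtain \<delta>2 where \<delta>2: "\<delta>2 > 0" and iso: "\<And>x. norm (x - xbar) < \<delta>2 \<Longrightarrow> 0 \<in> ?F x \<Longrightarrow> x = xbar"
    using isolated by blast
  obtain \<delta>3 where \<delta>3: "\<delta>3 > 0" and ex_dir: "\<And>x. norm (x - xbar) < \<delta>3 \<Longrightarrow> newton_directions A b g \<gamma> x \<noteq> {}"
    using solvable_local by blast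
  define U where "U = ball xbar (min \<delta>1 (min \<delta>2 \<delta>3))"
  have U: "norm (x - xbar) < \<delta>1" "norm (x - xbar) < \<delta>2" "norm (x - xbar) < \<delta>3" if "x \<in> U" for x
    using that by (auto simp: U_def dist_norm norm_minus_commute)
  have stay: "x + d \<in> U" if "x \<in> U" "d \<in> newton_directions A b g \<gamma> x" for x d
  proof -
    have "norm (x + d - xbar) \<le> norm (x - xbar)"
      using half[OF U(1)[OF that(1)] that(2)] norm_ge_zero[of "x - xbar"] by linarith
    then show ?thesis using U[OF that(1)] by (simp add: U_def dist_norm norm_minus_commute)
  qed
  have "newton_well_defined A b \<alpha> g \<gamma> x0" if x0: "x0 \<in> U" for x0
    unfolding newton_well_defined_def
  proof (intro allI impI, elim conjE)
    fix x assume "newton_iterate A b \<alpha> g \<gamma> x0 x"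
    then have x: "x \<in> U"
      by (induction rule: newton_iterate.induct) (auto intro: x0 stay)
    have "norm (x - xbar) < \<rho> / M" using U(1)[OF x] \<delta>1 by simp
    then show "is_singleton (Prox \<gamma> g (forward_point A b \<gamma> x)) \<and> newton_directions A b g \<gamma> x \<noteq> {}"
      using Prox_P[OF in_ball] ex_dir[OF U(3)[OF x]] by simp
  qed
  moreover have "(\<forall>k. 0 \<in> ?F (X k) \<longrightarrow> X k = xbar) \<and> ((\<forall>k. 0 \<notin> ?F (X k)) \<longrightarrow> Q_superlinear X xbar)"
    if x0: "x0 \<in> U" and X: "newton_sequence A b \<alpha> g \<gamma> x0 X" for x0 X
  proof -
    have X0: "X 0 = x0" using X by (simp add: newton_sequence_def)
    have stop: "X (Suc k) = X k" if "0 \<in> ?F (X k)" for k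
      using X that unfolding newton_sequence_def phi by meson
    have step: "\<exists>d\<in>newton_directions A b g \<gamma> (X k). X (Suc k) = X k + d" if "0 \<notin> ?F (X k)" for k
      using X that unfolding newton_sequence_def phi by meson
    have XU: "X k \<in> U" for k
    proof (induction k)
      case (Suc k)
      then show ?case using stop[of k] step[of k] stay by (cases "0 \<in> ?F (X k)") auto
    qed (simp add: X0 x0)
    have "Q_superlinear X xbar" if run: "\<forall>k. 0 \<notin> ?F (X k)"
    proof (rule contraction_Q_superlinear)
      show "norm (X (Suc k) - xbar) \<le> 1 / 2 * norm (X k - xbar)" for k
        using step[of k] run half[OF U(1)[OF XU]] by auto
      show "\<exists>\<delta>>0. \<forall>k. norm (X k - xbar) < \<delta> \<longrightarrow> norm (X (Suc k) - xbar) \<le> \<epsilon> * norm (X k - xbar)"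
        if \<epsilon>: "\<epsilon> > 0" for \<epsilon>
      proof -
        obtain \<delta> where "\<delta> > 0" "\<And>x d. norm (x - xbar) < \<delta> \<Longrightarrow> d \<in> newton_directions A b g \<gamma> x \<Longrightarrow>
            norm (x + d - xbar) \<le> \<epsilon> * norm (x - xbar)" using local[OF \<epsilon>] by blast
        then show ?thesis using step run by metis
      qed
    qed
    then show ?thesis using iso[OF U(2)[OF XU]] by blast
  qed
  moreover have "open U" "xbar \<in> U" using \<delta>1 \<delta>2 \<delta>3 by (auto simp: U_def)
  ultimately show ?thesis by blast
qed

end
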